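(* In the setting described in the context, assume that conditions $(\mathfrak{M})$, $(H_2)$ and $(H_3)$ (written out in the context) are satisfied for a measurable function $h:\mathbb{S}\to[0,\infty)$. Then for all sufficiently large $a>0$, with the regeneration times and cycle variables constructed from the minorization with parameter $a$, there exists an $\alpha>\mathfrak{r}$ such that $$\mathbb{E}[\check A^\alpha]<\infty,\qquad \mathbb{E}[|\check B|^\alpha]<\infty,\qquad \mathbb{E}[|\check M|^\alpha]<\infty,$$ and, for $\varphi$-almost all $x\in\mathbb{S}$, $$\mathbb{E}_x[\check A_0^\alpha]<\infty,\qquad \mathbb{E}_x[|\check B_0|^\alpha]<\infty,\qquad \mathbb{E}_x[|\check M_0|^\alpha]<\infty.$$
   Context: Setting. $\{X_n\}_{n\ge0}$ is a time-homogeneous Markov chain on a countably generated measurable space $(\mathbb{S},\mathcal{S})$ with transition kernel $P$; it is aperiodic, irreducible with respect to a maximal irreducibility measure $\varphi$, and Harris recurrent. $f:\mathbb{S}\to\mathbb{R}$ is measurable and $\log A_n=f(X_n)$. $\{B_n\}$ is an i.i.d. sequence of real random variables, independent of $\{X_n\}$ (and of the splitting variables $Y_n$ below). Set $S_n=\log A_1+\cdots+\log A_n$, $S_0=0$. For $\varphi$-a.a. initial states $x$ the distribution of $S_n$ is spread out (some convolution power has a nonzero absolutely continuous component) for all $n\ge N(x)$, some positive integer $N(x)$. Notation. $S_n^{(h)}=h(X_1)+\cdots+h(X_n)$; $\mathcal{L}_ah=\{x:h(x)\le a\}$ and $\mathcal{L}_bf=\{x:f(x)\le b\}$; $\Lambda(\alpha)=\limsup_n\frac1n\log\mathbb{E}[e^{\alpha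 S_n}]$; $\Lambda_B(\alpha)=\log\mathbb{E}[|B_1|^\alpha]$; $\boldsymbol{\Lambda}((\alpha,\beta))=\limsup_n\frac1n\log\mathbb{E}[e^{\alpha S_n+\beta S_n^{(h)}}]$. The dependence on the initial state $X_0=x$ is suppressed (values are the common values for $\varphi$-a.a. $x$; finiteness means for $\varphi$-a.a. $x$). $\mathfrak{r}=\sup\{\alpha:\Lambda(\alpha)\le0\}$. Conditions. $(H_2)$ There exist $\alpha>\mathfrak{r}$ and $\beta>0$ with $\boldsymbol{\Lambda}((\alpha,\beta))<\infty$ and $\Lambda_B(\alpha)<\infty$. $(H_3)$ For every $a>0$ there exist sets $E_1,\dots,E_l\in\mathcal{S}$ with $\varphi(E_i)>0$ and a finite constant $D_a$ such that $P(x,E)\le D_a\inf\{\sum_{i=1}^lP(x_i,E):x_i\in E_i\}$ for all $x\in\mathcal{L}_ah$, $E\in\mathcal{S}$. $(\mathfrak{M})$ For every sufficiently large $a>0$ there exist $\delta_a>0$ and a probability measure $\nu_a$ with $\nu_a(\mathcal{L}_ah)>0$ such that $\delta_a\mathbf{1}_{\mathcal{L}_ah}(x)\nu_a(E)\le P(x,E)$ for all $x\in\mathbb{S}$, $E\in\mathcal{S}$. Convention: $\nu_a$ is always chosen (by truncating and renormalizing) to be concentrated on $\mathcal{L}_ah\cap\mathcal{L}_bf$ for some finite $b$. Regeneration times (for fixed $a$). Augment the chain by variables $Y_n$ which are Bernoulli$(\delta_a)$, $Y_n$ independent of $X_0,\dots,X_n,Y_0,\dots,Y_{n-1}$, such that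 given the past up to time $n$: if $X_n=x\in\mathcal{L}_ah$ and $Y_n=1$ then $X_{n+1}\sim\nu_a$; if $X_n=x\in\mathcal{L}_ah$ and $Y_n=0$ then $X_{n+1}\sim(P(x,\cdot)-\delta_a\nu_a)/(1-\delta_a)$; if $X_n=x\notin\mathcal{L}_ah$ then $X_{n+1}\sim P(x,\cdot)$. Then $\{X_n\}$ still has transition kernel $P$. For $i\ge0$ let $T_i-1$ be the $(i+1)$-th time $n\ge1$ with $(X_n,Y_n)\in\mathcal{L}_ah\times\{1\}$, and $T_{-1}=1$. Blocks $\{X_{T_{i-1}},\dots,X_{T_i-1}\}$, $i\ge0$, are independent, and i.i.d. for $i\ge1$. Cycle variables. For $i\ge0$: $\check A_i=A_{T_{i-1}}\cdots A_{T_i-1}$; $\check B_i=B_{T_{i-1}}+A_{T_{i-1}}B_{T_{i-1}+1}+\cdots+(A_{T_{i-1}}\cdots A_{T_i-2})B_{T_i-1}$; $\check M_i=\sup\{B_{T_{i-1}}+A_{T_{i-1}}B_{T_{i-1}+1}+\cdots+(A_{T_{i-1}}\cdots A_{j-1})B_j:T_{i-1}\le j<T_i\}$. The triple $(\check A,\check B,\check M)$ has the common law of $(\check A_i,\check B_i,\check M_i)$, $i\ge1$. $\mathbb{E}_x$ denotes expectation given $X_0=x$. *)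

theory Defs
  imports "HOL-Probability.Probability"
begin

text \<open>A transition kernel on \<open>S\<close> is a measurable map \<open>P \<in> S \<rightarrow>\<^sub>M prob_algebra S\<close>; of
  \<open>S :: 's measure\<close> only the carrier and the sigma-algebra matter.\<close>

definition countably_generated :: "'s measure \<Rightarrow> bool" where
  "countably_generated S \<longleftrightarrow>
    (\<exists>G. countable G \<and> G \<subseteq> Pow (space S) \<and> sets S = sigma_sets (space S) G)"

primrec kernel_power :: "'s measure \<Rightarrow> ('s \<Rightarrow> 's measure) \<Rightarrow> nat \<Rightarrow> 's \<Rightarrow> 's measure" where
  "kernel_power S P 0 x = return S x"
| "kernel_power S P (Suc n) x = P x \<bind> kernel_power S P n"

definition irreducibility_measure :: "'s measure \<Rightarrow> ('s \<Rightarrow> 's measure) \<Rightarrow> 's measure \<Rightarrow> bool" where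
  "irreducibility_measure S P \<psi> \<longleftrightarrow>
     sets \<psi> = sets S \<and> sigma_finite_measure \<psi> \<and> emeasure \<psi> (space S) > 0 \<and>
     (\<forall>E\<in>sets S. emeasure \<psi> E > 0 \<longrightarrow>
        (\<forall>x\<in>space S. \<exists>n\<ge>1. emeasure (kernel_power S P n x) E > 0))"

definition maximal_irreducibility_measure ::
    "'s measure \<Rightarrow> ('s \<Rightarrow> 's measure) \<Rightarrow> 's measure \<Rightarrow> bool" where
  "maximal_irreducibility_measure S P \<phi> \<longleftrightarrow>
     irreducibility_measure S P \<phi> \<and>
     (\<forall>\<psi>. irreducibility_measure S P \<psi> \<longrightarrow> absolutely_continuous \<phi> \<psi>)"

definition kernel_cycle ::
    "'s measure \<Rightarrow> ('s \<Rightarrow> 's measure) \<Rightarrow> 's measure \<Rightarrow> nat \<Rightarrow> (nat \<Rightarrow> 's set) \<Rightarrow> bool" where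
  "kernel_cycle S P \<phi> d D \<longleftrightarrow>
     d \<ge> 1 \<and> (\<forall>i<d. D i \<in> sets S) \<and> disjoint_family_on D {..<d} \<and>
     (\<forall>i<d. \<forall>x\<in>D i. emeasure (P x) (D (Suc i mod d)) = 1) \<and>
     emeasure \<phi> (space S - (\<Union>i<d. D i)) = 0"

text \<open>The period is the largest \<open>d\<close> for which a \<open>d\<close>-cycle exists (the trivial cycle always gives
  \<open>d \<ge> 1\<close>); aperiodic means period 1.\<close>

definition aperiodic :: "'s measure \<Rightarrow> ('s \<Rightarrow> 's measure) \<Rightarrow> 's measure \<Rightarrow> bool" where
  "aperiodic S P \<phi> \<longleftrightarrow> (\<forall>d D. kernel_cycle S P \<phi> d D \<longrightarrow> d = 1)"

definition past :: "'w measure \<Rightarrow> 'z measure \<Rightarrow> (nat \<Rightarrow> 'w \<Rightarrow> 'z) \<Rightarrow> nat \<Rightarrow> 'w measure" where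
  "past M Z W n =
     vimage_algebra (space M) (\<lambda>\<omega>. \<lambda>i\<in>{..n}. W i \<omega>) (Pi\<^sub>M {..n} (\<lambda>_. Z))"

text \<open>The initial condition is stated as a law because singletons need not be measurable.\<close>

definition markov_chain_from ::
    "'s measure \<Rightarrow> ('s \<Rightarrow> 's measure) \<Rightarrow> 's \<Rightarrow> 'w measure \<Rightarrow> (nat \<Rightarrow> 'w \<Rightarrow> 's) \<Rightarrow> bool" where
  "markov_chain_from S P x M X \<longleftrightarrow>
     prob_space M \<and> (\<forall>n. X n \<in> M \<rightarrow>\<^sub>M S) \<and> distr M S (X 0) = return S x \<and>
     (\<forall>n. \<forall>E\<in>sets S. AE \<omega> in M.
        nn_cond_exp M (past M S X n) (\<lambda>\<omega>'. indicator E (X (Suc n) \<omega>')) \<omega>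
          = emeasure (P (X n \<omega>)) E)"

text \<open>Here and below a family \<open>Pr :: 's \<Rightarrow> 'w measure\<close> gives, for each initial state \<open>x\<close>, the
  probability \<open>Pr x\<close> under which the chain \<open>X\<close> starts at \<open>x\<close>.\<close>

definition harris_recurrent ::
    "'s measure \<Rightarrow> 's measure \<Rightarrow> ('s \<Rightarrow> 'w measure) \<Rightarrow> (nat \<Rightarrow> 'w \<Rightarrow> 's) \<Rightarrow> bool" where
  "harris_recurrent S \<phi> Pr X \<longleftrightarrow>
     (\<forall>E\<in>sets S. emeasure \<phi> E > 0 \<longrightarrow>
        (\<forall>x\<in>space S. AE \<omega> in Pr x. \<exists>\<^sub>\<infinity>n. X n \<omega> \<in> E))"

definition additive_sum :: "('s \<Rightarrow> real) \<Rightarrow> (nat \<Rightarrow> 'w \<Rightarrow> 's) \<Rightarrow> nat \<Rightarrow> 'w \<Rightarrow> real" where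
  "additive_sum g X n \<omega> = (\<Sum>i=1..n. g (X i \<omega>))"

primrec convolution_power :: "real measure \<Rightarrow> nat \<Rightarrow> real measure" where
  "convolution_power \<mu> 0 = return borel 0"
| "convolution_power \<mu> (Suc k) = convolution \<mu> (convolution_power \<mu> k)"

definition spread_out :: "real measure \<Rightarrow> bool" where
  "spread_out \<mu> \<longleftrightarrow>
     (\<exists>k\<ge>1. \<exists>\<kappa>. sets \<kappa> = sets borel \<and> absolutely_continuous lborel \<kappa> \<and>
        emeasure \<kappa> UNIV > 0 \<and>
        (\<forall>E\<in>sets borel. emeasure \<kappa> E \<le> emeasure (convolution_power \<mu> k) E))"

definition log_ennreal :: "ennreal \<Rightarrow> ereal" where
  "log_ennreal z =
     (if z = 0 then -\<infinity> else if z = \<infinity> then \<infinity> else ereal (ln (enn2real z)))"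

text \<open>The value taken by \<open>g\<close> at \<open>\<phi>\<close>-almost every initial state.\<close>

definition common_value :: "'s measure \<Rightarrow> ('s \<Rightarrow> ereal) \<Rightarrow> ereal" where
  "common_value \<phi> g = (THE c. AE x in \<phi>. g x = c)"

text \<open>The two-parameter function, with exponent \<open>\<alpha> S\<^sub>n + \<beta> S\<^sub>n\<^sup>(\<^sup>h\<^sup>)\<close>.\<close>

definition Lambda2 ::
    "'s measure \<Rightarrow> ('s \<Rightarrow> 'w measure) \<Rightarrow> (nat \<Rightarrow> 'w \<Rightarrow> 's) \<Rightarrow> ('s \<Rightarrow> real) \<Rightarrow> ('s \<Rightarrow> real)
      \<Rightarrow> real \<Rightarrow> real \<Rightarrow> ereal" where
  "Lambda2 \<phi> Pr X f h \<alpha> \<beta> =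
     common_value \<phi> (\<lambda>x. limsup (\<lambda>n.
       log_ennreal (\<integral>\<^sup>+\<omega>. ennreal (exp (\<alpha> * additive_sum f X n \<omega> + \<beta> * additive_sum h X n \<omega>)) \<partial>Pr x)
         / ereal (real n)))"

definition Lambda ::
    "'s measure \<Rightarrow> ('s \<Rightarrow> 'w measure) \<Rightarrow> (nat \<Rightarrow> 'w \<Rightarrow> 's) \<Rightarrow> ('s \<Rightarrow> real) \<Rightarrow> real \<Rightarrow> ereal" where
  "Lambda \<phi> Pr X f \<alpha> =
     common_value \<phi> (\<lambda>x. limsup (\<lambda>n.
       log_ennreal (\<integral>\<^sup>+\<omega>. ennreal (exp (\<alpha> * additive_sum f X n \<omega>)) \<partial>Pr x)
         / ereal (real n)))"

definition frak_r ::
    "'s measure \<Rightarrow> ('s \<Rightarrow> 'w measure) \<Rightarrow> (nat \<Rightarrow> 'w \<Rightarrow> 's) \<Rightarrow> ('s \<Rightarrow> real) \<Rightarrow> ereal" where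
  "frak_r \<phi> Pr X f = (SUP \<alpha>\<in>{\<alpha>::real. Lambda \<phi> Pr X f \<alpha> \<le> 0}. ereal \<alpha>)"

text \<open>\<open>\<mu>B\<close> is the common law of the \<open>B\<^sub>n\<close>, so this is the logarithm of the absolute \<open>\<alpha>\<close>-moment of \<open>B\<^sub>1\<close>.\<close>

definition LambdaB :: "real measure \<Rightarrow> real \<Rightarrow> ereal" where
  "LambdaB \<mu>B \<alpha> = log_ennreal (\<integral>\<^sup>+b. ennreal (\<bar>b\<bar> powr \<alpha>) \<partial>\<mu>B)"

definition sublevel :: "'s measure \<Rightarrow> ('s \<Rightarrow> real) \<Rightarrow> real \<Rightarrow> 's set" where
  "sublevel S g a = {x \<in> space S. g x \<le> a}"

definition minorization ::
    "'s measure \<Rightarrow> ('s \<Rightarrow> 's measure) \<Rightarrow> ('s \<Rightarrow> real) \<Rightarrow> real \<Rightarrow> real \<Rightarrow> 's measure \<Rightarrow> bool" where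
  "minorization S P h a \<delta> \<nu> \<longleftrightarrow>
     \<delta> > 0 \<and> prob_space \<nu> \<and> sets \<nu> = sets S \<and> emeasure \<nu> (sublevel S h a) > 0 \<and>
     (\<forall>x\<in>space S. \<forall>E\<in>sets S.
        ennreal \<delta> * indicator (sublevel S h a) x * emeasure \<nu> E \<le> emeasure (P x) E)"

definition condition_M :: "'s measure \<Rightarrow> ('s \<Rightarrow> 's measure) \<Rightarrow> ('s \<Rightarrow> real) \<Rightarrow> bool" where
  "condition_M S P h \<longleftrightarrow> (\<forall>\<^sub>F a in at_top. \<exists>\<delta> \<nu>. minorization S P h a \<delta> \<nu>)"

definition condition_H2 ::
    "'s measure \<Rightarrow> ('s \<Rightarrow> 'w measure) \<Rightarrow> (nat \<Rightarrow> 'w \<Rightarrow> 's) \<Rightarrow> ('s \<Rightarrow> real) \<Rightarrow> ('s \<Rightarrow> real)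
      \<Rightarrow> real measure \<Rightarrow> bool" where
  "condition_H2 \<phi> Pr X f h \<mu>B \<longleftrightarrow>
     (\<exists>\<alpha> \<beta>. ereal \<alpha> > frak_r \<phi> Pr X f \<and> \<beta> > 0 \<and>
        Lambda2 \<phi> Pr X f h \<alpha> \<beta> < \<infinity> \<and> LambdaB \<mu>B \<alpha> < \<infinity>)"

definition condition_H3 ::
    "'s measure \<Rightarrow> ('s \<Rightarrow> 's measure) \<Rightarrow> 's measure \<Rightarrow> ('s \<Rightarrow> real) \<Rightarrow> bool" where
  "condition_H3 S P \<phi> h \<longleftrightarrow>
     (\<forall>a>0. \<exists>(l::nat) (Es :: nat \<Rightarrow> 's set) (D::real).
        l \<ge> 1 \<and> (\<forall>i\<in>{1..l}. Es i \<in> sets S \<and> emeasure \<phi> (Es i) > 0) \<and>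
        (\<forall>x\<in>sublevel S h a. \<forall>E\<in>sets S.
           emeasure (P x) E
             \<le> ennreal D * (INF y\<in>(\<Pi>\<^sub>E i\<in>{1..l}. Es i). \<Sum>i=1..l. emeasure (P (y i)) E)))"

text \<open>Conditional probability of \<open>X\<^sub>n\<^sub>+\<^sub>1 \<in> E\<close> given \<open>X\<^sub>n = x\<close>, \<open>Y\<^sub>n = y\<close>, where \<open>L\<close> is the minorized
  set. If \<open>\<delta> = 1\<close> then \<open>Y\<^sub>n = 1\<close> almost surely and the value of the residual quotient is
  irrelevant.\<close>

definition split_transition ::
    "('s \<Rightarrow> 's measure) \<Rightarrow> 's set \<Rightarrow> real \<Rightarrow> 's measure \<Rightarrow> 's \<times> bool \<Rightarrow> 's set \<Rightarrow> ennreal" where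
  "split_transition P L \<delta> \<nu> z E =
     (case z of (x, y) \<Rightarrow>
        if x \<in> L then
          (if y then emeasure \<nu> E
           else (emeasure (P x) E - ennreal \<delta> * emeasure \<nu> E) / ennreal (1 - \<delta>))
        else emeasure (P x) E)"

text \<open>Independence of random elements with different value types (the library's \<open>indep_var\<close>
  requires equal types): the generated sigma-algebras are independent.\<close>

definition indep_elements ::
    "'w measure \<Rightarrow> 'u measure \<Rightarrow> ('w \<Rightarrow> 'u) \<Rightarrow> 'v measure \<Rightarrow> ('w \<Rightarrow> 'v) \<Rightarrow> bool" where
  "indep_elements M MU U MV V \<longleftrightarrow>
     U \<in> M \<rightarrow>\<^sub>M MU \<and> V \<in> M \<rightarrow>\<^sub>M MV \<and>
     prob_space.indep_set M
       (sets (vimage_algebra (space M) U MU)) (sets (vimage_algebra (space M) V MV))"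

text \<open>\<open>Y n \<omega> = True\<close> encodes the value 1 of the Bernoulli variable. The sequence \<open>B\<close> is indexed
  from 1, and is independent of the whole process \<open>(X, Y)\<close>.\<close>

definition split_chain_from ::
    "'s measure \<Rightarrow> ('s \<Rightarrow> 's measure) \<Rightarrow> 's set \<Rightarrow> real \<Rightarrow> 's measure \<Rightarrow> real measure \<Rightarrow> 's
      \<Rightarrow> 'w measure \<Rightarrow> (nat \<Rightarrow> 'w \<Rightarrow> 's) \<Rightarrow> (nat \<Rightarrow> 'w \<Rightarrow> bool) \<Rightarrow> (nat \<Rightarrow> 'w \<Rightarrow> real) \<Rightarrow> bool" where
  "split_chain_from S P L \<delta> \<nu> \<mu>B x M X Y B \<longleftrightarrow>
     prob_space M \<and>
     (\<forall>n. X n \<in> M \<rightarrow>\<^sub>M S) \<and> distr M S (X 0) = return S x \<and>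
     (\<forall>n. distr M (count_space UNIV) (Y n) = measure_pmf (bernoulli_pmf \<delta>)) \<and>
     (\<forall>n. indep_elements M
        (count_space UNIV) (Y n)
        (Pi\<^sub>M {..n} (\<lambda>_. S) \<Otimes>\<^sub>M Pi\<^sub>M {..<n} (\<lambda>_. count_space UNIV))
        (\<lambda>\<omega>. (\<lambda>i\<in>{..n}. X i \<omega>, \<lambda>i\<in>{..<n}. Y i \<omega>))) \<and>
     (\<forall>n. \<forall>E\<in>sets S. AE \<omega> in M.
        nn_cond_exp M (past M (S \<Otimes>\<^sub>M count_space UNIV) (\<lambda>i \<omega>. (X i \<omega>, Y i \<omega>)) n)
            (\<lambda>\<omega>'. indicator E (X (Suc n) \<omega>')) \<omega>
          = split_transition P L \<delta> \<nu> (X n \<omega>, Y n \<omega>) E) \<and>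
     prob_space.indep_vars M (\<lambda>_. borel) B {1..} \<and>
     (\<forall>n\<ge>1. distr M borel (B n) = \<mu>B) \<and>
     indep_elements M
        (Pi\<^sub>M UNIV (\<lambda>_. S \<Otimes>\<^sub>M count_space UNIV)) (\<lambda>\<omega> n. (X n \<omega>, Y n \<omega>))
        (Pi\<^sub>M {1..} (\<lambda>_. borel)) (\<lambda>\<omega>. \<lambda>n\<in>{1..}. B n \<omega>)"

text \<open>\<open>cycle_start L X Y \<omega> i\<close> is \<open>T\<^sub>i\<^sub>-\<^sub>1\<close>: index 0 gives \<open>T\<^sub>-\<^sub>1 = 1\<close>, and \<open>T\<^sub>i - 1\<close> is the \<open>(i+1)\<close>-th time
  \<open>n \<ge> 1\<close> with \<open>(X\<^sub>n, Y\<^sub>n) \<in> L \<times> {1}\<close>. So the \<open>i\<close>-th block is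
  \<open>{cycle_start L X Y \<omega> i..<cycle_start L X Y \<omega> (Suc i)}\<close>.\<close>

primrec cycle_start ::
    "'s set \<Rightarrow> (nat \<Rightarrow> 'w \<Rightarrow> 's) \<Rightarrow> (nat \<Rightarrow> 'w \<Rightarrow> bool) \<Rightarrow> 'w \<Rightarrow> nat \<Rightarrow> nat" where
  "cycle_start L X Y \<omega> 0 = 1"
| "cycle_start L X Y \<omega> (Suc i) = enumerate {n. 1 \<le> n \<and> X n \<omega> \<in> L \<and> Y n \<omega>} i + 1"

text \<open>For a block \<open>{s..<t}\<close> and coefficient sequences \<open>A\<close>, \<open>B\<close>.\<close>

definition perpetuity_sum :: "(nat \<Rightarrow> real) \<Rightarrow> (nat \<Rightarrow> real) \<Rightarrow> nat \<Rightarrow> nat \<Rightarrow> real" where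
  "perpetuity_sum A B s t = (\<Sum>k\<in>{s..<t}. (\<Prod>j\<in>{s..<k}. A j) * B k)"

definition cycle_A ::
    "('s \<Rightarrow> real) \<Rightarrow> 's set \<Rightarrow> (nat \<Rightarrow> 'w \<Rightarrow> 's) \<Rightarrow> (nat \<Rightarrow> 'w \<Rightarrow> bool) \<Rightarrow> nat \<Rightarrow> 'w \<Rightarrow> real" where
  "cycle_A f L X Y i \<omega> =
     (\<Prod>j\<in>{cycle_start L X Y \<omega> i..<cycle_start L X Y \<omega> (Suc i)}. exp (f (X j \<omega>)))"

definition cycle_B ::
    "('s \<Rightarrow> real) \<Rightarrow> 's set \<Rightarrow> (nat \<Rightarrow> 'w \<Rightarrow> 's) \<Rightarrow> (nat \<Rightarrow> 'w \<Rightarrow> bool) \<Rightarrow> (nat \<Rightarrow> 'w \<Rightarrow> real)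
      \<Rightarrow> nat \<Rightarrow> 'w \<Rightarrow> real" where
  "cycle_B f L X Y B i \<omega> =
     perpetuity_sum (\<lambda>j. exp (f (X j \<omega>))) (\<lambda>j. B j \<omega>)
       (cycle_start L X Y \<omega> i) (cycle_start L X Y \<omega> (Suc i))"

definition cycle_M ::
    "('s \<Rightarrow> real) \<Rightarrow> 's set \<Rightarrow> (nat \<Rightarrow> 'w \<Rightarrow> 's) \<Rightarrow> (nat \<Rightarrow> 'w \<Rightarrow> bool) \<Rightarrow> (nat \<Rightarrow> 'w \<Rightarrow> real)
      \<Rightarrow> nat \<Rightarrow> 'w \<Rightarrow> real" where
  "cycle_M f L X Y B i \<omega> =
     (SUP j\<in>{cycle_start L X Y \<omega> i..<cycle_start L X Y \<omega> (Suc i)}.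
        perpetuity_sum (\<lambda>j. exp (f (X j \<omega>))) (\<lambda>j. B j \<omega>) (cycle_start L X Y \<omega> i) (Suc j))"

definition finite_moment :: "real \<Rightarrow> 'w measure \<Rightarrow> ('w \<Rightarrow> real) \<Rightarrow> bool" where
  "finite_moment \<alpha> M Z \<longleftrightarrow> (\<integral>\<^sup>+\<omega>. ennreal (\<bar>Z \<omega>\<bar> powr \<alpha>) \<partial>M) < \<infinity>"

end

theory Submission
  imports Defs
begin

text \<open>At every exponent \<open>\<alpha>\<close> with \<open>\<Lambda> \<alpha> \<le> 0\<close> the renewal equation forces the cycle mass
  \<open>E[A\<^sup>\<alpha>]\<close> to be at most 1, and by monotone convergence this persists at \<open>r = frak_r\<close>. Hence the
  potential \<open>W = \<Sum>\<^sub>n R\<^sub>r\<^sup>n 1\<^sub>L\<close> of the weighted kernel killed at regeneration is finite almost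
  everywhere, and (H3) bounds it on \<open>L = {h \<le> a}\<close>. If \<open>G\<close> denotes the weighted killed kernel of the
  chain observed on \<open>L\<close>, then \<open>G W \<le> W - 1\<close> there, so \<open>W\<close> is a Lyapunov function with a gap. By (H2)
  the excursions away from \<open>L\<close> have light tails when \<open>a\<close> is large, and (H3) makes this uniform on \<open>L\<close>;
  convexity in the log-weight then carries a gap of \<open>1/2\<close> over to some \<open>\<alpha> > r\<close>, with an
  additional factor \<open>e\<^sup>\<epsilon>\<close> per step. This bounds \<open>\<Sum>\<^sub>k e\<^bsup>\<epsilon>k\<^esup> E[(A\<^sub>1 \<cdots> A\<^sub>k)\<^sup>\<alpha>; no regeneration before k]\<close>,
  and \<open>(\<Sum> c\<^sub>k)\<^sup>\<alpha> \<le> const \<cdot> \<Sum> e\<^bsup>\<epsilon>k\<^esup> c\<^sub>k\<^sup>\<alpha>\<close> turns this into the moment bounds of a cycle.\<close>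

section \<open>Weighted transition operators\<close>

text \<open>The obstacle is the step beyond \<open>r\<close>. At \<open>r\<close> only a bound by 1
  on the cycle mass is known, and that alone does not exclude an infinite mass at every larger
  exponent. Between two visits to \<open>L\<close> the weights are under control up to the exponent
  \<open>\<alpha>0\<close> of (H2); what the gap controls is the accumulation over many visits. The
  1 in the gap is the source term \<open>indicator L\<close> of the potential, so it is there even
  when the cycle mass equals 1. Interpolating with weight \<open>t\<close> towards
  \<open>\<alpha>0\<close> costs at most \<open>t * CW * CJ\<close> on \<open>L\<close>, and
  \<open>t\<close> is chosen to make this at most 1/2. The far end of the interpolation has
  log-weight \<open>\<alpha>0 * f + 1\<close>; its summand 1 turns into the gain
  \<open>\<epsilon> = t\<close> per step. All quantities are \<open>ennreal\<close>-valued and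
  potentials are bounded by comparison with supersolutions, so no finiteness has to be known
  beforehand. Almost-everywhere finiteness comes from irreducibility, since the sets where the
  relevant functions are finite are absorbing. Weights are charged at the state that is entered, in
  accordance with S_n beginning at \<open>X 1\<close>.\<close>

definition kop :: "('s \<Rightarrow> 's measure) \<Rightarrow> ('s \<Rightarrow> ennreal) \<Rightarrow> ('s \<Rightarrow> ennreal) \<Rightarrow> 's \<Rightarrow> ennreal" where
  "kop \<kappa> w g x = (\<integral>\<^sup>+y. w y * g y \<partial>\<kappa> x)"

text \<open>Weights are parametrised by a real log-weight, in which the convexity argument takes
  place. They never vanish, which \<open>AE_finite_of_kop_finite\<close> requires.\<close>

definition expw :: "('s \<Rightarrow> real) \<Rightarrow> 's \<Rightarrow> ennreal" where
  "expw u y = ennreal (exp (u y))"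

lemma expw_measurable [measurable]: "u \<in> borel_measurable S \<Longrightarrow> expw u \<in> borel_measurable S"
  unfolding expw_def by measurable

locale subkernel =
  fixes S :: "'s measure" and \<kappa> :: "'s \<Rightarrow> 's measure"
  assumes kernel [measurable]: "\<kappa> \<in> S \<rightarrow>\<^sub>M subprob_algebra S"
begin

lemma sets_kernel: "x \<in> space S \<Longrightarrow> sets (\<kappa> x) = sets S"
  using measurable_space[OF kernel] by (simp add: space_subprob_algebra)

lemma space_kernel: "x \<in> space S \<Longrightarrow> space (\<kappa> x) = space S"
  using sets_kernel sets_eq_imp_space_eq by blast

lemma measurable_kernel: "x \<in> space S \<Longrightarrow> g \<in> borel_measurable S \<Longrightarrow> g \<in> borel_measurable (\<kappa> x)"
  using measurable_cong_sets[OF sets_kernel refl] by blast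

lemma emeasure_kernel_le_1: "x \<in> space S \<Longrightarrow> emeasure (\<kappa> x) A \<le> 1"
  using measurable_space[OF kernel, of x]
  by (simp add: space_subprob_algebra subprob_space.subprob_emeasure_le_1)

lemma kop_measurable [measurable]:
  assumes [measurable]: "w \<in> borel_measurable S" "g \<in> borel_measurable S"
  shows "kop \<kappa> w g \<in> borel_measurable S"
proof -
  have "(\<lambda>x. \<integral>\<^sup>+y. w y * g y \<partial>\<kappa> x) \<in> borel_measurable S"
    by (rule measurable_compose[OF kernel nn_integral_measurable_subprob_algebra]) simp
  then show ?thesis by (simp add: kop_def[abs_def])
qed

lemma kop_funpow_measurable [measurable]:
  assumes [measurable]: "w \<in> borel_measurable S" "g \<in> borel_measurable S"
  shows "(kop \<kappa> w ^^ n) g \<in> borel_measurable S"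
  by (induction n) simp_all

lemma kop_mono:
  assumes "x \<in> space S" "\<And>y. y \<in> space S \<Longrightarrow> w y * g y \<le> w' y * g' y"
  shows "kop \<kappa> w g x \<le> kop \<kappa> w' g' x"
  unfolding kop_def using assms by (intro nn_integral_mono) (auto simp: space_kernel)

lemma kop_cong:
  assumes "x \<in> space S" "\<And>y. y \<in> space S \<Longrightarrow> w y * g y = w' y * g' y"
  shows "kop \<kappa> w g x = kop \<kappa> w' g' x"
  using assms by (intro antisym kop_mono) auto

lemma kop_funpow_mono:
  assumes "x \<in> space S" "\<And>y. y \<in> space S \<Longrightarrow> w y \<le> w' y" "\<And>y. y \<in> space S \<Longrightarrow> g y \<le> g' y"
  shows "(kop \<kappa> w ^^ n) g x \<le> (kop \<kappa> w' ^^ n) g' x"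
  using assms(1)
proof (induction n arbitrary: x)
  case 0 then show ?case using assms(3) by simp
next
  case (Suc n) then show ?case
    by (auto intro!: kop_mono mult_mono assms(2))
qed

lemma kop_add:
  assumes "x \<in> space S" and [measurable]: "w \<in> borel_measurable S" "g \<in> borel_measurable S" "g' \<in> borel_measurable S"
  shows "kop \<kappa> w (\<lambda>y. g y + g' y) x = kop \<kappa> w g x + kop \<kappa> w g' x"
  using assms(1) unfolding kop_def distrib_left
  by (intro nn_integral_add) (auto intro!: measurable_kernel)

lemma kop_cmult:
  assumes "x \<in> space S" and [measurable]: "w \<in> borel_measurable S" "g \<in> borel_measurable S"
  shows "kop \<kappa> w (\<lambda>y. c * g y) x = c * kop \<kappa> w g x"
proof -
  have "kop \<kappa> w (\<lambda>y. c * g y) x = (\<integral>\<^sup>+y. c * (w y * g y) \<partial>\<kappa> x)"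
    unfolding kop_def by (simp add: mult_ac)
  also have "\<dots> = c * kop \<kappa> w g x"
    unfolding kop_def by (rule nn_integral_cmult) (rule measurable_kernel[OF assms(1)], measurable)
  finally show ?thesis .
qed

lemma kop_funpow_cmult:
  assumes "x \<in> space S" and [measurable]: "w \<in> borel_measurable S" "g \<in> borel_measurable S"
  shows "(kop \<kappa> w ^^ n) (\<lambda>y. c * g y) x = c * (kop \<kappa> w ^^ n) g x"
  using assms(1)
proof (induction n arbitrary: x)
  case (Suc n)
  have "(kop \<kappa> w ^^ Suc n) (\<lambda>y. c * g y) x = kop \<kappa> w (\<lambda>y. c * (kop \<kappa> w ^^ n) g y) x"
    using Suc.prems by (simp, intro kop_cong) (auto simp: Suc.IH)
  also have "\<dots> = c * (kop \<kappa> w ^^ Suc n) g x"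
    using Suc.prems by (simp add: kop_cmult)
  finally show ?case .
qed simp

lemma kop_suminf:
  assumes "x \<in> space S" and [measurable]: "w \<in> borel_measurable S" "\<And>n. g n \<in> borel_measurable S"
  shows "kop \<kappa> w (\<lambda>y. \<Sum>n. g n y) x = (\<Sum>n. kop \<kappa> w (g n) x)"
  unfolding kop_def ennreal_suminf_cmult[symmetric]
  by (intro nn_integral_suminf measurable_kernel[OF assms(1)]) measurable

section \<open>Potentials: first-step equation and minimality\<close>

lemma potential_unfold:
  assumes "x \<in> space S" and [measurable]: "w \<in> borel_measurable S" "g \<in> borel_measurable S"
  shows "(\<Sum>n. (kop \<kappa> w ^^ n) g x) = g x + kop \<kappa> w (\<lambda>y. \<Sum>n. (kop \<kappa> w ^^ n) g y) x"
proof -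
  have "(\<Sum>n. (kop \<kappa> w ^^ n) g x) = (kop \<kappa> w ^^ 0) g x + (\<Sum>n. (kop \<kappa> w ^^ Suc n) g x)"
    using suminf_offset[of "\<lambda>n. (kop \<kappa> w ^^ n) g x" 1] by simp
  also have "(\<Sum>n. (kop \<kappa> w ^^ Suc n) g x) = kop \<kappa> w (\<lambda>y. \<Sum>n. (kop \<kappa> w ^^ n) g y) x"
    using assms(1) by (simp add: kop_suminf)
  finally show ?thesis by simp
qed

text \<open>By induction every partial sum of the series stays below \<open>V\<close>. Upper bounds
  on potentials are obtained from this by exhibiting a supersolution \<open>V\<close>, which may
  take the value infinity.\<close>

lemma potential_minimal:
  assumes x: "x \<in> space S" and [measurable]: "w \<in> borel_measurable S" "g \<in> borel_measurable S"
    and V: "\<And>y. y \<in> space S \<Longrightarrow> g y + kop \<kappa> w V y \<le> V y"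
  shows "(\<Sum>n. (kop \<kappa> w ^^ n) g x) \<le> V x"
proof (rule suminf_le_const)
  have "(\<Sum>k<n. (kop \<kappa> w ^^ k) g y) \<le> V y" if "y \<in> space S" for n y
    using that
  proof (induction n arbitrary: y)
    case (Suc n)
    have "(\<Sum>k<Suc n. (kop \<kappa> w ^^ k) g y) = g y + (\<Sum>k<n. kop \<kappa> w ((kop \<kappa> w ^^ k) g) y)"
      unfolding sum.lessThan_Suc_shift by simp
    also have "(\<Sum>k<n. kop \<kappa> w ((kop \<kappa> w ^^ k) g) y) = kop \<kappa> w (\<lambda>z. \<Sum>k<n. (kop \<kappa> w ^^ k) g z) y"
      unfolding kop_def[of _ _ _ y] sum_distrib_left
      by (rule nn_integral_sum[symmetric]) (rule measurable_kernel[OF Suc.prems], measurable)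
    also have "\<dots> \<le> kop \<kappa> w V y"
      using Suc by (intro kop_mono mult_left_mono) auto
    finally show ?case using V[OF Suc.prems] by (meson add_left_mono order_trans)
  qed simp
  then show "(\<Sum>k<n. (kop \<kappa> w ^^ k) g x) \<le> V x" for n using x .
qed simp

text \<open>Convexity of the iterates in the log-weight. The free shift \<open>z\<close> carries the weight already
  collected along the path, so that the pathwise inequality \<open>e\<^bsup>tz\<^esup> \<le> 1 - t + t e\<^bsup>z\<^esup>\<close> survives the
  induction without Hoelder's inequality.\<close>

lemma kop_convex_step:
  fixes u v :: "'s \<Rightarrow> real"
  assumes t: "0 \<le> t" "t \<le> 1"
    and [measurable]: "c \<in> borel_measurable S" "u \<in> borel_measurable S" "v \<in> borel_measurable S"
      "Ft \<in> borel_measurable S" "F0 \<in> borel_measurable S" "F1 \<in> borel_measurable S"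
    and F: "\<And>y z. y \<in> space S \<Longrightarrow>
      ennreal (exp (t * z)) * Ft y \<le> ennreal (1 - t) * F0 y + ennreal (t * exp z) * F1 y"
    and x: "x \<in> space S"
  shows "ennreal (exp (t * z)) * kop \<kappa> (\<lambda>y. c y * expw (\<lambda>y. (1 - t) * u y + t * v y) y) Ft x
    \<le> ennreal (1 - t) * kop \<kappa> (\<lambda>y. c y * expw u y) F0 x
      + ennreal (t * exp z) * kop \<kappa> (\<lambda>y. c y * expw v y) F1 x"
proof -
  have *: "ennreal (exp (t * z)) * (c y * expw (\<lambda>y. (1 - t) * u y + t * v y) y * Ft y)
      \<le> ennreal (1 - t) * (c y * expw u y * F0 y) + ennreal (t * exp z) * (c y * expw v y * F1 y)"
    if y: "y \<in> space S" for y
  proof -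
    have 1: "ennreal (exp (t * z)) * expw (\<lambda>y. (1 - t) * u y + t * v y) y
        = expw u y * ennreal (exp (t * (z + v y - u y)))"
      unfolding expw_def by (simp add: ennreal_mult[symmetric] exp_add[symmetric] algebra_simps)
    have 2: "expw u y * ennreal (t * exp (z + v y - u y)) = ennreal (t * exp z) * expw v y"
      unfolding expw_def using t
      by (simp add: ennreal_mult[symmetric] exp_add exp_diff algebra_simps)
    have "ennreal (exp (t * z)) * (c y * expw (\<lambda>y. (1 - t) * u y + t * v y) y * Ft y)
        = c y * (ennreal (exp (t * z)) * expw (\<lambda>y. (1 - t) * u y + t * v y) y) * Ft y"
      by (simp add: mult_ac)
    also have "\<dots> = c y * expw u y * (ennreal (exp (t * (z + v y - u y))) * Ft y)"
      unfolding 1 by (simp add: mult_ac)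
    also have "\<dots> \<le> c y * expw u y * (ennreal (1 - t) * F0 y + ennreal (t * exp (z + v y - u y)) * F1 y)"
      by (intro mult_left_mono F y) auto
    also have "\<dots> = ennreal (1 - t) * (c y * expw u y * F0 y)
        + c y * (expw u y * ennreal (t * exp (z + v y - u y))) * F1 y"
      by (simp add: distrib_left mult_ac)
    also have "\<dots> = ennreal (1 - t) * (c y * expw u y * F0 y) + ennreal (t * exp z) * (c y * expw v y * F1 y)"
      unfolding 2 by (simp add: mult_ac)
    finally show ?thesis .
  qed
  have "ennreal (exp (t * z)) * kop \<kappa> (\<lambda>y. c y * expw (\<lambda>y. (1 - t) * u y + t * v y) y) Ft x
      \<le> (\<integral>\<^sup>+y. ennreal (exp (t * z)) * (c y * expw (\<lambda>y. (1 - t) * u y + t * v y) y * Ft y) \<partial>\<kappa> x)"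
    unfolding kop_def
    by (subst nn_integral_cmult) (auto intro!: measurable_kernel[OF x])
  also have "\<dots> \<le> (\<integral>\<^sup>+y. ennreal (1 - t) * (c y * expw u y * F0 y)
      + ennreal (t * exp z) * (c y * expw v y * F1 y) \<partial>\<kappa> x)"
    using * x by (intro nn_integral_mono) (auto simp: space_kernel)
  also have "\<dots> = (\<integral>\<^sup>+y. ennreal (1 - t) * (c y * expw u y * F0 y) \<partial>\<kappa> x)
      + (\<integral>\<^sup>+y. ennreal (t * exp z) * (c y * expw v y * F1 y) \<partial>\<kappa> x)"
    by (intro nn_integral_add measurable_kernel[OF x]) measurable
  also have "\<dots> = ennreal (1 - t) * kop \<kappa> (\<lambda>y. c y * expw u y) F0 x
      + ennreal (t * exp z) * kop \<kappa> (\<lambda>y. c y * expw v y) F1 x"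
    unfolding kop_def by (subst (1 2) nn_integral_cmult) (auto intro!: measurable_kernel[OF x])
  finally show ?thesis .
qed

lemma kop_funpow_convex:
  fixes u v :: "'s \<Rightarrow> real"
  assumes t: "0 \<le> t" "t \<le> 1"
    and [measurable]: "c \<in> borel_measurable S" "u \<in> borel_measurable S" "v \<in> borel_measurable S"
      "Ft \<in> borel_measurable S" "F0 \<in> borel_measurable S" "F1 \<in> borel_measurable S"
    and F: "\<And>y z. y \<in> space S \<Longrightarrow>
      ennreal (exp (t * z)) * Ft y \<le> ennreal (1 - t) * F0 y + ennreal (t * exp z) * F1 y"
    and x: "x \<in> space S"
  shows "ennreal (exp (t * z)) * (kop \<kappa> (\<lambda>y. c y * expw (\<lambda>y. (1 - t) * u y + t * v y) y) ^^ n) Ft x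
    \<le> ennreal (1 - t) * (kop \<kappa> (\<lambda>y. c y * expw u y) ^^ n) F0 x
      + ennreal (t * exp z) * (kop \<kappa> (\<lambda>y. c y * expw v y) ^^ n) F1 x"
  using x
proof (induction n arbitrary: x z)
  case 0
  then show ?case using F by simp
next
  case (Suc n)
  have "ennreal (exp (t * z)) * kop \<kappa> (\<lambda>y. c y * expw (\<lambda>y. (1 - t) * u y + t * v y) y)
      ((kop \<kappa> (\<lambda>y. c y * expw (\<lambda>y. (1 - t) * u y + t * v y) y) ^^ n) Ft) x
    \<le> ennreal (1 - t) * kop \<kappa> (\<lambda>y. c y * expw u y) ((kop \<kappa> (\<lambda>y. c y * expw u y) ^^ n) F0) x
      + ennreal (t * exp z) * kop \<kappa> (\<lambda>y. c y * expw v y) ((kop \<kappa> (\<lambda>y. c y * expw v y) ^^ n) F1) x"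
    by (rule kop_convex_step[OF t]) (use Suc in simp_all)
  then show ?case by simp
qed

text \<open>Discounts \<open>exp (- c)\<close> and gains \<open>exp \<epsilon>\<close> per step are
  absorbed into the weight in this way.\<close>

lemma kop_funpow_scale:
  assumes [measurable]: "w \<in> borel_measurable S" "g \<in> borel_measurable S" and x: "x \<in> space S"
  shows "(kop \<kappa> (\<lambda>y. q * w y) ^^ n) g x = q ^ n * (kop \<kappa> w ^^ n) g x"
  using x
proof (induction n arbitrary: x)
  case (Suc n)
  have "(kop \<kappa> (\<lambda>y. q * w y) ^^ Suc n) g x = kop \<kappa> w (\<lambda>y. (q * q ^ n) * (kop \<kappa> w ^^ n) g y) x"
    using Suc.prems by (simp, intro kop_cong) (auto simp: Suc.IH mult_ac)
  also have "\<dots> = (q * q ^ n) * (kop \<kappa> w ^^ Suc n) g x"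
    using Suc.prems by (subst kop_cmult) auto
  finally show ?case by (simp add: mult_ac)
qed simp

lemma kop_funpow_le_power:
  assumes "\<And>y. y \<in> space S \<Longrightarrow> w y \<le> q" "\<And>y. y \<in> space S \<Longrightarrow> g y \<le> r" and x: "x \<in> space S"
  shows "(kop \<kappa> w ^^ n) g x \<le> q ^ n * r"
  using x
proof (induction n arbitrary: x)
  case (Suc n)
  have "(kop \<kappa> w ^^ Suc n) g x \<le> (\<integral>\<^sup>+y. q * (q ^ n * r) \<partial>\<kappa> x)"
    unfolding funpow.simps comp_def kop_def[of _ _ _ x] using Suc assms(1)
    by (intro nn_integral_mono mult_mono) (auto simp: space_kernel)
  also have "\<dots> = q * (q ^ n * r) * emeasure (\<kappa> x) (space (\<kappa> x))"
    by simp
  also have "\<dots> \<le> q * (q ^ n * r) * 1"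
    by (intro mult_left_mono emeasure_kernel_le_1 Suc.prems) auto
  finally show ?case by (simp add: mult_ac)
qed (use assms(2) in simp)

lemma kop_mass_le_1: "x \<in> space S \<Longrightarrow> (kop \<kappa> (\<lambda>_. 1) ^^ n) (\<lambda>_. 1) x \<le> 1"
  using kop_funpow_le_power[of "\<lambda>_. 1" 1 "\<lambda>_. 1" 1 x n] by simp

lemma kop_mass_decreasing:
  "x \<in> space S \<Longrightarrow> (kop \<kappa> (\<lambda>_. 1) ^^ Suc n) (\<lambda>_. 1) x \<le> (kop \<kappa> (\<lambda>_. 1) ^^ n) (\<lambda>_. 1) x"
proof (induction n arbitrary: x)
  case 0 then show ?case using kop_mass_le_1[of x 1] by simp
next
  case (Suc n) then show ?case
    by (simp only: funpow.simps(2)[of "Suc n"] funpow.simps(2)[of n] comp_def) (auto intro!: kop_mono)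
qed

end

lemma exp_le_convex_combination:
  fixes t z :: real assumes "0 \<le> t" "t \<le> 1"
  shows "exp (t * z) \<le> (1 - t) + t * exp z"
  using convex_onD[OF exp_convex, of t 0 z] assms by (simp add: algebra_simps)

section \<open>Irreducibility and growth rates\<close>

lemma kernel_power_measurable:
  assumes [measurable]: "P \<in> S \<rightarrow>\<^sub>M subprob_algebra S"
  shows "kernel_power S P n \<in> S \<rightarrow>\<^sub>M subprob_algebra S"
proof (induction n)
  case 0
  have "(\<lambda>x. return S x) \<in> S \<rightarrow>\<^sub>M subprob_algebra S" by (rule return_measurable)
  then show ?case by (simp cong: measurable_cong)
next
  case (Suc n)
  have "(\<lambda>x. P x \<bind> kernel_power S P n) \<in> S \<rightarrow>\<^sub>M subprob_algebra S"
    by (rule measurable_bind2[OF assms Suc])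
  then show ?case by (simp cong: measurable_cong)
qed

lemma AE_False_iff: "(AE x in M. False) \<longleftrightarrow> emeasure M (space M) = 0"
  by (rule AE_iff_measurable) auto

text \<open>No kernel power started in an absorbing set charges the complement, so irreducibility
  leaves the complement no positive mass.\<close>

lemma irreducibility_absorbing:
  assumes P: "P \<in> S \<rightarrow>\<^sub>M subprob_algebra S" and irr: "irreducibility_measure S P \<phi>"
    and F: "F \<in> sets S" "x \<in> F" "\<And>y. y \<in> F \<Longrightarrow> AE z in P y. z \<in> F"
  shows "AE y in \<phi>. y \<in> F"
proof -
  interpret subkernel S P by unfold_locales (rule P)
  have FS: "y \<in> space S" if "y \<in> F" for y using sets.sets_into_space[OF F(1)] that by auto
  have zero: "emeasure (kernel_power S P n y) (space S - F) = 0" if "y \<in> F" for n y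
    using that
  proof (induction n arbitrary: y)
    case 0
    then show ?case using F(1) FS by (simp add: emeasure_return indicator_def)
  next
    case (Suc n)
    have "emeasure (P y \<bind> kernel_power S P n) (space S - F)
        = (\<integral>\<^sup>+z. emeasure (kernel_power S P n z) (space S - F) \<partial>P y)"
    proof (rule emeasure_bind)
      show "space (P y) \<noteq> {}" using space_kernel[OF FS[OF Suc.prems]] FS[OF Suc.prems] by auto
      show "kernel_power S P n \<in> P y \<rightarrow>\<^sub>M subprob_algebra S"
        using kernel_power_measurable[OF P] measurable_cong_sets[OF sets_kernel[OF FS[OF Suc.prems]] refl] by blast
      show "space S - F \<in> sets S" using F(1) by auto
    qed
    also have "\<dots> = (\<integral>\<^sup>+z. 0 \<partial>P y)"
      using F(3)[OF Suc.prems] Suc.IH by (intro nn_integral_cong_AE) auto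
    finally show ?case by simp
  qed
  have "\<not> emeasure \<phi> (space S - F) > 0"
  proof
    assume "emeasure \<phi> (space S - F) > 0"
    then obtain n where "emeasure (kernel_power S P n x) (space S - F) > 0"
      using irr F(1) FS[OF F(2)] unfolding irreducibility_measure_def by blast
    then show False using zero[OF F(2)] by simp
  qed
  moreover have s: "sets \<phi> = sets S" using irr by (simp add: irreducibility_measure_def)
  moreover have "space \<phi> = space S" by (rule sets_eq_imp_space_eq[OF s])
  ultimately show ?thesis using F(1)
    by (intro AE_I[of _ _ "space S - F"]) (auto simp: zero_less_iff_neq_zero)
qed

locale irreducible_kernel = subkernel S P for S :: "'s measure" and P +
  fixes \<phi> :: "'s measure"
  assumes irreducible: "irreducibility_measure S P \<phi>"
begin

lemma sets_phi: "sets \<phi> = sets S" and space_phi: "space \<phi> = space S"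
  using irreducible sets_eq_imp_space_eq[of \<phi> S] by (auto simp: irreducibility_measure_def)

lemma AE_phi_space: "AE x in \<phi>. x \<in> space S"
  using AE_space[of \<phi>] by (simp add: space_phi)

lemma not_AE_False: "\<not> (AE x in \<phi>. False)"
  using irreducible by (auto simp: irreducibility_measure_def AE_False_iff space_phi)

text \<open>The set \<open>{V < \<infinity>}\<close> is absorbing and contains \<open>x\<close>:
  finiteness at a single point spreads to almost every point.\<close>

lemma AE_finite_if_absorbing:
  fixes V :: "'s \<Rightarrow> ennreal"
  assumes [measurable]: "V \<in> borel_measurable S" and x: "x \<in> space S" "V x < \<infinity>"
    and abs: "\<And>y. y \<in> space S \<Longrightarrow> V y < \<infinity> \<Longrightarrow> AE z in P y. V z < \<infinity>"
  shows "AE y in \<phi>. V y < \<infinity>"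
proof -
  have "AE y in \<phi>. y \<in> {y\<in>space S. V y < \<infinity>}"
  proof (rule irreducibility_absorbing[OF kernel irreducible])
    fix y assume y: "y \<in> {y \<in> space S. V y < \<infinity>}"
    then have "AE z in P y. V z < \<infinity>" using abs by auto
    then show "AE z in P y. z \<in> {y \<in> space S. V y < \<infinity>}"
      using AE_space[of "P y"] by eventually_elim (use y space_kernel in auto)
  qed (use x in auto)
  then show ?thesis by eventually_elim auto
qed

text \<open>The weight must not vanish: \<open>0 * \<infinity> = 0\<close> would let an infinite
  value of \<open>V\<close> hide in a finite integral.\<close>

lemma AE_finite_of_kop_finite:
  assumes y: "y \<in> space S" and [measurable]: "w \<in> borel_measurable S" "V \<in> borel_measurable S"
    and w: "\<And>z. z \<in> space S \<Longrightarrow> w z \<noteq> 0" and fin: "kop P w V y < \<infinity>"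
  shows "AE z in P y. V z < \<infinity>"
proof -
  have "AE z in P y. w z * V z \<noteq> \<infinity>"
    using fin unfolding kop_def by (intro nn_integral_noteq_infinite measurable_kernel[OF y]) auto
  then show ?thesis using AE_space[of "P y"]
    by eventually_elim (use y w space_kernel in \<open>auto simp: ennreal_mult_eq_top_iff less_top\<close>)
qed

text \<open>A limsup at \<open>x\<close> controls only a tail of the series, and early terms may be
  infinite. The tail from \<open>m\<close> is the full potential after \<open>m\<close> weighted
  steps, so a state reached in at most \<open>m\<close> steps has a finite full potential, and
  finiteness spreads from there.\<close>

lemma AE_summable_if_tail_summable:
  assumes [measurable]: "w \<in> borel_measurable S" and w: "\<And>z. z \<in> space S \<Longrightarrow> w z \<noteq> 0"
    and x: "x \<in> space S" and fin: "(\<Sum>n. (kop P w ^^ (n + m)) (\<lambda>_. 1) x) < \<infinity>"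
  shows "AE y in \<phi>. (\<Sum>n. (kop P w ^^ n) (\<lambda>_. 1) y) < \<infinity>"
proof -
  define V where "V m y = (\<Sum>n. (kop P w ^^ (n + m)) (\<lambda>_. 1) y)" for m y
  have [measurable]: "V m \<in> borel_measurable S" for m unfolding V_def by measurable
  have step: "kop P w (V m) y = V (Suc m) y" if "y \<in> space S" for m y
    unfolding V_def using that by (subst kop_suminf) auto
  have abs: "AE z in P y. V m z < \<infinity>" if "y \<in> space S" "V (Suc m) y < \<infinity>" for m y
    using that step[OF that(1)] w by (intro AE_finite_of_kop_finite[of y w]) auto
  have desc: "AE z in P y. V 0 z < \<infinity>" if "y \<in> space S" "V 0 y < \<infinity>" for y
  proof -
    have "V 0 y = (kop P w ^^ 0) (\<lambda>_. 1) y + V 1 y"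
      unfolding V_def using suminf_offset[of "\<lambda>n. (kop P w ^^ n) (\<lambda>_. 1) y" 1] by simp
    then have "V 1 y < \<infinity>" using that by auto
    then show ?thesis using abs[of y 0] that by simp
  qed
  have "\<exists>y\<in>space S. V 0 y < \<infinity>" if "y \<in> space S" "V m y < \<infinity>" for m y
    using that
  proof (induction m arbitrary: y)
    case (Suc m)
    have "AE z in P y. V m z < \<infinity>" by (rule abs) fact+
    show ?case
    proof (cases "emeasure (P y) (space S) = 0")
      \<comment> \<open>A subkernel may have mass 0 at \<open>y\<close>; then nothing follows
        \<open>y\<close> and its potential is 1.\<close>
      case True
      have "kop P w (V 0) y = 0"
      proof -
        have "AE z in P y. False"
          using True Suc.prems space_kernel[of y] by (simp add: AE_False_iff)
        then have "AE z in P y. w z * V 0 z = 0" by (rule AE_mp) simp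
        then show ?thesis unfolding kop_def using Suc.prems
          by (subst nn_integral_0_iff_AE) (auto intro!: measurable_kernel)
      qed
      moreover have "V 0 y = 1 + kop P w (V 0) y"
        unfolding V_def using potential_unfold[OF Suc.prems(1), of w "\<lambda>_. 1"] by simp
      ultimately show ?thesis using Suc.prems(1) by (intro bexI[of _ y]) auto
    next
      case False
      have "\<exists>z\<in>space S. V m z < \<infinity>"
      proof (rule ccontr)
        assume "\<not> ?thesis"
        then have "AE z in P y. False"
          using \<open>AE z in P y. V m z < \<infinity>\<close> AE_space[of "P y"]
          by (rule_tac AE_mp) (use space_kernel[OF Suc.prems(1)] in auto)
        then show False using False Suc.prems space_kernel[of y] by (simp add: AE_False_iff)
      qed
      then show ?thesis using Suc.IH by blast
    qed
  qed auto
  then obtain y where "y \<in> space S" "V 0 y < \<infinity>" using x fin unfolding V_def by blast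
  then have "AE y in \<phi>. V 0 y < \<infinity>" using desc by (intro AE_finite_if_absorbing) auto
  then show ?thesis by (simp add: V_def)
qed

end

section \<open>Growth rates and summability of discounted series\<close>

lemma log_ennreal_less_iff:
  assumes n: "n > 0"
  shows "log_ennreal z / ereal (real n) < ereal c \<longleftrightarrow> z < ennreal (exp (c * real n))"
proof (cases z)
  case (real r)
  show ?thesis
  proof (cases "r = 0")
    case False
    then have "ln r < c * real n \<longleftrightarrow> r < exp (c * real n)"
      using real(1) exp_less_cancel_iff[of "ln r" "c * real n"] by simp
    then show ?thesis using n real False
      by (simp add: log_ennreal_def divide_less_eq ennreal_less_iff)
  qed (use n real in \<open>simp add: log_ennreal_def\<close>)
next
  case top
  then show ?thesis using n by (simp add: log_ennreal_def)
qed

lemma log_ennreal_less_top_iff: "log_ennreal z < \<infinity> \<longleftrightarrow> z < \<infinity>"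
  by (cases z) (auto simp: log_ennreal_def less_top)

definition growth_rate :: "(nat \<Rightarrow> ennreal) \<Rightarrow> ereal" where
  "growth_rate e = limsup (\<lambda>n. log_ennreal (e n) / ereal (real n))"

text \<open>A value \<open>c'\<close> strictly between the growth rate and \<open>c\<close> leaves a
  geometric series of ratio \<open>exp (c' - c)\<close>. Only a tail can be claimed, since the
  limsup says nothing about the first terms.\<close>

lemma growth_rate_less_imp_summable:
  assumes "growth_rate e < ereal c"
  shows "\<exists>m. (\<Sum>n. ennreal (exp (- c)) ^ (n + m) * e (n + m)) < \<infinity>"
proof -
  obtain c' where c': "growth_rate e < ereal c'" "c' < c"
    using ereal_dense2[OF assms] by (auto)
  have "\<forall>\<^sub>F n in sequentially. log_ennreal (e n) / ereal (real n) < ereal c'"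
    using c'(1) unfolding growth_rate_def by (rule Limsup_lessD)
  then obtain m where m: "\<And>n. n \<ge> m \<Longrightarrow> log_ennreal (e n) / ereal (real n) < ereal c'"
    unfolding eventually_sequentially by auto
  \<comment> \<open>At index 0 the quotient divides by zero, hence \<open>Suc m\<close>.\<close>
  have le: "ennreal (exp (- c)) ^ n * e n \<le> ennreal (exp (c' - c) ^ n)" if "n \<ge> Suc m" for n
  proof -
    have "e n \<le> ennreal (exp (c' * real n))"
      using m[of n] that log_ennreal_less_iff[of n "e n" c'] by auto
    then have "ennreal (exp (- c)) ^ n * e n \<le> ennreal (exp (- c)) ^ n * ennreal (exp (c' * real n))"
      by (rule mult_left_mono) simp
    also have "\<dots> = ennreal (exp (c' - c) ^ n)"
      by (simp add: ennreal_power ennreal_mult[symmetric] exp_of_nat_mult[symmetric]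
          exp_add[symmetric] algebra_simps)
    finally show ?thesis .
  qed
  have "(\<Sum>n. ennreal (exp (- c)) ^ (n + Suc m) * e (n + Suc m)) \<le> (\<Sum>n. ennreal (exp (c' - c) ^ (n + Suc m)))"
    by (intro suminf_le le) auto
  also have "\<dots> < \<infinity>"
  proof -
    have "summable (\<lambda>n. exp (c' - c) ^ (n + Suc m))"
      using c'(2) by (intro summable_ignore_initial_segment summable_geometric) auto
    then show ?thesis by (subst suminf_ennreal2) auto
  qed
  finally show ?thesis by blast
qed

text \<open>The terms tend to 0, so eventually \<open>e n\<close> is at most
  \<open>exp (c * n)\<close>. With the preceding lemma this trades a limsup for the finiteness of a
  potential, a property that spreads along the chain.\<close>

lemma summable_imp_growth_rate_le:
  assumes "(\<Sum>n. ennreal (exp (- c)) ^ n * e n) < \<infinity>"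
  shows "growth_rate e \<le> ereal c"
proof -
  let ?a = "\<lambda>n. ennreal (exp (- c)) ^ n * e n"
  have fin: "?a n < \<infinity>" for n
  proof -
    have "?a n \<le> (\<Sum>n. ?a n)" using sum_le_suminf[of ?a "{n}"] by simp
    then show ?thesis using assms by (rule le_less_trans)
  qed
  have "summable (\<lambda>n. enn2real (?a n))"
  proof (rule summable_suminf_not_top)
    show "(\<Sum>n. ennreal (enn2real (?a n))) \<noteq> \<top>"
      using assms fin by (subst ennreal_enn2real) (auto simp: less_top)
  qed simp
  then have "(\<lambda>n. enn2real (?a n)) \<longlonglongrightarrow> 0" by (rule summable_LIMSEQ_zero)
  then have "\<forall>\<^sub>F n in sequentially. enn2real (?a n) < 1" by (rule order_tendstoD) simp
  then have ev: "\<forall>\<^sub>F n in sequentially. log_ennreal (e n) / ereal (real n) \<le> ereal c"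
    using eventually_gt_at_top[of 0]
  proof eventually_elim
    case (elim n)
    have "?a n = ennreal (enn2real (?a n))" using fin[of n] by (simp add: ennreal_enn2real_if less_top)
    then have "?a n < 1" using elim(1) by (metis ennreal_less_one_iff)
    have "ennreal (exp (c * real n)) * ?a n = e n"
    proof -
      have "ennreal (exp (c * real n)) * ennreal (exp (- c)) ^ n = 1"
        by (simp add: ennreal_power ennreal_mult[symmetric] exp_of_nat_mult[symmetric]
          exp_add[symmetric] algebra_simps)
      then show ?thesis by (simp add: mult.assoc[symmetric])
    qed
    moreover have "ennreal (exp (c * real n)) * ?a n \<le> ennreal (exp (c * real n)) * 1"
      using \<open>?a n < 1\<close> by (intro mult_left_mono) auto
    ultimately have "e n \<le> ennreal (exp (c * real n))" by simp
    then have "\<not> ereal c < log_ennreal (e n) / ereal (real n)"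
    proof (cases "e n" rule: ennreal_cases)
      case (real r)
      show ?thesis
      proof (cases "r = 0")
        case False
        then have "ln r \<le> c * real n \<longleftrightarrow> r \<le> exp (c * real n)"
          using real(1) exp_le_cancel_iff[of "ln r" "c * real n"] by simp
        then show ?thesis using elim(2) \<open>e n \<le> _\<close> real False
          by (simp add: log_ennreal_def less_divide_eq not_less)
      qed (use elim(2) real in \<open>simp add: log_ennreal_def\<close>)
    qed (use \<open>e n \<le> _\<close> in \<open>simp add: top_unique\<close>)
    then show ?case by simp
  qed
  show ?thesis unfolding growth_rate_def by (rule Limsup_bounded[OF ev])
qed

section \<open>Growth rates are almost everywhere constant\<close>

context irreducible_kernel
begin

text \<open>Two constants that both agree with \<open>g\<close> almost everywhere coincide because
  \<phi> is not the zero measure, so the description in \<open>common_value\<close> is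
  unique.\<close>

lemma common_value_eqI:
  assumes "AE x in \<phi>. g x = c"
  shows "common_value \<phi> g = c"
  unfolding common_value_def
proof (rule the_equality, rule assms)
  fix c' assume "AE x in \<phi>. g x = c'"
  with assms have "AE x in \<phi>. c = c'" by eventually_elim auto
  then show "c' = c" using not_AE_False by (cases "c = c'") auto
qed

lemma growth_rate_summable:
  assumes [measurable]: "u \<in> borel_measurable S" and x: "x \<in> space S"
    and less: "growth_rate (\<lambda>n. (kop P (expw u) ^^ n) (\<lambda>_. 1) x) < ereal c"
  shows "AE x in \<phi>. (\<Sum>n. ennreal (exp (- c)) ^ n * (kop P (expw u) ^^ n) (\<lambda>_. 1) x) < \<infinity>"
proof -
  let ?w = "\<lambda>y. ennreal (exp (- c)) * expw u y"
  have scale: "(kop P ?w ^^ n) (\<lambda>_. 1) y = ennreal (exp (- c)) ^ n * (kop P (expw u) ^^ n) (\<lambda>_. 1) y"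
    if "y \<in> space S" for y n
    by (rule kop_funpow_scale) (use that in auto)
  obtain m where "(\<Sum>n. ennreal (exp (- c)) ^ (n + m) * (kop P (expw u) ^^ (n + m)) (\<lambda>_. 1) x) < \<infinity>"
    using growth_rate_less_imp_summable[OF less] by auto
  then have "AE x in \<phi>. (\<Sum>n. (kop P ?w ^^ n) (\<lambda>_. 1) x) < \<infinity>"
    by (intro AE_summable_if_tail_summable[of _ x m]) (auto simp: scale x, auto simp: expw_def)
  then show ?thesis using AE_phi_space by eventually_elim (simp add: scale)
qed

text \<open>If the rate lies below \<open>c\<close> at one point, summability spreads and the rate
  is at most \<open>c\<close> almost everywhere. Running through the rational \<open>c\<close> above
  the infimum identifies the rate almost everywhere with the infimum. This gives
  \<open>common_value\<close> its meaning.\<close>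

lemma AE_growth_rate_eq_Inf:
  assumes [measurable]: "u \<in> borel_measurable S"
  defines "g \<equiv> \<lambda>x. growth_rate (\<lambda>n. (kop P (expw u) ^^ n) (\<lambda>_. 1) x)"
  shows "AE x in \<phi>. g x = Inf (g ` space S)"
proof -
  let ?c = "Inf (g ` space S)"
  have le: "AE x in \<phi>. g x \<le> ereal c" if less: "?c < ereal c" for c
  proof -
    obtain x where "x \<in> space S" "g x < ereal c" using less by (auto simp: Inf_less_iff)
    from growth_rate_summable[OF assms(1) this(1) this(2)[unfolded g_def]]
    show ?thesis unfolding g_def by eventually_elim (auto intro!: summable_imp_growth_rate_le)
  qed
  have "AE x in \<phi>. \<forall>q::rat. ?c < ereal (of_rat q) \<longrightarrow> g x \<le> ereal (of_rat q)"
    unfolding AE_all_countable using le by auto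
  then show ?thesis using AE_phi_space
  proof eventually_elim
    case (elim x)
    have "g x \<le> ?c"
    proof (rule ccontr)
      assume "\<not> g x \<le> ?c"
      then have "?c < g x" by simp
      then obtain r where r: "?c < ereal r" "ereal r < g x" using ereal_dense2 by blast
      then obtain r' where r': "ereal r < ereal r'" "ereal r' < g x" using ereal_dense2 by blast
      then obtain q where q: "r < of_rat q" "of_rat q < r'" using of_rat_dense[of r r'] by auto
      have "?c < ereal (of_rat q)" using r(1) q(1) by (metis ereal_less_eq(3) less_le_trans less_imp_le)
      then have "g x \<le> ereal (of_rat q)" using elim by auto
      then have "g x < ereal r'" using q(2) by (metis ereal_less(2) less_ereal.simps(1) le_less_trans)
      then show False using r' by simp
    qed
    moreover have "?c \<le> g x" using elim by (auto intro: Inf_lower)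
    ultimately show ?case by simp
  qed
qed

lemma common_growth_rate_less_imp_summable:
  assumes [measurable]: "u \<in> borel_measurable S"
    and e: "\<And>n x. x \<in> space S \<Longrightarrow> e n x = (kop P (expw u) ^^ n) (\<lambda>_. 1) x"
    and less: "common_value \<phi> (\<lambda>x. growth_rate (\<lambda>n. e n x)) < ereal c"
  shows "AE x in \<phi>. (\<Sum>n. ennreal (exp (- c)) ^ n * (kop P (expw u) ^^ n) (\<lambda>_. 1) x) < \<infinity>"
proof -
  let ?g = "\<lambda>x. growth_rate (\<lambda>n. (kop P (expw u) ^^ n) (\<lambda>_. 1) x)"
  have "AE x in \<phi>. growth_rate (\<lambda>n. e n x) = Inf (?g ` space S)"
    using AE_growth_rate_eq_Inf[OF assms(1)] AE_phi_space by eventually_elim (simp add: e)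
  then have "common_value \<phi> (\<lambda>x. growth_rate (\<lambda>n. e n x)) = Inf (?g ` space S)"
    by (rule common_value_eqI)
  with less obtain x where "x \<in> space S" "?g x < ereal c" by (auto simp: Inf_less_iff)
  then show ?thesis by (rule growth_rate_summable[OF assms(1)])
qed

end

section \<open>Splitting and the renewal inequality\<close>

lemma SUP_mult_ennreal:
  fixes a b :: "nat \<Rightarrow> ennreal"
  assumes "incseq a" "incseq b"
  shows "(SUP n. a n) * (SUP n. b n) = (SUP n. a n * b n)"
proof (rule antisym)
  have "a i * b j \<le> (SUP n. a n * b n)" for i j
  proof -
    have "a i * b j \<le> a (max i j) * b (max i j)"
      using assms by (intro mult_mono) (auto simp: incseq_def)
    also have "\<dots> \<le> (SUP n. a n * b n)" by (rule SUP_upper) simp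
    finally show ?thesis .
  qed
  then show "(SUP n. a n) * (SUP n. b n) \<le> (SUP n. a n * b n)"
    by (auto simp: SUP_mult_left_ennreal SUP_mult_right_ennreal intro!: SUP_least)
  show "(SUP n. a n * b n) \<le> (SUP n. a n) * (SUP n. b n)"
    by (intro SUP_least mult_mono SUP_upper) auto
qed

text \<open>Lifts the domination in (H3) from sets to nonnegative functions.\<close>

lemma nn_integral_le_sum_of_emeasure_le:
  assumes sets: "sets M = sets S" "\<And>i. i \<in> I \<Longrightarrow> sets (N i) = sets S" and I: "finite I"
    and le: "\<And>E. E \<in> sets S \<Longrightarrow> emeasure M E \<le> c * (\<Sum>i\<in>I. emeasure (N i) E)"
    and g: "g \<in> borel_measurable S"
  shows "(\<integral>\<^sup>+x. g x \<partial>M) \<le> c * (\<Sum>i\<in>I. \<integral>\<^sup>+x. g x \<partial>N i)"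
proof -
  have mM [measurable_cong]: "sets M = sets S" by fact
  have meas: "f \<in> borel_measurable (N i)" if "f \<in> borel_measurable S" "i \<in> I" for f :: "'a \<Rightarrow> ennreal" and i
    using measurable_cong_sets[OF sets(2)[OF that(2)] refl] that(1) by blast
  show ?thesis using g
  proof (induction rule: borel_measurable_induct)
    case (cong f g)
    have "(\<integral>\<^sup>+x. f x \<partial>M) = (\<integral>\<^sup>+x. g x \<partial>M)"
      using cong(3) sets_eq_imp_space_eq[OF sets(1)] by (intro nn_integral_cong) auto
    moreover have "(\<integral>\<^sup>+x. f x \<partial>N i) = (\<integral>\<^sup>+x. g x \<partial>N i)" if "i \<in> I" for i
      using cong(3) sets_eq_imp_space_eq[OF sets(2)[OF that]] by (intro nn_integral_cong) auto
    ultimately show ?case using cong(4) by simp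
  next
    case (set A)
    then show ?case using le[of A] sets by (simp cong: sum.cong)
  next
    case (mult u c')
    have "(\<integral>\<^sup>+x. c' * u x \<partial>M) = c' * (\<integral>\<^sup>+x. u x \<partial>M)"
      using mult by (intro nn_integral_cmult) simp
    also have "\<dots> \<le> c' * (c * (\<Sum>i\<in>I. \<integral>\<^sup>+x. u x \<partial>N i))"
      by (intro mult_left_mono mult) simp
    also have "\<dots> = c * (\<Sum>i\<in>I. c' * (\<integral>\<^sup>+x. u x \<partial>N i))"
      by (simp add: sum_distrib_left mult_ac)
    also have "\<dots> = c * (\<Sum>i\<in>I. \<integral>\<^sup>+x. c' * u x \<partial>N i)"
      using meas[OF mult(2)] by (simp add: nn_integral_cmult)
    finally show ?case .
  next
    case (add u v)
    have "(\<integral>\<^sup>+x. v x + u x \<partial>M) = (\<integral>\<^sup>+x. v x \<partial>M) + (\<integral>\<^sup>+x. u x \<partial>M)"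
      using add by (intro nn_integral_add) auto
    also have "\<dots> \<le> c * (\<Sum>i\<in>I. \<integral>\<^sup>+x. v x \<partial>N i) + c * (\<Sum>i\<in>I. \<integral>\<^sup>+x. u x \<partial>N i)"
      by (intro add_mono add)
    also have "\<dots> = c * (\<Sum>i\<in>I. (\<integral>\<^sup>+x. v x \<partial>N i) + (\<integral>\<^sup>+x. u x \<partial>N i))"
      by (simp add: sum.distrib distrib_left)
    also have "\<dots> = c * (\<Sum>i\<in>I. \<integral>\<^sup>+x. v x + u x \<partial>N i)"
      using meas[OF \<open>u \<in> _\<close>] meas[OF \<open>v \<in> _\<close>] by (simp add: nn_integral_add)
    finally show ?case .
  next
    case (seq U)
    have "(\<integral>\<^sup>+x. (SUP j. U j) x \<partial>M) = (SUP j. \<integral>\<^sup>+x. U j x \<partial>M)"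
      unfolding SUP_apply using seq by (intro nn_integral_monotone_convergence_SUP) auto
    also have "\<dots> \<le> c * (\<Sum>i\<in>I. \<integral>\<^sup>+x. (SUP j. U j) x \<partial>N i)"
    proof (rule SUP_least)
      fix j
      have "(\<integral>\<^sup>+x. U j x \<partial>M) \<le> c * (\<Sum>i\<in>I. \<integral>\<^sup>+x. U j x \<partial>N i)" by (rule seq)
      also have "\<dots> \<le> c * (\<Sum>i\<in>I. \<integral>\<^sup>+x. (SUP j. U j) x \<partial>N i)"
        by (intro mult_left_mono sum_mono nn_integral_mono) (auto intro: SUP_upper le_funD)
      finally show "(\<integral>\<^sup>+x. U j x \<partial>M) \<le> c * (\<Sum>i\<in>I. \<integral>\<^sup>+x. (SUP j. U j) x \<partial>N i)" .
    qed
    finally show ?case .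
  qed
qed

text \<open>\<open>R\<close> is the kernel of the chain killed at a regeneration.\<close>

locale split_kernel = irreducible_kernel S P \<phi> + R: subkernel S R
  for S :: "'s measure" and P \<phi> R +
  fixes L :: "'s set" and \<delta> :: real and \<nu> :: "'s measure"
  assumes L [measurable]: "L \<in> sets S" and phi_L: "emeasure \<phi> L > 0"
    and delta: "0 < \<delta>"
    and prob_nu: "prob_space \<nu>" and sets_nu [measurable_cong]: "sets \<nu> = sets S" and nu_L: "emeasure \<nu> L = 1"
    and decomposition: "\<And>x E. x \<in> space S \<Longrightarrow> E \<in> sets S \<Longrightarrow>
      emeasure (P x) E = emeasure (R x) E + ennreal \<delta> * indicator L x * emeasure \<nu> E"
begin

lemma space_nu: "space \<nu> = space S"
  by (rule sets_eq_imp_space_eq[OF sets_nu])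

lemma AE_nu_L: "AE y in \<nu>. y \<in> L"
  using prob_space.AE_prob_1[OF prob_nu] nu_L prob_nu by (simp add: measure_def)

lemma nn_integral_decomposition:
  assumes x: "x \<in> space S" and g: "g \<in> borel_measurable S"
  shows "(\<integral>\<^sup>+y. g y \<partial>P x) = (\<integral>\<^sup>+y. g y \<partial>R x) + ennreal \<delta> * indicator L x * (\<integral>\<^sup>+y. g y \<partial>\<nu>)"
  using g
proof (induction rule: borel_measurable_induct)
  case (cong f g)
  have "(\<integral>\<^sup>+x. f x \<partial>M) = (\<integral>\<^sup>+x. g x \<partial>M)" if "space M = space S" for M
    using cong(3) that by (intro nn_integral_cong) auto
  then show ?case using cong(4) x by (simp add: space_kernel R.space_kernel space_nu)
next
  case (set A)
  then show ?case using decomposition[OF x, of A] x by (simp add: sets_kernel R.sets_kernel sets_nu)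
next
  case (mult u c)
  then show ?case using measurable_kernel[OF x mult(2)] R.measurable_kernel[OF x mult(2)]
    by (simp add: nn_integral_cmult distrib_left mult_ac)
next
  case (add u v)
  have "(\<integral>\<^sup>+y. v y + u y \<partial>M) = (\<integral>\<^sup>+y. v y \<partial>M) + (\<integral>\<^sup>+y. u y \<partial>M)" if "sets M = sets S" for M
    using \<open>u \<in> _\<close> \<open>v \<in> _\<close> measurable_cong_sets[OF that refl] by (intro nn_integral_add) auto
  with add x show ?case
    by (simp add: sets_kernel R.sets_kernel sets_nu distrib_left add_ac)
next
  case (seq U)
  have U: "U i \<in> borel_measurable S" for i by (rule seq)
  have inc: "incseq (\<lambda>i. \<integral>\<^sup>+y. U i y \<partial>M)" for M
    using seq(3) by (auto simp: incseq_def le_fun_def intro!: nn_integral_mono)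
  have "(SUP i. (\<integral>\<^sup>+y. U i y \<partial>R x) + ennreal \<delta> * indicator L x * (\<integral>\<^sup>+y. U i y \<partial>\<nu>))
      = (SUP i. \<integral>\<^sup>+y. U i y \<partial>R x) + (SUP i. ennreal \<delta> * indicator L x * (\<integral>\<^sup>+y. U i y \<partial>\<nu>))"
    using inc by (intro ennreal_SUP_add) (auto simp: incseq_def intro!: mult_left_mono)
  moreover have "(\<integral>\<^sup>+y. (SUP i. U i) y \<partial>M) = (SUP i. \<integral>\<^sup>+y. U i y \<partial>M)" if "sets M = sets S" for M
    unfolding SUP_apply using measurable_cong_sets[OF that refl] seq(3) U
    by (intro nn_integral_monotone_convergence_SUP) blast+
  ultimately show ?case using seq x
    by (simp add: sets_kernel R.sets_kernel sets_nu SUP_mult_left_ennreal)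
qed

lemma kop_decomposition:
  assumes x: "x \<in> space S" and [measurable]: "w \<in> borel_measurable S" "g \<in> borel_measurable S"
  shows "kop P w g x = kop R w g x + ennreal \<delta> * indicator L x * (\<integral>\<^sup>+y. w y * g y \<partial>\<nu>)"
  unfolding kop_def by (rule nn_integral_decomposition[OF x]) measurable

lemma kop_R_le:
  assumes x: "x \<in> space S" and "w \<in> borel_measurable S" "g \<in> borel_measurable S"
  shows "kop R w g x \<le> kop P w g x"
  using kop_decomposition[OF assms] by simp

lemma kop_R_funpow_le:
  assumes x: "x \<in> space S" and [measurable]: "w \<in> borel_measurable S" "g \<in> borel_measurable S"
    and le: "\<And>y. y \<in> space S \<Longrightarrow> w y \<le> w' y" "\<And>y. y \<in> space S \<Longrightarrow> g y \<le> g' y"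
  shows "(kop R w ^^ n) g x \<le> (kop P w' ^^ n) g' x"
  using x
proof (induction n arbitrary: x)
  case (Suc n)
  have "(kop R w ^^ Suc n) g x \<le> kop P w ((kop R w ^^ n) g) x"
    using Suc.prems by (simp add: kop_R_le)
  also have "\<dots> \<le> (kop P w' ^^ Suc n) g' x"
    using Suc le(1) by (auto intro!: kop_mono mult_mono)
  finally show ?case .
qed (use le in simp)

text \<open>The finite integral against \<nu> provides one point where \<open>V\<close> is finite. A
  step of \<open>P\<close> is a step of \<open>R\<close>, under which \<open>V\<close> does not
  grow, plus at most \<delta> times that integral; hence \<open>{V < \<infinity>}\<close> is
  absorbing for \<open>P\<close> itself.\<close>

lemma AE_finite_if_R_absorbing:
  fixes V :: "'s \<Rightarrow> ennreal"
  assumes [measurable]: "V \<in> borel_measurable S" "w \<in> borel_measurable S"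
    and w: "\<And>z. z \<in> space S \<Longrightarrow> w z \<noteq> 0"
    and R: "\<And>y. y \<in> space S \<Longrightarrow> kop R w V y \<le> V y"
    and nu: "(\<integral>\<^sup>+y. w y * V y \<partial>\<nu>) < \<infinity>"
  shows "AE y in \<phi>. V y < \<infinity>"
proof -
  have "AE y in \<nu>. w y * V y \<noteq> \<infinity>"
    using nu by (intro nn_integral_noteq_infinite) auto
  then have "AE y in \<nu>. y \<in> space S \<and> V y < \<infinity>"
    using AE_space[of \<nu>] by eventually_elim (use w space_nu in \<open>auto simp: ennreal_mult_eq_top_iff less_top\<close>)
  then obtain x where x: "x \<in> space S" "V x < \<infinity>"
    using prob_space.AE_contr[OF prob_nu] by (metis (mono_tags, lifting) AE_mp AE_I2)
  show ?thesis
  proof (rule AE_finite_if_absorbing[where V = V])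
    show "x \<in> space S" "V x < \<infinity>" by fact+
    fix y assume y: "y \<in> space S" "V y < \<infinity>"
    have "kop P w V y < \<infinity>"
      using kop_decomposition[OF y(1), of w V] R[OF y(1)] y(2) nu
      by (auto simp: ennreal_mult_less_top le_less_trans indicator_def)
    then show "AE z in P y. V z < \<infinity>" using y w by (intro AE_finite_of_kop_finite[of y w]) auto
  qed simp
qed

text \<open>Renewal inequality: if the weighted cycle mass exceeded 1, the potential
  \<open>\<Gamma> = \<Sum>\<^sub>n K\<^sup>n 1\<^sub>L\<close> would satisfy \<open>\<psi> \<Gamma> \<ge> 1 + \<psi> \<Gamma>\<close>, hence be infinite on \<open>L\<close>.\<close>

lemma renewal_less_1:
  assumes [measurable]: "w \<in> borel_measurable S"
    and fin: "AE x in \<phi>. (\<Sum>n. (kop P w ^^ n) (\<lambda>_. 1) x) < \<infinity>"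
  shows "ennreal \<delta> * (\<integral>\<^sup>+y. w y * (\<Sum>n. (kop R w ^^ n) (indicator L) y) \<partial>\<nu>) < 1"
proof (rule ccontr)
  define W where "W y = (\<Sum>n. (kop R w ^^ n) (indicator L) y)" for y
  define \<Gamma> where "\<Gamma> y = (\<Sum>n. (kop P w ^^ n) (indicator L) y)" for y
  have [measurable]: "W \<in> borel_measurable S" "\<Gamma> \<in> borel_measurable S"
    unfolding W_def \<Gamma>_def by measurable
  define \<psi> where "\<psi> g = ennreal \<delta> * (\<integral>\<^sup>+y. w y * g y \<partial>\<nu>)" for g
  assume "\<not> ennreal \<delta> * (\<integral>\<^sup>+y. w y * (\<Sum>n. (kop R w ^^ n) (indicator L) y) \<partial>\<nu>) < 1"
  then have ge: "\<psi> W \<ge> 1" unfolding \<psi>_def W_def by simp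
  \<comment> \<open>Renewal equation: a step of \<open>P\<close> is a step of \<open>R\<close> or a
    regeneration, and a regeneration from \<open>L\<close> contributes
    \<open>\<psi> \<Gamma>\<close>.\<close>
  have eq: "\<Gamma> x = (1 + \<psi> \<Gamma>) * indicator L x + kop R w \<Gamma> x" if x: "x \<in> space S" for x
    using potential_unfold[OF x, of w "indicator L"] kop_decomposition[OF x, of w \<Gamma>]
    by (simp add: \<Gamma>_def[symmetric] \<psi>_def distrib_right distrib_left mult_ac add_ac)
  have le: "(1 + \<psi> \<Gamma>) * W x \<le> \<Gamma> x" if x: "x \<in> space S" for x
  proof -
    have "(1 + \<psi> \<Gamma>) * W x = (\<Sum>n. (kop R w ^^ n) (\<lambda>y. (1 + \<psi> \<Gamma>) * indicator L y) x)"
      unfolding W_def by (simp add: R.kop_funpow_cmult[OF x])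
    also have "\<dots> \<le> \<Gamma> x"
      by (rule R.potential_minimal[OF x]) (simp_all add: eq[symmetric])
    finally show ?thesis .
  qed
  have "1 + \<psi> \<Gamma> \<le> (1 + \<psi> \<Gamma>) * \<psi> W"
    using mult_left_mono[OF ge, of "1 + \<psi> \<Gamma>"] by simp
  also have "\<dots> = ennreal \<delta> * (\<integral>\<^sup>+y. (1 + \<psi> \<Gamma>) * (w y * W y) \<partial>\<nu>)"
    unfolding \<psi>_def[of W] by (subst nn_integral_cmult) (auto simp: mult_ac)
  also have "\<dots> \<le> \<psi> \<Gamma>"
    unfolding \<psi>_def[of \<Gamma>]
  proof (intro mult_left_mono nn_integral_mono)
    fix y assume "y \<in> space \<nu>"
    then have "w y * ((1 + \<psi> \<Gamma>) * W y) \<le> w y * \<Gamma> y" by (intro mult_left_mono le) (auto simp: space_nu)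
    then show "(1 + ennreal \<delta> * (\<integral>\<^sup>+y. w y * \<Gamma> y \<partial>\<nu>)) * (w y * W y) \<le> w y * \<Gamma> y"
      by (simp add: \<psi>_def mult_ac)
  qed simp
  finally have "\<psi> \<Gamma> = \<infinity>" by (cases "\<psi> \<Gamma>") (auto simp flip: ennreal_1 ennreal_plus)
  then have "\<Gamma> x = \<infinity>" if "x \<in> L" for x
    using eq[of x] that sets.sets_into_space[OF L] by auto
  moreover have "AE x in \<phi>. \<Gamma> x < \<infinity>"
    using fin AE_phi_space
  proof eventually_elim
    case (elim x)
    have "\<Gamma> x \<le> (\<Sum>n. (kop P w ^^ n) (\<lambda>_. 1) x)"
      unfolding \<Gamma>_def using elim by (intro suminf_le kop_funpow_mono) (auto simp: indicator_def)
    then show ?case using elim by auto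
  qed
  ultimately have "AE x in \<phi>. x \<notin> L" by (auto elim: AE_mp)
  then have "emeasure \<phi> L = 0" using L sets_phi sets.sets_into_space[OF L]
    by (subst (asm) AE_iff_measurable[of L]) (auto simp: space_phi)
  then show False using phi_L by simp
qed

text \<open>At growth rate 0 the series of \<open>P\<close> itself need not converge, so the strict
  inequality is applied to the weights discounted by \<open>exp (- c)\<close>, and then
  \<open>c\<close> tends to 0.\<close>

lemma renewal_le_1:
  assumes [measurable]: "u \<in> borel_measurable S"
    and fin: "\<And>c. c > 0 \<Longrightarrow>
      AE x in \<phi>. (\<Sum>n. ennreal (exp (- c)) ^ n * (kop P (expw u) ^^ n) (\<lambda>_. 1) x) < \<infinity>"
  shows "ennreal \<delta> * (\<integral>\<^sup>+y. expw u y * (\<Sum>n. (kop R (expw u) ^^ n) (indicator L) y) \<partial>\<nu>) \<le> 1"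
proof -
  \<comment> \<open>\<open>b n\<close> is the weighted mass of the cycles of length
    \<open>n + 1\<close>, whence the exponent \<open>Suc n\<close> of the discount.\<close>
  define b where "b n = ennreal \<delta> * (\<integral>\<^sup>+y. expw u y * (kop R (expw u) ^^ n) (indicator L) y \<partial>\<nu>)" for n
  have less: "(\<Sum>n. ennreal (exp (- c)) ^ Suc n * b n) < 1" if c: "c > 0" for c
  proof -
    let ?q = "ennreal (exp (- c))" and ?w = "\<lambda>y. ennreal (exp (- c)) * expw u y"
    have "AE x in \<phi>. (\<Sum>n. (kop P ?w ^^ n) (\<lambda>_. 1) x) < \<infinity>"
      using fin[OF c] AE_phi_space by eventually_elim (simp add: kop_funpow_scale)
    then have "ennreal \<delta> * (\<integral>\<^sup>+y. ?w y * (\<Sum>n. (kop R ?w ^^ n) (indicator L) y) \<partial>\<nu>) < 1"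
      by (intro renewal_less_1) measurable
    also have "(\<integral>\<^sup>+y. ?w y * (\<Sum>n. (kop R ?w ^^ n) (indicator L) y) \<partial>\<nu>)
        = (\<integral>\<^sup>+y. (\<Sum>n. ?q ^ Suc n * (expw u y * (kop R (expw u) ^^ n) (indicator L) y)) \<partial>\<nu>)"
      unfolding ennreal_suminf_cmult[symmetric]
      by (intro nn_integral_cong suminf_cong, subst R.kop_funpow_scale) (auto simp: space_nu mult_ac)
    also have "\<dots> = (\<Sum>n. \<integral>\<^sup>+y. ?q ^ Suc n * (expw u y * (kop R (expw u) ^^ n) (indicator L) y) \<partial>\<nu>)"
      by (rule nn_integral_suminf) measurable
    also have "\<dots> = (\<Sum>n. ?q ^ Suc n * (\<integral>\<^sup>+y. expw u y * (kop R (expw u) ^^ n) (indicator L) y \<partial>\<nu>))"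
      by (intro suminf_cong nn_integral_cmult) measurable
    also have "ennreal \<delta> * \<dots> = (\<Sum>n. ?q ^ Suc n * b n)"
      unfolding b_def ennreal_suminf_cmult[symmetric] by (intro suminf_cong) (simp add: mult_ac)
    finally show ?thesis .
  qed
  \<comment> \<open>For fixed \<open>n\<close>, removing the discount from the first
    \<open>n\<close> terms costs at most \<open>exp (n * c)\<close>, which tends to 1 along
    \<open>c = 1 / (m + 1)\<close>.\<close>
  have "(\<Sum>k<n. b k) \<le> ennreal (exp (real n * inverse (real (Suc m))))" for n m
  proof -
    let ?c = "inverse (real (Suc m))"
    let ?q = "ennreal (exp (- ?c))"
    have q: "?q \<le> 1" by (simp add: ennreal_le_1)
    have "?q ^ n * (\<Sum>k<n. b k) \<le> (\<Sum>k<n. ?q ^ Suc k * b k)"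
      unfolding sum_distrib_left using q
      by (intro sum_mono mult_right_mono power_decreasing) auto
    also have "\<dots> \<le> (\<Sum>k. ?q ^ Suc k * b k)" by (intro sum_le_suminf) auto
    also have "\<dots> \<le> 1" using less[of ?c] by simp
    finally have "ennreal (exp (real n * ?c)) * (?q ^ n * (\<Sum>k<n. b k)) \<le> ennreal (exp (real n * ?c)) * 1"
      by (intro mult_left_mono) auto
    also have "ennreal (exp (real n * ?c)) * (?q ^ n * (\<Sum>k<n. b k)) = (\<Sum>k<n. b k)"
    proof -
      have "ennreal (exp (real n * ?c)) * ?q ^ n = 1"
        by (simp add: ennreal_power ennreal_mult[symmetric] exp_of_nat_mult[symmetric] exp_add[symmetric])
      then show ?thesis by (metis mult.assoc mult_1)
    qed
    finally show ?thesis by simp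
  qed
  moreover have "(\<lambda>m. ennreal (exp (real n * inverse (real (Suc m))))) \<longlonglongrightarrow> ennreal (exp (real n * 0))" for n
    by (intro tendsto_intros LIMSEQ_inverse_real_of_nat)
  ultimately have "(\<Sum>k<n. b k) \<le> ennreal (exp (real n * 0))" for n
    using LIMSEQ_le_const by blast
  then have "(\<Sum>k<n. b k) \<le> 1" for n by simp
  then have "(\<Sum>k. b k) \<le> 1" by (intro suminf_le_const) auto
  also have "(\<Sum>k. b k) = ennreal \<delta> * (\<integral>\<^sup>+y. (\<Sum>n. expw u y * (kop R (expw u) ^^ n) (indicator L) y) \<partial>\<nu>)"
    unfolding b_def by (simp add: nn_integral_suminf[symmetric])
  finally show ?thesis unfolding ennreal_suminf_cmult .
qed

text \<open>The direction in which \<open>exp (\<alpha> * f y)\<close> moves with \<alpha> depends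
  on the sign of \<open>f y\<close>, so monotone convergence is run along the weights
  \<open>exp (r * f - \<bar>f\<bar> / (m + 1))\<close> instead. They increase to
  \<open>exp (r * f)\<close>, and each of them lies below \<open>exp (\<alpha> * f)\<close> whenever
  \<open>r - 1 / (m + 1) < \<alpha> \<le> r\<close>.\<close>

lemma renewal_le_1_limit:
  fixes f :: "'s \<Rightarrow> real"
  assumes [measurable]: "f \<in> borel_measurable S"
    and approx: "\<And>e. e > 0 \<Longrightarrow> \<exists>\<alpha>. r - e < \<alpha> \<and> \<alpha> \<le> r \<and>
      ennreal \<delta> * (\<integral>\<^sup>+y. expw (\<lambda>y. \<alpha> * f y) y *
        (\<Sum>n. (kop R (expw (\<lambda>y. \<alpha> * f y)) ^^ n) (indicator L) y) \<partial>\<nu>) \<le> 1"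
  shows "ennreal \<delta> * (\<integral>\<^sup>+y. expw (\<lambda>y. r * f y) y *
        (\<Sum>n. (kop R (expw (\<lambda>y. r * f y)) ^^ n) (indicator L) y) \<partial>\<nu>) \<le> 1"
proof -
  define w where "w m = expw (\<lambda>y. r * f y - inverse (real (Suc m)) * \<bar>f y\<bar>)" for m
  define W where "W m y = (\<Sum>n. (kop R (w m) ^^ n) (indicator L) y)" for m y
  have [measurable]: "w m \<in> borel_measurable S" for m unfolding w_def by measurable
  have [measurable]: "W m \<in> borel_measurable S" for m unfolding W_def by measurable
  have w_mono: "w m y \<le> w n y" if "m \<le> n" for m n y
    unfolding w_def expw_def using that by (intro ennreal_leI) (auto intro!: mult_right_mono le_imp_inverse_le)
  have W_mono: "W m y \<le> W n y" if "m \<le> n" "y \<in> space S" for m n y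
    unfolding W_def by (intro suminf_le R.kop_funpow_mono that w_mono) auto
  have w_SUP: "expw (\<lambda>y. r * f y) y = (SUP m. w m y)" for y
  proof (rule LIMSEQ_unique)
    have "(\<lambda>m. ennreal (exp (r * f y - inverse (real (Suc m)) * \<bar>f y\<bar>))) \<longlonglongrightarrow> ennreal (exp (r * f y - 0 * \<bar>f y\<bar>))"
      by (intro tendsto_intros LIMSEQ_inverse_real_of_nat)
    then show "(\<lambda>m. w m y) \<longlonglongrightarrow> expw (\<lambda>y. r * f y) y" by (simp add: w_def expw_def)
    show "(\<lambda>m. w m y) \<longlonglongrightarrow> (SUP m. w m y)"
      by (rule LIMSEQ_SUP) (auto simp: incseq_def w_mono)
  qed
  have prod: "expw (\<lambda>y. r * f y) y * (SUP m. W m y) = (SUP m. w m y * W m y)" if "y \<in> space S" for y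
    unfolding w_SUP by (rule SUP_mult_ennreal) (auto simp: incseq_def w_mono W_mono that)
  have int: "(\<integral>\<^sup>+y. expw (\<lambda>y. r * f y) y * (SUP m. W m y) \<partial>M) = (SUP m. \<integral>\<^sup>+y. w m y * W m y \<partial>M)"
    if M: "sets M = sets S" for M
  proof -
    have [measurable_cong]: "sets M = sets S" by fact
    have sp: "space M = space S" by (rule sets_eq_imp_space_eq[OF M])
    have "(\<integral>\<^sup>+y. expw (\<lambda>y. r * f y) y * (SUP m. W m y) \<partial>M) = (\<integral>\<^sup>+y. (SUP m. w m y * W m y) \<partial>M)"
      by (intro nn_integral_cong prod) (simp add: sp)
    also have "\<dots> = (SUP m. \<integral>\<^sup>+y. w m y * W m y \<partial>M)"
      by (intro nn_integral_monotone_convergence_SUP_AE AE_I2 mult_mono)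
         (auto simp: sp intro: w_mono W_mono)
    finally show ?thesis .
  qed
  \<comment> \<open>The supremum of the approximating potentials is a supersolution for the limiting
    weight and therefore dominates its potential.\<close>
  have le: "(\<Sum>n. (kop R (expw (\<lambda>y. r * f y)) ^^ n) (indicator L) y) \<le> (SUP m. W m y)" if y: "y \<in> space S" for y
  proof (rule R.potential_minimal[OF y])
    fix y assume y: "y \<in> space S"
    have "indicator L y + kop R (expw (\<lambda>y. r * f y)) (\<lambda>y. SUP m. W m y) y
        = indicator L y + (SUP m. kop R (w m) (W m) y)"
      unfolding kop_def using int[OF R.sets_kernel[OF y]] by simp
    also have "\<dots> = (SUP m. indicator L y + kop R (w m) (W m) y)"
      by (rule ennreal_SUP_add_right) simp
    also have "\<dots> = (SUP m. W m y)"
      unfolding W_def by (subst R.potential_unfold[OF y, symmetric]) auto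
    finally show "indicator L y + kop R (expw (\<lambda>y. r * f y)) (\<lambda>y. SUP m. W m y) y \<le> (SUP m. W m y)"
      by simp
  qed measurable
  have m_le: "ennreal \<delta> * (\<integral>\<^sup>+y. w m y * W m y \<partial>\<nu>) \<le> 1" for m
  proof -
    obtain \<alpha> where \<alpha>: "r - inverse (real (Suc m)) < \<alpha>" "\<alpha> \<le> r" and le1:
      "ennreal \<delta> * (\<integral>\<^sup>+y. expw (\<lambda>y. \<alpha> * f y) y *
        (\<Sum>n. (kop R (expw (\<lambda>y. \<alpha> * f y)) ^^ n) (indicator L) y) \<partial>\<nu>) \<le> 1"
      using approx[of "inverse (real (Suc m))"] by auto
    have w_le: "w m y \<le> expw (\<lambda>y. \<alpha> * f y) y" for y
    proof -
      have "(r - \<alpha>) * f y \<le> inverse (real (Suc m)) * \<bar>f y\<bar>"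
        using \<alpha> by (intro order_trans[OF mult_left_mono[OF abs_ge_self] mult_right_mono]) auto
      then show ?thesis unfolding w_def expw_def
        by (intro ennreal_leI) (simp add: algebra_simps)
    qed
    have "ennreal \<delta> * (\<integral>\<^sup>+y. w m y * W m y \<partial>\<nu>) \<le> ennreal \<delta> * (\<integral>\<^sup>+y. expw (\<lambda>y. \<alpha> * f y) y *
        (\<Sum>n. (kop R (expw (\<lambda>y. \<alpha> * f y)) ^^ n) (indicator L) y) \<partial>\<nu>)"
      unfolding W_def
      by (intro mult_left_mono nn_integral_mono mult_mono w_le suminf_le R.kop_funpow_mono)
         (auto simp: space_nu)
    then show ?thesis using le1 by (rule order_trans)
  qed
  have "ennreal \<delta> * (\<integral>\<^sup>+y. expw (\<lambda>y. r * f y) y *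
        (\<Sum>n. (kop R (expw (\<lambda>y. r * f y)) ^^ n) (indicator L) y) \<partial>\<nu>)
      \<le> ennreal \<delta> * (\<integral>\<^sup>+y. expw (\<lambda>y. r * f y) y * (SUP m. W m y) \<partial>\<nu>)"
    by (intro mult_left_mono nn_integral_mono le) (auto simp: space_nu)
  also have "\<dots> = (SUP m. ennreal \<delta> * (\<integral>\<^sup>+y. w m y * W m y \<partial>\<nu>))"
    unfolding int[OF sets_nu] by (rule SUP_mult_left_ennreal)
  also have "\<dots> \<le> 1" by (intro SUP_least m_le)
  finally show ?thesis .
qed

end

section \<open>Spectral gap beyond the critical exponent\<close>

lemma (in subkernel) kop_split_indicator:
  assumes x: "x \<in> space S" and A: "A \<in> sets S" and [measurable]: "w \<in> borel_measurable S" "g \<in> borel_measurable S"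
  shows "kop \<kappa> w g x = kop \<kappa> (\<lambda>y. indicator (space S - A) y * w y) g x + kop \<kappa> (\<lambda>y. indicator A y * w y) g x"
proof -
  note A [measurable]
  have "kop \<kappa> w g x = (\<integral>\<^sup>+y. indicator (space S - A) y * w y * g y + indicator A y * w y * g y \<partial>\<kappa> x)"
    unfolding kop_def using x by (intro nn_integral_cong) (auto simp: space_kernel indicator_def)
  also have "\<dots> = kop \<kappa> (\<lambda>y. indicator (space S - A) y * w y) g x + kop \<kappa> (\<lambda>y. indicator A y * w y) g x"
    unfolding kop_def by (intro nn_integral_add measurable_kernel[OF x]) measurable
  finally show ?thesis .
qed

context split_kernel
begin

text \<open>The \<open>n\<close>-th term is the expected weight collected up to time \<open>n + 1\<close> on the event that the chain
  avoids \<open>L\<close> at the times \<open>1, \<dots>, n\<close>.\<close>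

definition excursion :: "('s \<Rightarrow> real) \<Rightarrow> 's \<Rightarrow> ennreal" where
  "excursion u x =
     (\<Sum>n. (kop P (\<lambda>y. indicator (space S - L) y * expw u y) ^^ n) (kop P (expw u) (\<lambda>_. 1)) x)"

lemma excursion_measurable [measurable]:
  assumes [measurable]: "u \<in> borel_measurable S" shows "excursion u \<in> borel_measurable S"
proof -
  have [measurable]: "kop P (expw u) (\<lambda>_. 1) \<in> borel_measurable S" by (rule kop_measurable) measurable
  show ?thesis unfolding excursion_def[abs_def] by measurable
qed

text \<open>A geometric series. It supplies the light end of the interpolation that bounds
  \<open>N\<close> in \<open>cycle_moment\<close>.\<close>

lemma excursion_le_const:
  assumes x: "x \<in> space S" and k: "k > 0" shows "excursion (\<lambda>_. - k) x \<le> ennreal (1 / (1 - exp (- k)))"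
proof -
  have "excursion (\<lambda>_. - k) x \<le> (\<Sum>n. ennreal (exp (- k)) ^ n * 1)"
    unfolding excursion_def
  proof (intro suminf_le kop_funpow_le_power x)
    fix y assume y: "y \<in> space S"
    have "(kop P (expw (\<lambda>_. - k)) ^^ 1) (\<lambda>_. 1) y \<le> ennreal (exp (- k)) ^ 1 * 1"
      by (rule kop_funpow_le_power) (auto simp: expw_def y)
    also have "\<dots> \<le> 1" using k by (simp add: ennreal_le_1)
    finally show "kop P (expw (\<lambda>_. - k)) (\<lambda>_. 1) y \<le> 1" by simp
  qed (auto simp: expw_def indicator_def)
  also have "\<dots> = ennreal (\<Sum>n. exp (- k) ^ n)"
    using k by (subst suminf_ennreal2[symmetric]) (auto simp: ennreal_power summable_geometric)
  also have "\<dots> = ennreal (1 / (1 - exp (- k)))"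
    using k by (subst suminf_geometric) auto
  finally show ?thesis .
qed

lemma excursion_convex:
  assumes x: "x \<in> space S" and t: "0 \<le> t" "t \<le> 1"
    and [measurable]: "u \<in> borel_measurable S" "v \<in> borel_measurable S"
  shows "excursion (\<lambda>y. (1 - t) * u y + t * v y) x \<le> ennreal (1 - t) * excursion u x + ennreal t * excursion v x"
proof -
  let ?s = "\<lambda>y. (1 - t) * u y + t * v y"
  let ?J = "\<lambda>u n. (kop P (\<lambda>y. indicator (space S - L) y * expw u y) ^^ n) (kop P (expw u) (\<lambda>_. 1))"
  \<comment> \<open>The final step may enter \<open>L\<close>, so it carries a different weight and
    gets its own one-step inequality. The shift \<open>z\<close> has to stay free for the iteration
    that follows.\<close>
  have base: "ennreal (exp (t * z)) * kop P (expw ?s) (\<lambda>_. 1) y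
      \<le> ennreal (1 - t) * kop P (expw u) (\<lambda>_. 1) y + ennreal (t * exp z) * kop P (expw v) (\<lambda>_. 1) y"
    if y: "y \<in> space S" for y z
    using kop_convex_step[of t "\<lambda>_. 1" u v "\<lambda>_. 1" "\<lambda>_. 1" "\<lambda>_. 1" y z] t y exp_le_convex_combination[OF t]
    by (simp flip: ennreal_plus)
  have "?J ?s n x \<le> ennreal (1 - t) * ?J u n x + ennreal t * ?J v n x" for n
    using kop_funpow_convex[of t "indicator (space S - L)" u v "kop P (expw ?s) (\<lambda>_. 1)"
        "kop P (expw u) (\<lambda>_. 1)" "kop P (expw v) (\<lambda>_. 1)" x 0 n] t x base
    by simp
  then have "excursion ?s x \<le> (\<Sum>n. ennreal (1 - t) * ?J u n x + ennreal t * ?J v n x)"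
    unfolding excursion_def by (intro suminf_le) auto
  also have "\<dots> = ennreal (1 - t) * excursion u x + ennreal t * excursion v x"
    unfolding excursion_def ennreal_suminf_cmult[symmetric] by (intro suminf_add[symmetric]) auto
  finally show ?thesis .
qed

lemma excursion_mono:
  assumes "x \<in> space S" "\<And>y. y \<in> space S \<Longrightarrow> u y \<le> v y"
  shows "excursion u x \<le> excursion v x"
  unfolding excursion_def using assms
  by (intro suminf_le kop_funpow_mono kop_mono mult_left_mono) (auto simp: expw_def intro!: ennreal_leI mult_right_mono)

text \<open>The potential \<open>W\<close> of \<open>1\<^sub>L\<close> at the critical exponent, bounded on \<open>L\<close> by (H3), is a Lyapunov function
  with a gap for the chain observed on \<open>L\<close>; convexity in the log-weight carries the gap over to a
  slightly larger exponent.\<close>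

theorem cycle_moment:
  fixes f :: "'s \<Rightarrow> real" and r \<alpha>0 b :: real
  defines "W \<equiv> \<lambda>x. \<Sum>n. (kop R (expw (\<lambda>y. r * f y)) ^^ n) (indicator L) x"
  assumes [measurable]: "f \<in> borel_measurable S" and r: "0 \<le> r" "r < \<alpha>0"
    and crit: "ennreal \<delta> * (\<integral>\<^sup>+y. expw (\<lambda>y. r * f y) y * W y \<partial>\<nu>) \<le> 1"
    and exc: "AE x in \<phi>. excursion (\<lambda>y. \<alpha>0 * f y + 2) x < \<infinity>"
    and H3: "\<And>F. (AE x in \<phi>. F x) \<Longrightarrow> \<exists>(l::nat) y D. (\<forall>i\<in>{1..l}. y i \<in> space S \<and> F (y i)) \<and>
      (\<forall>x\<in>L. \<forall>E\<in>sets S. emeasure (P x) E \<le> ennreal D * (\<Sum>i=1..l. emeasure (P (y i)) E))"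
    and f_le: "AE y in \<nu>. f y \<le> b"
  shows "\<exists>\<alpha> \<epsilon>. r < \<alpha> \<and> \<alpha> \<le> \<alpha>0 \<and> 0 < \<epsilon> \<and>
    (\<integral>\<^sup>+y. expw (\<lambda>y. \<alpha> * f y) y * (\<Sum>n. (kop R (expw (\<lambda>y. \<alpha> * f y + \<epsilon>)) ^^ n) (\<lambda>_. 1) y) \<partial>\<nu>) < \<infinity> \<and>
    (AE x in \<phi>. kop P (expw (\<lambda>y. \<alpha> * f y)) (\<lambda>y. \<Sum>n. (kop R (expw (\<lambda>y. \<alpha> * f y + \<epsilon>)) ^^ n) (\<lambda>_. 1) y) x < \<infinity>)"
proof -
  let ?cL = "indicator (space S - L) :: 's \<Rightarrow> ennreal" and ?iL = "indicator L :: 's \<Rightarrow> ennreal"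
  let ?wr = "expw (\<lambda>y. r * f y)"
  \<comment> \<open>The summand 1 in \<open>v1\<close> becomes the gain \<open>t\<close> per step of
    \<open>u\<close>. The summand 2 in \<open>v2\<close> leaves room for the constant
    \<open>- k\<close> with which \<open>N\<close> is bounded.\<close>
  define v1 where "v1 y = \<alpha>0 * f y + 1" for y
  define v2 where "v2 y = \<alpha>0 * f y + 2" for y
  have [measurable]: "v1 \<in> borel_measurable S" "v2 \<in> borel_measurable S" "W \<in> borel_measurable S"
    unfolding v1_def v2_def W_def by measurable
  have LS: "x \<in> space S" if "x \<in> L" for x using that sets.sets_into_space[OF L] by auto
  have W_eq: "W x = ?iL x + kop R ?wr W x" if "x \<in> space S" for x
    unfolding W_def by (rule R.potential_unfold[OF that]) measurable
  have W_ge: "1 \<le> W x" if "x \<in> L" for x using W_eq[OF LS[OF that]] that by simp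
  have psi_fin: "(\<integral>\<^sup>+y. ?wr y * W y \<partial>\<nu>) < \<infinity>"
    using crit delta by (cases "(\<integral>\<^sup>+y. ?wr y * W y \<partial>\<nu>)") (auto simp: ennreal_mult_top top_unique)
  have "AE x in \<phi>. W x < \<infinity>"
    by (rule AE_finite_if_R_absorbing[of W ?wr]) (use W_eq psi_fin in \<open>auto simp: expw_def[of _ "_::'s"]\<close>)
  with exc have "AE x in \<phi>. W x < \<infinity> \<and> excursion v2 x < \<infinity>"
    unfolding v2_def by eventually_elim auto
  from H3[OF this] obtain l :: nat and y D where y: "\<And>i. i \<in> {1..l} \<Longrightarrow> y i \<in> space S"
      "\<And>i. i \<in> {1..l} \<Longrightarrow> W (y i) < \<infinity>" "\<And>i. i \<in> {1..l} \<Longrightarrow> excursion v2 (y i) < \<infinity>"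
    and dom: "\<And>x E. x \<in> L \<Longrightarrow> E \<in> sets S \<Longrightarrow> emeasure (P x) E \<le> ennreal D * (\<Sum>i=1..l. emeasure (P (y i)) E)"
    by blast
  have dom_kop: "kop P w g x \<le> ennreal D * (\<Sum>i=1..l. kop P w g (y i))"
    if "x \<in> L" and [measurable]: "w \<in> borel_measurable S" "g \<in> borel_measurable S" for x w g
    unfolding kop_def
    by (rule nn_integral_le_sum_of_emeasure_le) (use that dom y LS sets_kernel in auto)
  \<comment> \<open>A step of \<open>R\<close> is below a step of \<open>P\<close>, which (H3)
    compares with the points \<open>y i\<close>. There \<open>kop P\<close> of \<open>W\<close> is
    finite, being at most \<open>W\<close> plus the regenerated mass.\<close>
  obtain CW where CW: "0 \<le> CW" "\<And>x. x \<in> L \<Longrightarrow> W x \<le> ennreal CW"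
  proof -
    let ?c = "1 + ennreal D * (\<Sum>i=1..l. kop P ?wr W (y i))"
    have "kop P ?wr W (y i) < \<infinity>" if i: "i \<in> {1..l}" for i
      using kop_decomposition[OF y(1)[OF i], of ?wr W] y(2)[OF i] W_eq[OF y(1)[OF i]] psi_fin
      by (auto simp: ennreal_mult_less_top indicator_def)
    then have "?c < \<infinity>" by (auto simp: ennreal_mult_less_top)
    moreover have "W x \<le> ?c" if "x \<in> L" for x
      unfolding W_eq[OF LS[OF that]]
      using that kop_R_le[OF LS[OF that], of ?wr W] dom_kop[OF that, of ?wr W]
      by (intro add_mono) auto
    ultimately show ?thesis using that[of "enn2real ?c"] by (auto simp: ennreal_enn2real_if less_top)
  qed
  \<comment> \<open>Each term of the series begins with a step of \<open>P\<close>, so (H3) applies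
    term by term, and only finiteness at the points \<open>y i\<close> enters.\<close>
  obtain CJ where CJ: "0 \<le> CJ" "\<And>x. x \<in> L \<Longrightarrow> excursion v2 x \<le> ennreal CJ"
  proof -
    let ?c = "ennreal D * (\<Sum>i=1..l. excursion v2 (y i))"
    let ?J = "\<lambda>n. (kop P (\<lambda>y. ?cL y * expw v2 y) ^^ n) (kop P (expw v2) (\<lambda>_. 1))"
    have "?J n x \<le> ennreal D * (\<Sum>i=1..l. ?J n (y i))" if "x \<in> L" for n x
    proof (cases n)
      case 0
      then show ?thesis using dom_kop[OF that, of "expw v2" "\<lambda>_. 1"] by simp
    next
      case (Suc m)
      then show ?thesis using dom_kop[OF that, of "\<lambda>y. ?cL y * expw v2 y" "?J m"] by simp
    qed
    then have "excursion v2 x \<le> (\<Sum>n. ennreal D * (\<Sum>i=1..l. ?J n (y i)))" if "x \<in> L" for x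
      unfolding excursion_def using that by (intro suminf_le) auto
    also have "(\<Sum>n. ennreal D * (\<Sum>i=1..l. ?J n (y i))) = ?c"
      unfolding excursion_def by (simp add: suminf_sum)
    finally have "excursion v2 x \<le> ?c" if "x \<in> L" for x using that .
    moreover have "?c < \<infinity>" using y(3) by (auto simp: ennreal_mult_less_top)
    ultimately show ?thesis using that[of "enn2real ?c"] by (auto simp: ennreal_enn2real_if less_top)
  qed
  \<comment> \<open>Makes \<open>t * CW * CJ\<close> at most 1/2, so that at most half of the gap is
    spent on the change of exponent. The added 1 keeps the denominator positive.\<close>
  define t where "t = 1 / (2 * (1 + CW * CJ))"
  have den: "1 + CW * CJ \<ge> 1" using CW CJ by simp
  have t: "0 < t" "t < 1" "t * (CW * CJ) \<le> 1 / 2"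
    using den unfolding t_def by (auto simp: field_simps)
  define \<alpha> where "\<alpha> = (1 - t) * r + t * \<alpha>0"
  define u where "u y = (1 - t) * (r * f y) + t * v1 y" for y
  have u_eq: "u = (\<lambda>y. \<alpha> * f y + t)" unfolding u_def v1_def \<alpha>_def by (auto simp: algebra_simps)
  have [measurable]: "u \<in> borel_measurable S" unfolding u_eq by measurable
  have \<alpha>: "r < \<alpha>" "\<alpha> < \<alpha>0" "\<alpha> > 0"
  proof -
    have "t * r < t * \<alpha>0" "(1 - t) * r < (1 - t) * \<alpha>0" using t r by auto
    then show "r < \<alpha>" "\<alpha> < \<alpha>0" unfolding \<alpha>_def by (auto simp: algebra_simps)
    then show "\<alpha> > 0" using r by simp
  qed
  \<comment> \<open>Weighted expectation of \<open>W\<close> at the next visit to \<open>L\<close>,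
    over paths that do not regenerate before it.\<close>
  define G where "G u x = (\<Sum>n. (kop R (\<lambda>y. ?cL y * expw u y) ^^ n) (kop R (\<lambda>y. ?iL y * expw u y) W) x)" for u x
  have [measurable]: "G u \<in> borel_measurable S" if [measurable]: "u \<in> borel_measurable S" for u
    unfolding G_def by measurable
  have G_unfold: "G u x = kop R (\<lambda>y. ?iL y * expw u y) W x + kop R (\<lambda>y. ?cL y * expw u y) (G u) x"
    if "x \<in> space S" and [measurable]: "u \<in> borel_measurable S" for u x
    unfolding G_def by (rule R.potential_unfold[OF that(1)]) measurable
  \<comment> \<open>\<open>W\<close> is a supersolution for the steps outside \<open>L\<close> with
    source \<open>indicator L + ?g\<close>, where \<open>?g\<close> accounts for entering
    \<open>L\<close>. At a point of \<open>L\<close> the indicator is the gap.\<close>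
  have gap_r: "G (\<lambda>y. r * f y) x + 1 \<le> W x" if x: "x \<in> L" for x
  proof -
    let ?g = "kop R (\<lambda>y. ?iL y * ?wr y) W"
    let ?\<Gamma> = "\<lambda>x. \<Sum>n. (kop R (\<lambda>y. ?cL y * ?wr y) ^^ n) (\<lambda>y. ?iL y + ?g y) x"
    have "G (\<lambda>y. r * f y) x + 1 = (?iL x + ?g x) + kop R (\<lambda>y. ?cL y * ?wr y) (G (\<lambda>y. r * f y)) x"
      using x G_unfold[OF LS[OF x], of "\<lambda>y. r * f y"] by (simp add: add_ac)
    also have "\<dots> \<le> (?iL x + ?g x) + kop R (\<lambda>y. ?cL y * ?wr y) ?\<Gamma> x"
      unfolding G_def using LS[OF x]
      by (intro add_left_mono R.kop_mono mult_left_mono suminf_le R.kop_funpow_mono) auto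
    also have "\<dots> = ?\<Gamma> x"
      by (rule R.potential_unfold[OF LS[OF x], symmetric]) measurable
    also have "\<dots> \<le> W x"
    proof (rule R.potential_minimal[OF LS[OF x]])
      fix z assume z: "z \<in> space S"
      show "?iL z + ?g z + kop R (\<lambda>y. ?cL y * ?wr y) W z \<le> W z"
        unfolding W_eq[OF z] using R.kop_split_indicator[OF z L, of ?wr W] by (simp add: add_ac)
    qed measurable
    finally show ?thesis .
  qed
  \<comment> \<open>On entering \<open>L\<close> the value of \<open>W\<close> is at most
    \<open>CW\<close>; what remains is a pure excursion of \<open>P\<close>.\<close>
  have G_v1: "G v1 x \<le> ennreal CW * excursion v2 x" if x: "x \<in> space S" for x
  proof -
    have le: "expw v1 y \<le> expw v2 y" for y unfolding v1_def v2_def expw_def by (intro ennreal_leI) auto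
    have 1: "kop R (\<lambda>y. ?iL y * expw v1 y) W z \<le> ennreal CW * kop P (expw v2) (\<lambda>_. 1) z" if z: "z \<in> space S" for z
    proof -
      have "kop R (\<lambda>y. ?iL y * expw v1 y) W z \<le> kop P (\<lambda>y. ?iL y * expw v1 y) W z"
        by (rule kop_R_le[OF z]) measurable
      also have "\<dots> \<le> kop P (expw v2) (\<lambda>_. ennreal CW * 1) z"
        using CW(2) by (intro kop_mono z) (auto simp: indicator_def intro!: mult_mono le)
      also have "\<dots> = ennreal CW * kop P (expw v2) (\<lambda>_. 1) z"
        by (rule kop_cmult[OF z]) measurable
      finally show ?thesis .
    qed
    have "G v1 x \<le> (\<Sum>n. (kop P (\<lambda>y. ?cL y * expw v2 y) ^^ n) (\<lambda>z. ennreal CW * kop P (expw v2) (\<lambda>_. 1) z) x)"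
      unfolding G_def using 1 by (intro suminf_le kop_R_funpow_le x mult_left_mono le) auto
    also have "\<dots> = ennreal CW * excursion v2 x"
      unfolding excursion_def ennreal_suminf_cmult[symmetric] by (intro suminf_cong kop_funpow_cmult x) measurable
    finally show ?thesis .
  qed
  have G_conv: "G u x \<le> ennreal (1 - t) * G (\<lambda>y. r * f y) x + ennreal t * G v1 x" if x: "x \<in> space S" for x
  proof -
    let ?J = "\<lambda>u n. (kop R (\<lambda>y. ?cL y * expw u y) ^^ n) (kop R (\<lambda>y. ?iL y * expw u y) W)"
    have ut: "u = (\<lambda>y. (1 - t) * (r * f y) + t * v1 y)" unfolding u_def by auto
    have t': "0 \<le> t" "t \<le> 1" using t by auto
    \<comment> \<open>The same \<open>W\<close> stands at both ends of the interpolation, so the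
      hypothesis on the endpoint functions reduces to convexity of the exponential.\<close>
    have W_step: "ennreal (exp (t * z)) * W y \<le> ennreal (1 - t) * W y + ennreal (t * exp z) * W y" for y z
    proof -
      have "ennreal (exp (t * z)) \<le> ennreal (1 - t) + ennreal (t * exp z)"
        using exp_le_convex_combination[OF t', of z] t' by (simp flip: ennreal_plus)
      then show ?thesis unfolding distrib_right[symmetric] by (intro mult_right_mono) auto
    qed
    have base: "ennreal (exp (t * z)) * kop R (\<lambda>y. ?iL y * expw u y) W y
        \<le> ennreal (1 - t) * kop R (\<lambda>y. ?iL y * expw (\<lambda>y. r * f y) y) W y
          + ennreal (t * exp z) * kop R (\<lambda>y. ?iL y * expw v1 y) W y" if y: "y \<in> space S" for y z
      unfolding ut by (rule R.kop_convex_step[OF t']) (use W_step y in measurable)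
    have "?J u n x \<le> ennreal (1 - t) * ?J (\<lambda>y. r * f y) n x + ennreal t * ?J v1 n x" for n
      using R.kop_funpow_convex[of t ?cL "\<lambda>y. r * f y" v1 "kop R (\<lambda>y. ?iL y * expw u y) W"
          "kop R (\<lambda>y. ?iL y * expw (\<lambda>y. r * f y) y) W" "kop R (\<lambda>y. ?iL y * expw v1 y) W" x 0 n,
          folded ut] t' x base
      by simp
    then have "G u x \<le> (\<Sum>n. ennreal (1 - t) * ?J (\<lambda>y. r * f y) n x + ennreal t * ?J v1 n x)"
      unfolding G_def by (intro suminf_le) auto
    also have "\<dots> = ennreal (1 - t) * G (\<lambda>y. r * f y) x + ennreal t * G v1 x"
      unfolding G_def ennreal_suminf_cmult[symmetric] by (intro suminf_add[symmetric]) auto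
    finally show ?thesis .
  qed
  have gap: "G u x + ennreal (1/2) \<le> W x" if x: "x \<in> L" for x
  proof -
    have "ennreal t * G v1 x \<le> ennreal t * (ennreal CW * ennreal CJ)"
      by (intro mult_left_mono order_trans[OF G_v1[OF LS[OF x]]] CJ(2)[OF x]) simp_all
    also have "\<dots> = ennreal (t * (CW * CJ))" using t CW CJ by (simp add: ennreal_mult)
    also have "\<dots> \<le> ennreal (1/2)" using t(3) by (rule ennreal_leI)
    finally have 1: "ennreal t * G v1 x \<le> ennreal (1/2)" .
    have 2: "ennreal (1 - t) * G (\<lambda>y. r * f y) x \<le> 1 * G (\<lambda>y. r * f y) x"
      using t by (intro mult_right_mono) (auto simp: ennreal_le_1)
    have "G u x + ennreal (1/2) \<le> (1 * G (\<lambda>y. r * f y) x + ennreal (1/2)) + ennreal (1/2)"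
      using G_conv[OF LS[OF x]] 1 2 by (intro add_mono order_trans[OF _ add_mono[OF 2 1]]) auto
    also have "\<dots> = G (\<lambda>y. r * f y) x + 1"
      using ennreal_plus[of "1/2" "1/2"] by (simp add: add.assoc del: ennreal_plus)
    finally show ?thesis using gap_r[OF x] by simp
  qed
  \<comment> \<open>Weight accumulated over the times before the return to \<open>L\<close>,
    including time 0.\<close>
  define N where "N x = (\<Sum>n. (kop R (\<lambda>y. ?cL y * expw u y) ^^ n) (\<lambda>_. 1) x)" for x
  have [measurable]: "N \<in> borel_measurable S" unfolding N_def by measurable
  have N_unfold: "N x = 1 + kop R (\<lambda>y. ?cL y * expw u y) N x" if "x \<in> space S" for x
    unfolding N_def by (rule R.potential_unfold[OF that]) measurable
  obtain CN where CN: "0 < CN" "\<And>x. x \<in> L \<Longrightarrow> N x \<le> ennreal CN"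
  proof -
    \<comment> \<open>Since \<open>\<tau> * \<alpha>0 = \<alpha>\<close>, the function
      \<open>\<tau> * v2\<close> is \<open>\<alpha> * f + 2 * \<tau>\<close>. The choice of
      \<open>k\<close> makes the admixture of the constant \<open>- k\<close> cost exactly \<tau>,
      and the remaining \<tau> covers the summand \<open>t\<close> of \<open>u\<close>.\<close>
    define \<tau> where "\<tau> = \<alpha> / \<alpha>0"
    have \<tau>: "0 < \<tau>" "\<tau> < 1" "t \<le> \<tau>" "\<tau> * \<alpha>0 = \<alpha>"
      using \<alpha> r t unfolding \<tau>_def by (auto simp: field_simps \<alpha>_def mult_left_le)
    define k where "k = \<tau> / (1 - \<tau>)"
    have k: "k > 0" "(1 - \<tau>) * k = \<tau>" using \<tau> unfolding k_def by auto
    have u_le: "u y \<le> (1 - \<tau>) * - k + \<tau> * v2 y" for y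
    proof -
      have "\<tau> * v2 y = \<alpha> * f y + 2 * \<tau>" unfolding v2_def \<tau>(4)[symmetric] by (simp add: algebra_simps)
      then show ?thesis unfolding u_eq using k(2) \<tau>(3) by simp
    qed
    let ?e = "1 / (1 - exp (- k))"
    have e: "?e \<ge> 0" using k by simp
    have "N x \<le> ennreal (1 + ?e + CJ)" if x: "x \<in> L" for x
    proof -
      have "N x = 1 + (\<Sum>n. (kop R (\<lambda>y. ?cL y * expw u y) ^^ n) (kop R (\<lambda>y. ?cL y * expw u y) (\<lambda>_. 1)) x)"
        unfolding N_def by (subst suminf_offset[of _ 1]) (simp_all add: funpow_swap1)
      also have "\<dots> \<le> 1 + excursion u x"
        unfolding excursion_def
      proof (intro add_left_mono suminf_le kop_R_funpow_le LS[OF x])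
        fix z assume z: "z \<in> space S"
        have "kop R (\<lambda>y. ?cL y * expw u y) (\<lambda>_. 1) z \<le> kop P (\<lambda>y. ?cL y * expw u y) (\<lambda>_. 1) z"
          by (rule kop_R_le[OF z]) measurable
        also have "\<dots> \<le> kop P (expw u) (\<lambda>_. 1) z"
          by (intro kop_mono z) (auto simp: indicator_def)
        finally show "kop R (\<lambda>y. ?cL y * expw u y) (\<lambda>_. 1) z \<le> kop P (expw u) (\<lambda>_. 1) z" .
      qed auto
      also have "excursion u x \<le> excursion (\<lambda>y. (1 - \<tau>) * - k + \<tau> * v2 y) x"
        by (intro excursion_mono LS[OF x] u_le)
      also have "\<dots> \<le> ennreal (1 - \<tau>) * excursion (\<lambda>_. - k) x + ennreal \<tau> * excursion v2 x"
        using \<tau> by (intro excursion_convex LS[OF x]) auto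
      also have "\<dots> \<le> 1 * ennreal ?e + 1 * ennreal CJ"
        using \<tau> excursion_le_const[OF LS[OF x] k(1)] CJ(2)[OF x]
        by (intro add_mono mult_mono) (auto simp: ennreal_le_1)
      finally show ?thesis using e CJ(1) by (simp add: add_left_mono add.assoc)
    qed
    then show ?thesis using that[of "1 + ?e + CJ"] e CJ(1) by auto
  qed
  \<comment> \<open>The gap 1/2 multiplied by \<open>c\<close> is \<open>CN\<close>, which pays for
    \<open>N\<close> on \<open>L\<close>.\<close>
  define c where "c = ennreal (2 * CN)"
  define V where "V x = N x + c * G u x" for x
  have [measurable]: "V \<in> borel_measurable S" unfolding V_def by measurable
  have V_le: "V x \<le> c * W x" if x: "x \<in> L" for x
  proof -
    have "V x \<le> ennreal CN + c * G u x" unfolding V_def using CN(2)[OF x] by (intro add_right_mono)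
    also have "ennreal CN = c * ennreal (1/2)" using CN(1) ennreal_mult[of "2 * CN" "1/2"] by (simp add: c_def del: ennreal_mult)
    also have "\<dots> + c * G u x = c * (G u x + ennreal (1/2))" by (simp add: distrib_left add_ac)
    also have "\<dots> \<le> c * W x" by (intro mult_left_mono gap x) auto
    finally show ?thesis .
  qed
  \<comment> \<open>The step is split by whether it enters \<open>L\<close>. If it does,
    \<open>V\<close> is replaced by \<open>c * W\<close>; the pieces then reassemble into the
    first-step equations of \<open>N\<close> and \<open>G u\<close>, and the 1 is the one in the
    equation for \<open>N\<close>.\<close>
  have V_super: "1 + kop R (expw u) V x \<le> V x" if x: "x \<in> space S" for x
  proof -
    have "kop R (expw u) V x = kop R (\<lambda>y. ?cL y * expw u y) V x + kop R (\<lambda>y. ?iL y * expw u y) V x"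
      by (rule R.kop_split_indicator[OF x L]) measurable
    also have "kop R (\<lambda>y. ?cL y * expw u y) V x
        = kop R (\<lambda>y. ?cL y * expw u y) N x + c * kop R (\<lambda>y. ?cL y * expw u y) (G u) x"
      unfolding V_def by (subst R.kop_add[OF x]) (simp_all add: R.kop_cmult[OF x])
    also have "kop R (\<lambda>y. ?iL y * expw u y) V x \<le> kop R (\<lambda>y. ?iL y * expw u y) (\<lambda>y. c * W y) x"
      using V_le by (intro R.kop_mono x) (auto simp: indicator_def intro!: mult_left_mono)
    also have "\<dots> = c * kop R (\<lambda>y. ?iL y * expw u y) W x"
      by (rule R.kop_cmult[OF x]) measurable
    finally show ?thesis unfolding V_def N_unfold[OF x] G_unfold[OF x \<open>u \<in> borel_measurable S\<close>]
      by (simp add: distrib_left add_ac add_left_mono)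
  qed
  define U where "U x = (\<Sum>n. (kop R (expw u) ^^ n) (\<lambda>_. 1) x)" for x
  have [measurable]: "U \<in> borel_measurable S" unfolding U_def by measurable
  have U_unfold: "U x = 1 + kop R (expw u) U x" if "x \<in> space S" for x
    unfolding U_def by (rule R.potential_unfold[OF that]) measurable
  have U_le: "U x \<le> V x" if "x \<in> space S" for x
    unfolding U_def using V_super by (intro R.potential_minimal that) auto
  let ?wa = "expw (\<lambda>y. \<alpha> * f y)"
  have wa_le: "?wa y \<le> expw u y" for y unfolding u_eq expw_def using t by (intro ennreal_leI) auto
  have nu_fin: "(\<integral>\<^sup>+y. ?wa y * U y \<partial>\<nu>) < \<infinity>"
  proof -
    \<comment> \<open>The measure \<nu> lives on the part of \<open>L\<close> where \<open>f\<close>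
      is at most \<open>b\<close>, so both factors are bounded by constants.\<close>
    have "AE y in \<nu>. ?wa y * U y \<le> ennreal (exp (\<alpha> * b)) * (c * ennreal CW)"
      using AE_nu_L f_le
    proof eventually_elim
      case (elim y)
      have "U y \<le> c * ennreal CW"
        using U_le[OF LS[OF elim(1)]] V_le[OF elim(1)] mult_left_mono[OF CW(2)[OF elim(1)], of c] by auto
      then show ?case unfolding expw_def using elim(2) \<alpha> by (intro mult_mono) (auto intro!: ennreal_leI)
    qed
    then have "(\<integral>\<^sup>+y. ?wa y * U y \<partial>\<nu>) \<le> (\<integral>\<^sup>+y. ennreal (exp (\<alpha> * b)) * (c * ennreal CW) \<partial>\<nu>)"
      by (rule nn_integral_mono_AE)
    also have "\<dots> < \<infinity>"
      using prob_space.emeasure_space_1[OF prob_nu] by (simp add: c_def ennreal_mult_less_top)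
    finally show ?thesis .
  qed
  have "AE x in \<phi>. U x < \<infinity>"
  proof (rule AE_finite_if_R_absorbing[of U ?wa])
    show "kop R ?wa U x \<le> U x" if "x \<in> space S" for x
      unfolding U_unfold[OF that] using wa_le
      by (intro order_trans[OF R.kop_mono[OF that, of ?wa U "expw u" U]] mult_right_mono) auto
  qed (use nu_fin in \<open>auto simp: expw_def[of _ "_::'s"]\<close>)
  then have "AE x in \<phi>. kop P ?wa U x < \<infinity>"
    using AE_phi_space
  proof eventually_elim
    case (elim x)
    have "kop R ?wa U x \<le> kop R (expw u) U x"
      by (intro R.kop_mono elim mult_right_mono wa_le) auto
    also have "\<dots> \<le> U x" unfolding U_unfold[OF elim(2)] by simp
    finally have "kop R ?wa U x < \<infinity>" using elim(1) by (rule le_less_trans)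
    then show ?case using kop_decomposition[OF elim(2), of ?wa U] nu_fin
      by (auto simp: ennreal_mult_less_top indicator_def)
  qed
  then show ?thesis using nu_fin t \<alpha> unfolding U_def u_eq
    by (intro exI[of _ \<alpha>] exI[of _ t]) auto
qed

text \<open>Let \<open>s\<close> be the supremum over all states of the probability of never
  regenerating. From \<open>L\<close> the next step is survived with probability
  \<open>1 - \<delta>\<close>, and from elsewhere \<open>L\<close> is reached almost surely. Hence
  \<open>s \<le> (1 - \<delta>) * s\<close>, which forces \<open>s = 0\<close>.\<close>

lemma no_regeneration_mass:
  assumes prob: "\<And>x. x \<in> space S \<Longrightarrow> emeasure (P x) (space S) = 1"
    and hit: "\<And>x. x \<in> space S \<Longrightarrow> (\<lambda>n. (kop P (indicator (space S - L)) ^^ n) (\<lambda>_. 1) x) \<longlonglongrightarrow> 0"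
    and x: "x \<in> space S"
  shows "(INF n. (kop R (\<lambda>_. 1) ^^ n) (\<lambda>_. 1) x) = 0"
proof -
  define q where "q n x = (kop R (\<lambda>_. 1) ^^ n) (\<lambda>_. 1) x" for n x
  define k where "k x = (INF n. q n x)" for x
  have [measurable]: "q n \<in> borel_measurable S" for n unfolding q_def by measurable
  have [measurable]: "k \<in> borel_measurable S" unfolding k_def by measurable
  have q_le_1: "q n y \<le> 1" if "y \<in> space S" for n y
    using R.kop_mass_le_1[OF that] unfolding q_def .
  have q_Suc: "q (Suc n) y = kop R (\<lambda>_. 1) (q n) y" for n y
    unfolding q_def by simp
  define s where "s = (SUP y\<in>space S. k y)"
  have k_le_s: "k y \<le> s" if "y \<in> space S" for y unfolding s_def using that by (rule SUP_upper)
  have s_le_1: "s \<le> 1" unfolding s_def k_def by (intro SUP_least INF_lower2[of 0]) (auto simp: q_def)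
  have q_dec: "q (Suc n) y \<le> q n y" if "y \<in> space S" for n y
    using R.kop_mass_decreasing[OF that] unfolding q_def .
  have k_eq: "k y = kop R (\<lambda>_. 1) k y" if y: "y \<in> space S" for y
  proof -
    have "kop R (\<lambda>_. 1) k y = (\<integral>\<^sup>+z. (INF n. q n z) \<partial>R y)" unfolding kop_def k_def by simp
    also have "\<dots> = (INF n. \<integral>\<^sup>+z. q n z \<partial>R y)"
    proof (rule nn_integral_monotone_convergence_INF_AE)
      show "AE z in R y. q (Suc n) z \<le> q n z" for n using q_dec y by (intro AE_I2) (auto simp: R.space_kernel)
      have "(\<integral>\<^sup>+z. q 0 z \<partial>R y) = q 1 y" unfolding q_def kop_def by simp
      then show "(\<integral>\<^sup>+z. q 0 z \<partial>R y) < \<infinity>" using q_le_1[OF y, of 1] by (auto simp: order_le_less_trans)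
    qed (auto intro: R.measurable_kernel[OF y])
    also have "\<dots> = (INF n. q (Suc n) y)" unfolding q_Suc kop_def by simp
    also have "\<dots> = k y" unfolding k_def
    proof (intro antisym INF_greatest)
      show "(INF n. q (Suc n) y) \<le> q n y" for n by (rule INF_lower2[of n]) (auto intro: q_dec y)
      show "(INF n. q n y) \<le> q (Suc n) y" for n by (rule INF_lower) simp
    qed
    finally show ?thesis by simp
  qed
  have R_L: "emeasure (R y) (space S) = ennreal (1 - \<delta>)" if y: "y \<in> L" for y
  proof -
    have yS: "y \<in> space S" using y sets.sets_into_space[OF L] by auto
    have nS: "emeasure \<nu> (space S) = 1" using prob_space.emeasure_space_1[OF prob_nu] by (simp add: space_nu)
    have "1 = emeasure (R y) (space S) + ennreal \<delta>"
      using decomposition[OF yS, of "space S"] prob[OF yS] y nS by simp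
    then have "ennreal 1 = emeasure (R y) (space S) + ennreal \<delta>" by simp
    then show ?thesis using delta
      by (cases "emeasure (R y) (space S)") (auto simp flip: ennreal_plus)
  qed
  have k_L: "k y \<le> ennreal (1 - \<delta>) * s" if y: "y \<in> L" for y
  proof -
    have yS: "y \<in> space S" using y sets.sets_into_space[OF L] by auto
    have "k y \<le> (\<integral>\<^sup>+z. s \<partial>R y)"
      unfolding k_eq[OF yS] unfolding kop_def using k_le_s by (intro nn_integral_mono) (auto simp: R.space_kernel yS)
    also have "\<dots> = s * ennreal (1 - \<delta>)" using R_L[OF y] by (simp add: R.space_kernel yS)
    finally show ?thesis by (simp add: mult.commute)
  qed
  have k_P: "k y \<le> kop P (\<lambda>_. 1) k y" if "y \<in> space S" for y
    using k_eq[OF that] kop_R_le[OF that, of "\<lambda>_. 1" k] by simp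
  \<comment> \<open>The error term is the probability of avoiding \<open>L\<close> at the times 1 to
    \<open>n\<close>; by \<open>hit\<close> it vanishes in the limit.\<close>
  have iter: "k y \<le> ennreal (1 - \<delta>) * s + (kop P (indicator (space S - L)) ^^ n) (\<lambda>_. 1) y"
    if "y \<in> space S" for n y
    using that
  proof (induction n arbitrary: y)
    case 0
    have "k y \<le> 1" using k_le_s[OF 0] s_le_1 by auto
    then show ?case by (simp add: add_increasing)
  next
    case (Suc n)
    show ?case
    proof (cases "y \<in> L")
      case True then show ?thesis using k_L by (auto intro: add_increasing2)
    next
      case False
      let ?g = "(kop P (indicator (space S - L)) ^^ n) (\<lambda>_. 1)" and ?c = "ennreal (1 - \<delta>) * s"
      have "k y \<le> (\<integral>\<^sup>+z. 1 * k z \<partial>P y)"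
        using k_P[OF Suc.prems] by (simp add: kop_def)
      also have "\<dots> \<le> (\<integral>\<^sup>+z. ?c + indicator (space S - L) z * ?g z \<partial>P y)"
      proof (intro nn_integral_mono)
        fix z assume "z \<in> space (P y)"
        then have z: "z \<in> space S" using Suc.prems by (simp add: space_kernel)
        show "1 * k z \<le> ?c + indicator (space S - L) z * ?g z"
        proof (cases "z \<in> L")
          case True then show ?thesis using k_L[OF True] by simp
        next
          case False
          then have "indicator (space S - L) z = (1::ennreal)" using z by simp
          then show ?thesis using Suc.IH[OF z] by simp
        qed
      qed
      also have "\<dots> = ?c + kop P (indicator (space S - L)) ?g y"
        unfolding kop_def[of _ _ _ y]
        by (subst nn_integral_add) (auto intro!: measurable_kernel[OF Suc.prems] simp: prob Suc.prems space_kernel)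
      finally show ?thesis by simp
    qed
  qed
  have "k y \<le> ennreal (1 - \<delta>) * s + 0" if y: "y \<in> space S" for y
  proof (rule LIMSEQ_le_const)
    show "(\<lambda>n. ennreal (1 - \<delta>) * s + (kop P (indicator (space S - L)) ^^ n) (\<lambda>_. 1) y) \<longlonglongrightarrow> ennreal (1 - \<delta>) * s + 0"
      by (intro tendsto_add tendsto_const hit y)
  qed (use iter[OF y] in auto)
  then have "(SUP y\<in>space S. k y) \<le> ennreal (1 - \<delta>) * s" by (intro SUP_least) simp
  then have s_le: "s \<le> ennreal (1 - \<delta>) * s" by (simp only: s_def[symmetric])
  have "s = 0"
  proof (cases s)
    case (real a)
    \<comment> \<open>\<open>ennreal\<close> sends a negative \<open>1 - \<delta>\<close> to 0; the
      maximum covers that case.\<close>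
    have "ennreal (1 - \<delta>) = ennreal (max 0 (1 - \<delta>))" by (simp add: max_def ennreal_neg)
    then have "ennreal a \<le> ennreal (max 0 (1 - \<delta>) * a)"
      using s_le real by (simp add: ennreal_mult)
    then have "a \<le> max 0 (1 - \<delta>) * a" using real by (auto simp: ennreal_le_iff2)
    then have "a = 0" using real delta by (auto simp: max_def algebra_simps mult_le_0_iff split: if_splits)
    then show ?thesis using real by simp
  qed (use s_le_1 in \<open>simp add: top_unique\<close>)
  then show ?thesis using k_le_s[OF x] unfolding k_def q_def by simp
qed

end

section \<open>Laws of the chain and of the split chain\<close>

text \<open>The factors \<open>H\<close> and \<open>H'\<close> may differ because in
  \<open>survive\<close> the indicator of no regeneration stands on the left only; on the right its
  effect is absorbed into the defective kernel.\<close>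

lemma nn_integral_kernel_extend:
  assumes \<kappa>: "subkernel S \<kappa>" and V [measurable]: "V \<in> M \<rightarrow>\<^sub>M S" and Z [measurable]: "Z \<in> M \<rightarrow>\<^sub>M S"
    and [measurable]: "H \<in> borel_measurable M" "H' \<in> borel_measurable M"
    and eq: "\<And>E. E \<in> sets S \<Longrightarrow>
      (\<integral>\<^sup>+\<omega>. H \<omega> * indicator E (V \<omega>) \<partial>M) = (\<integral>\<^sup>+\<omega>. H' \<omega> * emeasure (\<kappa> (Z \<omega>)) E \<partial>M)"
    and g: "g \<in> borel_measurable S"
  shows "(\<integral>\<^sup>+\<omega>. H \<omega> * g (V \<omega>) \<partial>M) = (\<integral>\<^sup>+\<omega>. H' \<omega> * (\<integral>\<^sup>+y. g y \<partial>\<kappa> (Z \<omega>)) \<partial>M)"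
proof -
  interpret subkernel S \<kappa> by fact
  note ZS = measurable_space[OF Z] and VS = measurable_space[OF V]
  have kint: "(\<lambda>\<omega>. \<integral>\<^sup>+y. u y \<partial>\<kappa> (Z \<omega>)) \<in> borel_measurable M" if "u \<in> borel_measurable S" for u
    by (rule measurable_compose[OF measurable_compose[OF Z kernel] nn_integral_measurable_subprob_algebra[OF that]])
  show ?thesis using g
  proof (induction rule: borel_measurable_induct)
    case (cong f g)
    have "(\<integral>\<^sup>+\<omega>. H \<omega> * f (V \<omega>) \<partial>M) = (\<integral>\<^sup>+\<omega>. H \<omega> * g (V \<omega>) \<partial>M)"
      using cong(3) VS by (intro nn_integral_cong) auto
    moreover have "(\<integral>\<^sup>+y. f y \<partial>\<kappa> (Z \<omega>)) = (\<integral>\<^sup>+y. g y \<partial>\<kappa> (Z \<omega>))" if "\<omega> \<in> space M" for \<omega>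
      using cong(3) ZS[OF that] by (intro nn_integral_cong) (auto simp: space_kernel)
    ultimately show ?case using cong(4) by (simp cong: nn_integral_cong)
  next
    case (set A)
    have "(\<integral>\<^sup>+y. indicator A y \<partial>\<kappa> (Z \<omega>)) = emeasure (\<kappa> (Z \<omega>)) A" if "\<omega> \<in> space M" for \<omega>
      using set ZS[OF that] by (simp add: sets_kernel)
    then show ?case using eq[OF set] by (simp cong: nn_integral_cong)
  next
    case (mult u c)
    note [measurable] = mult(2) kint[OF mult(2)]
    have "(\<integral>\<^sup>+y. c * u y \<partial>\<kappa> (Z \<omega>)) = c * (\<integral>\<^sup>+y. u y \<partial>\<kappa> (Z \<omega>))" if "\<omega> \<in> space M" for \<omega>
      using measurable_kernel[OF ZS[OF that] mult(2)] by (rule nn_integral_cmult)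
    then have "(\<integral>\<^sup>+\<omega>. H' \<omega> * (\<integral>\<^sup>+y. c * u y \<partial>\<kappa> (Z \<omega>)) \<partial>M) = (\<integral>\<^sup>+\<omega>. c * (H' \<omega> * (\<integral>\<^sup>+y. u y \<partial>\<kappa> (Z \<omega>))) \<partial>M)"
      by (intro nn_integral_cong) (simp add: mult_ac)
    also have "\<dots> = c * (\<integral>\<^sup>+\<omega>. H' \<omega> * (\<integral>\<^sup>+y. u y \<partial>\<kappa> (Z \<omega>)) \<partial>M)"
      by (rule nn_integral_cmult) measurable
    also have "\<dots> = c * (\<integral>\<^sup>+\<omega>. H \<omega> * u (V \<omega>) \<partial>M)" using mult(3,4) by simp
    also have "\<dots> = (\<integral>\<^sup>+\<omega>. c * (H \<omega> * u (V \<omega>)) \<partial>M)"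
      by (rule nn_integral_cmult[symmetric]) measurable
    finally show ?case by (simp add: mult_ac)
  next
    case (add u v)
    have [measurable]: "u \<in> borel_measurable S" "v \<in> borel_measurable S" by fact+
    note [measurable] = kint[OF \<open>u \<in> _\<close>] kint[OF \<open>v \<in> _\<close>]
    have "(\<integral>\<^sup>+y. v y + u y \<partial>\<kappa> (Z \<omega>)) = (\<integral>\<^sup>+y. v y \<partial>\<kappa> (Z \<omega>)) + (\<integral>\<^sup>+y. u y \<partial>\<kappa> (Z \<omega>))" if "\<omega> \<in> space M" for \<omega>
      by (intro nn_integral_add measurable_kernel[OF ZS[OF that]]) fact+
    then have "(\<integral>\<^sup>+\<omega>. H' \<omega> * (\<integral>\<^sup>+y. v y + u y \<partial>\<kappa> (Z \<omega>)) \<partial>M)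
        = (\<integral>\<^sup>+\<omega>. H' \<omega> * (\<integral>\<^sup>+y. v y \<partial>\<kappa> (Z \<omega>)) + H' \<omega> * (\<integral>\<^sup>+y. u y \<partial>\<kappa> (Z \<omega>)) \<partial>M)"
      by (intro nn_integral_cong) (simp add: distrib_left)
    also have "\<dots> = (\<integral>\<^sup>+\<omega>. H \<omega> * v (V \<omega>) \<partial>M) + (\<integral>\<^sup>+\<omega>. H \<omega> * u (V \<omega>) \<partial>M)"
      using add by (subst nn_integral_add) auto
    also have "\<dots> = (\<integral>\<^sup>+\<omega>. H \<omega> * v (V \<omega>) + H \<omega> * u (V \<omega>) \<partial>M)"
      by (rule nn_integral_add[symmetric]) measurable
    finally show ?case by (simp add: distrib_left)
  next
    case (seq U)
    have U [measurable]: "U i \<in> borel_measurable S" for i by (rule seq)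
    note kU [measurable] = kint[OF U]
    have inc: "U i y \<le> U j y" if "i \<le> j" for i j y
      using seq(3) that by (auto simp: incseq_def le_fun_def)
    have "(\<integral>\<^sup>+y. (SUP i. U i) y \<partial>\<kappa> (Z \<omega>)) = (SUP i. \<integral>\<^sup>+y. U i y \<partial>\<kappa> (Z \<omega>))" if "\<omega> \<in> space M" for \<omega>
      unfolding SUP_apply using measurable_kernel[OF ZS[OF that] U] seq(3)
      by (intro nn_integral_monotone_convergence_SUP) auto
    then have "(\<integral>\<^sup>+\<omega>. H' \<omega> * (\<integral>\<^sup>+y. (SUP i. U i) y \<partial>\<kappa> (Z \<omega>)) \<partial>M)
        = (\<integral>\<^sup>+\<omega>. (SUP i. H' \<omega> * (\<integral>\<^sup>+y. U i y \<partial>\<kappa> (Z \<omega>))) \<partial>M)"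
      by (intro nn_integral_cong) (simp add: SUP_mult_left_ennreal)
    also have "\<dots> = (SUP i. \<integral>\<^sup>+\<omega>. H' \<omega> * (\<integral>\<^sup>+y. U i y \<partial>\<kappa> (Z \<omega>)) \<partial>M)"
      by (intro nn_integral_monotone_convergence_SUP)
         (auto simp: incseq_def le_fun_def intro!: mult_left_mono nn_integral_mono inc)
    also have "\<dots> = (SUP i. \<integral>\<^sup>+\<omega>. H \<omega> * U i (V \<omega>) \<partial>M)" using seq by simp
    also have "\<dots> = (\<integral>\<^sup>+\<omega>. (SUP i. H \<omega> * U i (V \<omega>)) \<partial>M)"
      by (intro nn_integral_monotone_convergence_SUP[symmetric])
         (auto simp: incseq_def le_fun_def intro!: mult_left_mono inc)
    finally show ?case by (simp add: SUP_mult_left_ennreal image_comp)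
  qed
qed

section \<open>Integrating out the last step of a process\<close>

lemma subalgebra_vimage_algebra:
  assumes "g \<in> M \<rightarrow>\<^sub>M N" shows "subalgebra M (vimage_algebra (space M) g N)"
  unfolding subalgebra_def using sets_image_in_sets[OF refl assms] by simp

lemma measurable_past_component:
  assumes W: "\<And>i. W i \<in> M \<rightarrow>\<^sub>M Z" and i: "i \<le> n"
  shows "W i \<in> past M Z W n \<rightarrow>\<^sub>M Z"
proof -
  have "(\<lambda>\<omega>. \<lambda>i\<in>{..n}. W i \<omega>) \<in> past M Z W n \<rightarrow>\<^sub>M Pi\<^sub>M {..n} (\<lambda>_. Z)"
    unfolding past_def using measurable_space[OF W]
    by (intro measurable_vimage_algebra1) (auto simp: space_PiM)
  from measurable_compose[OF this measurable_component_singleton[of i "{..n}" "\<lambda>_. Z"]]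
  show ?thesis using i by simp
qed

lemma subalgebra_past:
  assumes [measurable]: "\<And>i. W i \<in> M \<rightarrow>\<^sub>M Z" shows "subalgebra M (past M Z W n)"
  unfolding past_def by (rule subalgebra_vimage_algebra) measurable

text \<open>The conditional probabilities in the two chain definitions are used only in this
  integrated form.\<close>

lemma nn_integral_past_step:
  assumes M: "prob_space M" and W: "\<And>i. W i \<in> M \<rightarrow>\<^sub>M Z" and [measurable]: "V \<in> M \<rightarrow>\<^sub>M S" "E \<in> sets S"
    and ce: "AE \<omega> in M. nn_cond_exp M (past M Z W n) (\<lambda>\<omega>'. indicator E (V \<omega>')) \<omega> = k \<omega>"
    and F: "F \<in> borel_measurable (past M Z W n)"
  shows "(\<integral>\<^sup>+\<omega>. F \<omega> * indicator E (V \<omega>) \<partial>M) = (\<integral>\<^sup>+\<omega>. F \<omega> * k \<omega> \<partial>M)"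
proof -
  interpret prob_space M by fact
  have "finite_measure_subalgebra M (past M Z W n)"
    by unfold_locales (rule subalgebra_past[OF W])
  then interpret sigma_finite_subalgebra M "past M Z W n"
    by (rule finite_measure_subalgebra_is_sigma_finite)
  have "(\<integral>\<^sup>+\<omega>. F \<omega> * indicator E (V \<omega>) \<partial>M)
      = (\<integral>\<^sup>+\<omega>. F \<omega> * nn_cond_exp M (past M Z W n) (\<lambda>\<omega>'. indicator E (V \<omega>')) \<omega> \<partial>M)"
    by (rule nn_cond_exp_intg[symmetric]) (use F in measurable)
  also have "\<dots> = (\<integral>\<^sup>+\<omega>. F \<omega> * k \<omega> \<partial>M)"
    using ce by (intro nn_integral_cong_AE) auto
  finally show ?thesis .
qed

lemma nn_integral_initial_state:
  assumes "X \<in> M \<rightarrow>\<^sub>M S" "distr M S X = return S x" "x \<in> space S" "g \<in> borel_measurable S"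
  shows "(\<integral>\<^sup>+\<omega>. g (X \<omega>) \<partial>M) = g x"
proof -
  have "(\<integral>\<^sup>+\<omega>. g (X \<omega>) \<partial>M) = (\<integral>\<^sup>+y. g y \<partial>distr M S X)"
    by (rule nn_integral_distr[symmetric]) (use assms in auto)
  also have "\<dots> = g x" unfolding assms(2) using assms by (intro nn_integral_return) auto
  finally show ?thesis .
qed

lemma markov_chain_nn_integral:
  assumes P: "subkernel S P" and x: "x \<in> space S" and mc: "markov_chain_from S P x M X"
    and [measurable]: "w \<in> borel_measurable S" and g: "g \<in> borel_measurable S"
  shows "(\<integral>\<^sup>+\<omega>. (\<Prod>i=1..n. w (X i \<omega>)) * g (X n \<omega>) \<partial>M) = (kop P w ^^ n) g x"
  using g
proof (induction n arbitrary: g)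
  interpret subkernel S P by fact
  have M: "prob_space M" and X: "\<And>n. X n \<in> M \<rightarrow>\<^sub>M S" and X0: "distr M S (X 0) = return S x"
    and ce: "\<And>n E. E \<in> sets S \<Longrightarrow> AE \<omega> in M.
      nn_cond_exp M (past M S X n) (\<lambda>\<omega>'. indicator E (X (Suc n) \<omega>')) \<omega> = emeasure (P (X n \<omega>)) E"
    using mc unfolding markov_chain_from_def by auto
  {
    case 0
    then show ?case using nn_integral_initial_state[OF X X0 x, of g] by simp
  next
    case (Suc n)
    note [measurable] = X Suc.prems
    \<comment> \<open>The newest step is integrated out first, which replaces \<open>g\<close> by
      \<open>kop P w g\<close>; this is why the induction generalises \<open>g\<close>.\<close>
    let ?F = "\<lambda>\<omega>. \<Prod>i=1..n. w (X i \<omega>)"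
    have F: "?F \<in> borel_measurable (past M S X n)"
      using measurable_past_component[of X M S _ n, OF X]
      by (intro borel_measurable_prod_ennreal) (auto intro: measurable_compose)
    have "(\<integral>\<^sup>+\<omega>. (\<Prod>i=1..Suc n. w (X i \<omega>)) * g (X (Suc n) \<omega>) \<partial>M)
        = (\<integral>\<^sup>+\<omega>. ?F \<omega> * (\<lambda>y. w y * g y) (X (Suc n) \<omega>) \<partial>M)"
      by (simp add: mult_ac)
    also have "\<dots> = (\<integral>\<^sup>+\<omega>. ?F \<omega> * (\<integral>\<^sup>+y. w y * g y \<partial>P (X n \<omega>)) \<partial>M)"
    proof (rule nn_integral_kernel_extend[OF P])
      show "(\<integral>\<^sup>+\<omega>. ?F \<omega> * indicator E (X (Suc n) \<omega>) \<partial>M) = (\<integral>\<^sup>+\<omega>. ?F \<omega> * emeasure (P (X n \<omega>)) E \<partial>M)"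
        if E: "E \<in> sets S" for E
        by (rule nn_integral_past_step[OF M X X E ce[OF E] F])
    qed measurable
    also have "\<dots> = (\<integral>\<^sup>+\<omega>. ?F \<omega> * kop P w g (X n \<omega>) \<partial>M)" unfolding kop_def ..
    also have "\<dots> = (kop P w ^^ n) (kop P w g) x" by (rule Suc.IH) measurable
    finally show ?case by (simp add: funpow_swap1)
  }
qed

text \<open>Both \<open>a\<close> and \<open>b\<close> take values in \<open>ennreal\<close>, so
  independence of the differently typed elements passes to \<open>indep_var\<close>, and the product
  formula applies.\<close>

lemma indep_elements_nn_integral:
  assumes M: "prob_space M" and ind: "indep_elements M MU U MV V"
    and a: "a \<in> borel_measurable (vimage_algebra (space M) U MU)"
    and b: "b \<in> borel_measurable (vimage_algebra (space M) V MV)"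
  shows "(\<integral>\<^sup>+\<omega>. a \<omega> * b \<omega> \<partial>M) = (\<integral>\<^sup>+\<omega>. a \<omega> \<partial>M) * (\<integral>\<^sup>+\<omega>. b \<omega> \<partial>M :: ennreal)"
proof -
  interpret prob_space M by fact
  have meas: "U \<in> M \<rightarrow>\<^sub>M MU" "V \<in> M \<rightarrow>\<^sub>M MV"
    and indep: "indep_set (sets (vimage_algebra (space M) U MU)) (sets (vimage_algebra (space M) V MV))"
    using ind unfolding indep_elements_def by auto
  have sub: "sigma_sets (space M) {c -` A \<inter> space M |A. A \<in> sets borel} \<subseteq> sets (vimage_algebra (space M) W N)"
    if "c \<in> borel_measurable (vimage_algebra (space M) W N)" for c :: "_ \<Rightarrow> ennreal" and W :: "_ \<Rightarrow> 'q" and N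
    using measurable_sets[OF that] sets.sigma_sets_subset[of _ "vimage_algebra (space M) W N"]
    by (subst space_vimage_algebra[of "space M" W N, symmetric]) (rule sets.sigma_sets_subset, auto)
  have "indep_var borel a borel b"
    unfolding indep_var_eq
  proof (intro conjI)
    show "a \<in> borel_measurable M" "b \<in> borel_measurable M"
      using measurable_from_subalg[OF subalgebra_vimage_algebra] meas a b by blast+
    show "indep_set (sigma_sets (space M) {a -` A \<inter> space M |A. A \<in> sets borel})
        (sigma_sets (space M) {b -` A \<inter> space M |A. A \<in> sets borel})"
      using indep sub[OF a] sub[OF b] unfolding indep_sets2_eq by blast
  qed
  moreover have "case_bool borel borel = (\<lambda>_::bool. borel :: ennreal measure)"
    by (rule ext) (simp split: bool.split)
  ultimately have "indep_vars (\<lambda>_. borel) (case_bool a b) UNIV"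
    unfolding indep_var_def by simp
  from indep_vars_nn_integral[OF _ this] show ?thesis by (simp add: UNIV_bool mult.commute)
qed

section \<open>The split chain: histories, regeneration and survival\<close>

locale split_chain = split_kernel S P \<phi> R L \<delta> \<nu> + M: prob_space M
  for S :: "'s measure" and P \<phi> R L \<delta> \<nu> and M :: "'v measure" +
  fixes \<mu>B :: "real measure" and x :: 's and X :: "nat \<Rightarrow> 'v \<Rightarrow> 's"
    and Y :: "nat \<Rightarrow> 'v \<Rightarrow> bool" and B :: "nat \<Rightarrow> 'v \<Rightarrow> real"
  assumes x: "x \<in> space S" and prob_P: "\<And>y. y \<in> space S \<Longrightarrow> emeasure (P y) (space S) = 1"
    and chain: "split_chain_from S P L \<delta> \<nu> \<mu>B x M X Y B"
begin

lemma X_measurable [measurable]: "X n \<in> M \<rightarrow>\<^sub>M S"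
  using chain by (simp add: split_chain_from_def)

lemma X_space: "\<omega> \<in> space M \<Longrightarrow> X n \<omega> \<in> space S"
  using measurable_space[OF X_measurable] .

text \<open>The history excludes \<open>Y n\<close>, which is therefore independent of it.\<close>

definition history :: "nat \<Rightarrow> 'v measure" where
  "history n = vimage_algebra (space M) (\<lambda>\<omega>. (\<lambda>i\<in>{..n}. X i \<omega>, \<lambda>i\<in>{..<n}. Y i \<omega>))
     (Pi\<^sub>M {..n} (\<lambda>_. S) \<Otimes>\<^sub>M Pi\<^sub>M {..<n} (\<lambda>_. count_space UNIV))"

lemma Y_indep: "indep_elements M (count_space UNIV) (Y n)
        (Pi\<^sub>M {..n} (\<lambda>_. S) \<Otimes>\<^sub>M Pi\<^sub>M {..<n} (\<lambda>_. count_space UNIV))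
        (\<lambda>\<omega>. (\<lambda>i\<in>{..n}. X i \<omega>, \<lambda>i\<in>{..<n}. Y i \<omega>))"
  using chain by (simp add: split_chain_from_def)

lemma Y_measurable [measurable]: "Y n \<in> M \<rightarrow>\<^sub>M count_space UNIV"
  using Y_indep[of n] by (simp add: indep_elements_def)

lemma space_history [simp]: "space (history n) = space M"
  by (simp add: history_def)

lemma measurable_history_pair:
  "(\<lambda>\<omega>. (\<lambda>i\<in>{..n}. X i \<omega>, \<lambda>i\<in>{..<n}. Y i \<omega>)) \<in> history n \<rightarrow>\<^sub>M
     (Pi\<^sub>M {..n} (\<lambda>_. S) \<Otimes>\<^sub>M Pi\<^sub>M {..<n} (\<lambda>_. count_space UNIV))"
  unfolding history_def
  by (intro measurable_vimage_algebra1) (auto simp: space_PiM space_pair_measure X_space)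

lemma measurable_X_history:
  assumes "i \<le> n" shows "X i \<in> history n \<rightarrow>\<^sub>M S"
proof -
  from measurable_compose[OF measurable_compose[OF measurable_history_pair measurable_fst]
      measurable_component_singleton[of i "{..n}" "\<lambda>_. S"]]
  show ?thesis using assms by simp
qed

lemma measurable_Y_history:
  assumes "i < n" shows "Y i \<in> history n \<rightarrow>\<^sub>M count_space UNIV"
proof -
  from measurable_compose[OF measurable_compose[OF measurable_history_pair measurable_snd]
      measurable_component_singleton[of i "{..<n}" "\<lambda>_. count_space UNIV"]]
  show ?thesis using assms by simp
qed

text \<open>In contrast to \<open>history n\<close> this contains \<open>Y n\<close>; the law of
  \<open>X (Suc n)\<close> is prescribed relative to this larger sigma-algebra.\<close>

abbreviation "full_past \<equiv> past M (S \<Otimes>\<^sub>M count_space UNIV) (\<lambda>i \<omega>. (X i \<omega>, Y i \<omega>))"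

lemma space_full_past [simp]: "space (full_past n) = space M"
  by (simp add: past_def)

lemma
  assumes "i \<le> n"
  shows measurable_X_past: "X i \<in> full_past n \<rightarrow>\<^sub>M S"
    and measurable_Y_past: "Y i \<in> full_past n \<rightarrow>\<^sub>M count_space UNIV"
proof -
  have "(\<lambda>\<omega>. (X i \<omega>, Y i \<omega>)) \<in> full_past n \<rightarrow>\<^sub>M S \<Otimes>\<^sub>M count_space UNIV"
    using assms by (intro measurable_past_component) measurable
  from measurable_compose[OF this measurable_fst] measurable_compose[OF this measurable_snd]
  show "X i \<in> full_past n \<rightarrow>\<^sub>M S" "Y i \<in> full_past n \<rightarrow>\<^sub>M count_space UNIV" by simp_all
qed

lemma measurable_history_imp_past:
  assumes "F \<in> borel_measurable (history n)" shows "F \<in> borel_measurable (full_past n)"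
proof -
  have "(\<lambda>\<omega>. \<omega>) \<in> full_past n \<rightarrow>\<^sub>M history n"
    unfolding history_def
  proof (rule measurable_vimage_algebra2)
    show "(\<lambda>\<omega>. (\<lambda>i\<in>{..n}. X i \<omega>, \<lambda>i\<in>{..<n}. Y i \<omega>)) \<in> full_past n \<rightarrow>\<^sub>M
        (Pi\<^sub>M {..n} (\<lambda>_. S) \<Otimes>\<^sub>M Pi\<^sub>M {..<n} (\<lambda>_. count_space UNIV))"
      by (intro measurable_Pair measurable_restrict measurable_X_past measurable_Y_past) auto
  qed simp
  from measurable_compose[OF this assms] show ?thesis .
qed

lemma measurable_history_imp_M:
  assumes "F \<in> borel_measurable (history n)" shows "F \<in> borel_measurable M"
  using assms Y_indep[of n] unfolding history_def indep_elements_def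
  by (blast intro: measurable_from_subalg[OF subalgebra_vimage_algebra])

lemma measurable_past_imp_M:
  assumes "F \<in> borel_measurable (full_past n)" shows "F \<in> borel_measurable M"
proof (rule measurable_from_subalg[OF _ assms])
  show "subalgebra M (full_past n)" by (rule subalgebra_past) measurable
qed

definition regen :: "nat \<Rightarrow> 'v \<Rightarrow> bool" where
  "regen n \<omega> \<longleftrightarrow> X n \<omega> \<in> L \<and> Y n \<omega>"

lemma regen_measurable [measurable]: "Measurable.pred M (regen n)"
  unfolding regen_def[abs_def] by measurable

lemma transition:
  assumes "F \<in> borel_measurable (full_past n)" "E \<in> sets S"
  shows "(\<integral>\<^sup>+\<omega>. F \<omega> * indicator E (X (Suc n) \<omega>) \<partial>M)
    = (\<integral>\<^sup>+\<omega>. F \<omega> * split_transition P L \<delta> \<nu> (X n \<omega>, Y n \<omega>) E \<partial>M)"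
  using chain assms(2) unfolding split_chain_from_def
  by (intro nn_integral_past_step[OF M.prob_space_axioms _ X_measurable assms(2) _ assms(1)]) auto

text \<open>At a regeneration the next state is drawn from \<nu> whatever the past,
  \<open>Y n\<close> included, so the integral factorises.\<close>

lemma regenerate:
  assumes F: "F \<in> borel_measurable (full_past n)" and g: "g \<in> borel_measurable S"
  shows "(\<integral>\<^sup>+\<omega>. F \<omega> * indicator {\<omega>. regen n \<omega>} \<omega> * g (X (Suc n) \<omega>) \<partial>M)
    = (\<integral>\<^sup>+\<omega>. F \<omega> * indicator {\<omega>. regen n \<omega>} \<omega> \<partial>M) * (\<integral>\<^sup>+y. g y \<partial>\<nu>)"
proof -
  note [measurable] = measurable_X_past[OF order_refl, of n] measurable_Y_past[OF order_refl, of n] F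
  let ?F = "\<lambda>\<omega>. F \<omega> * indicator {\<omega>. regen n \<omega>} \<omega>"
  have Fp: "?F \<in> borel_measurable (full_past n)" unfolding regen_def by measurable
  note [measurable] = measurable_past_imp_M[OF Fp]
  have "subkernel S (\<lambda>_. \<nu>)"
    using prob_nu sets_nu
    by unfold_locales (intro measurable_const, simp add: space_subprob_algebra prob_space_imp_subprob_space)
  then have "(\<integral>\<^sup>+\<omega>. ?F \<omega> * g (X (Suc n) \<omega>) \<partial>M) = (\<integral>\<^sup>+\<omega>. ?F \<omega> * (\<integral>\<^sup>+y. g y \<partial>\<nu>) \<partial>M)"
  proof (rule nn_integral_kernel_extend[where Z = "X n"])
    fix E assume E: "E \<in> sets S"
    show "(\<integral>\<^sup>+\<omega>. ?F \<omega> * indicator E (X (Suc n) \<omega>) \<partial>M) = (\<integral>\<^sup>+\<omega>. ?F \<omega> * emeasure \<nu> E \<partial>M)"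
      unfolding transition[OF Fp E]
      by (intro nn_integral_cong) (auto simp: split_transition_def regen_def indicator_def)
  qed (use g in measurable)
  then show ?thesis by (simp add: nn_integral_multc)
qed

lemma delta_le_1: "\<delta> \<le> 1"
proof -
  have "L \<noteq> {}" using nu_L by auto
  then obtain y where y: "y \<in> L" by auto
  then have yS: "y \<in> space S" using sets.sets_into_space[OF L] by auto
  have "emeasure \<nu> (space S) = 1" using prob_space.emeasure_space_1[OF prob_nu] by (simp add: space_nu)
  then have "1 = emeasure (R y) (space S) + ennreal \<delta>"
    using decomposition[OF yS, of "space S"] prob_P[OF yS] y by simp
  moreover have "ennreal \<delta> \<le> emeasure (R y) (space S) + ennreal \<delta>" by simp
  ultimately have "ennreal \<delta> \<le> 1" by simp
  then show ?thesis by simp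
qed

lemma not_Y_prob: "(\<integral>\<^sup>+\<omega>. indicator {\<omega>. \<not> Y n \<omega>} \<omega> \<partial>M) = ennreal (1 - \<delta>)"
proof -
  have "(\<integral>\<^sup>+\<omega>. indicator {\<omega>. \<not> Y n \<omega>} \<omega> \<partial>M) = (\<integral>\<^sup>+y. indicator {False} y \<partial>distr M (count_space UNIV) (Y n))"
    by (subst nn_integral_distr) (auto intro!: nn_integral_cong simp: indicator_def)
  also have "distr M (count_space UNIV) (Y n) = measure_pmf (bernoulli_pmf \<delta>)"
    using chain by (simp add: split_chain_from_def)
  also have "(\<integral>\<^sup>+y. indicator {False} y \<partial>measure_pmf (bernoulli_pmf \<delta>)) = ennreal (1 - \<delta>)"
    using delta delta_le_1 by (simp add: emeasure_pmf_single)
  finally show ?thesis .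
qed

text \<open>On \<open>L\<close> the law given no regeneration carries a factor
  \<open>1 / (1 - \<delta>)\<close>. Averaging over \<open>Y n\<close>, which is independent of the
  history, cancels it. For this reason \<open>F\<close> must be measurable for
  \<open>history n\<close> and not merely for \<open>full_past n\<close>.\<close>

lemma survive:
  assumes F: "F \<in> borel_measurable (history n)" and g: "g \<in> borel_measurable S"
  shows "(\<integral>\<^sup>+\<omega>. F \<omega> * indicator {\<omega>. \<not> regen n \<omega>} \<omega> * g (X (Suc n) \<omega>) \<partial>M)
    = (\<integral>\<^sup>+\<omega>. F \<omega> * (\<integral>\<^sup>+y. g y \<partial>R (X n \<omega>)) \<partial>M)"
proof -
  let ?F = "\<lambda>\<omega>. F \<omega> * indicator {\<omega>. \<not> regen n \<omega>} \<omega>"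
  have Fp: "?F \<in> borel_measurable (full_past n)"
  proof -
    note [measurable] = measurable_X_past[OF order_refl, of n] measurable_Y_past[OF order_refl, of n]
      measurable_history_imp_past[OF F]
    show ?thesis unfolding regen_def by measurable
  qed
  note [measurable] = measurable_past_imp_M[OF Fp] measurable_history_imp_M[OF F]
  show ?thesis
  proof (rule nn_integral_kernel_extend)
    show "subkernel S R" by unfold_locales
    fix E assume E [measurable]: "E \<in> sets S"
    let ?r = "\<lambda>\<omega>. emeasure (R (X n \<omega>)) E"
    have [measurable]: "?r \<in> borel_measurable M"
      by (rule measurable_compose[OF X_measurable measurable_emeasure_kernel[OF R.kernel E]])
    let ?G = "\<lambda>\<omega>. F \<omega> * indicator L (X n \<omega>) * (?r \<omega> / ennreal (1 - \<delta>))"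
    have G: "?G \<in> borel_measurable (history n)"
    proof -
      note [measurable] = measurable_X_history[OF order_refl, of n] F
      have [measurable]: "?r \<in> borel_measurable (history n)"
        by (rule measurable_compose[OF measurable_X_history[OF order_refl] measurable_emeasure_kernel[OF R.kernel E]])
      show ?thesis by measurable
    qed
    note [measurable] = measurable_history_imp_M[OF G]
    have nS: "emeasure \<nu> (space S) = 1" using prob_space.emeasure_space_1[OF prob_nu] by (simp add: space_nu)
    have nE: "emeasure \<nu> E \<noteq> \<infinity>"
      using prob_space.emeasure_le_1[OF prob_nu, of E] by (auto simp: top_unique)
    have st: "?F \<omega> * split_transition P L \<delta> \<nu> (X n \<omega>, Y n \<omega>) E
        = F \<omega> * indicator (space S - L) (X n \<omega>) * ?r \<omega> + ?G \<omega> * indicator {\<omega>. \<not> Y n \<omega>} \<omega>"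
      if \<omega>: "\<omega> \<in> space M" for \<omega>
    proof -
      have "emeasure (P (X n \<omega>)) E = ?r \<omega> + ennreal \<delta> * indicator L (X n \<omega>) * emeasure \<nu> E"
        by (rule decomposition[OF X_space[OF \<omega>] E])
      then show ?thesis using X_space[OF \<omega>, of n] nE
        by (cases "X n \<omega> \<in> L"; cases "Y n \<omega>")
           (auto simp: split_transition_def regen_def ennreal_mult_eq_top_iff)
    qed
    have "(\<integral>\<^sup>+\<omega>. ?G \<omega> * indicator {\<omega>. \<not> Y n \<omega>} \<omega> \<partial>M) = (\<integral>\<^sup>+\<omega>. indicator {\<omega>. \<not> Y n \<omega>} \<omega> * ?G \<omega> \<partial>M)"
      by (simp add: mult_ac)
    also have "\<dots> = (\<integral>\<^sup>+\<omega>. indicator {\<omega>. \<not> Y n \<omega>} \<omega> \<partial>M) * (\<integral>\<^sup>+\<omega>. ?G \<omega> \<partial>M)"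
    proof (rule indep_elements_nn_integral[OF M.prob_space_axioms Y_indep])
      have [measurable]: "Y n \<in> vimage_algebra (space M) (Y n) (count_space UNIV) \<rightarrow>\<^sub>M count_space UNIV"
        by (intro measurable_vimage_algebra1) simp
      show "indicator {\<omega>. \<not> Y n \<omega>} \<in> borel_measurable (vimage_algebra (space M) (Y n) (count_space UNIV))"
        by measurable
    qed (use G in \<open>simp add: history_def\<close>)
    also have "\<dots> = (\<integral>\<^sup>+\<omega>. ennreal (1 - \<delta>) * ?G \<omega> \<partial>M)"
      unfolding not_Y_prob by (rule nn_integral_cmult[symmetric]) measurable
    also have "\<dots> = (\<integral>\<^sup>+\<omega>. F \<omega> * indicator L (X n \<omega>) * ?r \<omega> \<partial>M)"
    proof (intro nn_integral_cong)
      fix \<omega> assume \<omega>: "\<omega> \<in> space M"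
      show "ennreal (1 - \<delta>) * ?G \<omega> = F \<omega> * indicator L (X n \<omega>) * ?r \<omega>"
      proof (cases "\<delta> = 1 \<and> X n \<omega> \<in> L")
        \<comment> \<open>For \<open>\<delta> = 1\<close> nothing can be cancelled, but then
          \<open>R\<close> has mass 0 at this state and both sides vanish.\<close>
        case True
        have "1 = emeasure (R (X n \<omega>)) (space S) + 1"
          using decomposition[OF X_space[OF \<omega>, of n], of "space S"] prob_P[OF X_space[OF \<omega>, of n]] True nS by simp
        then have "emeasure (R (X n \<omega>)) (space S) = 0"
          by (cases "emeasure (R (X n \<omega>)) (space S)") (auto simp flip: ennreal_1 ennreal_plus)
        then have "?r \<omega> = 0"
          using E emeasure_mono[of E "space S" "R (X n \<omega>)"] sets.sets_into_space[OF E] X_space[OF \<omega>]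
          by (simp add: R.sets_kernel)
        then show ?thesis by simp
      next
        case False
        show ?thesis
        proof (cases "X n \<omega> \<in> L")
          case True
          then have "0 < 1 - \<delta>" using False delta_le_1 by auto
          then have "ennreal (1 - \<delta>) * (?r \<omega> / ennreal (1 - \<delta>)) = ?r \<omega>"
            by (simp add: ennreal_times_divide mult.commute[of "ennreal (1 - \<delta>)"] ennreal_mult_divide_eq)
          with True show ?thesis by (simp add: mult_ac)
        qed simp
      qed
    qed
    finally have 1: "(\<integral>\<^sup>+\<omega>. ?G \<omega> * indicator {\<omega>. \<not> Y n \<omega>} \<omega> \<partial>M) = (\<integral>\<^sup>+\<omega>. F \<omega> * indicator L (X n \<omega>) * ?r \<omega> \<partial>M)" .
    have "(\<integral>\<^sup>+\<omega>. ?F \<omega> * indicator E (X (Suc n) \<omega>) \<partial>M)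
        = (\<integral>\<^sup>+\<omega>. F \<omega> * indicator (space S - L) (X n \<omega>) * ?r \<omega> + ?G \<omega> * indicator {\<omega>. \<not> Y n \<omega>} \<omega> \<partial>M)"
      unfolding transition[OF Fp E] by (intro nn_integral_cong st)
    also have "\<dots> = (\<integral>\<^sup>+\<omega>. F \<omega> * indicator (space S - L) (X n \<omega>) * ?r \<omega> \<partial>M) + (\<integral>\<^sup>+\<omega>. F \<omega> * indicator L (X n \<omega>) * ?r \<omega> \<partial>M)"
      unfolding 1[symmetric] by (intro nn_integral_add) measurable
    also have "\<dots> = (\<integral>\<^sup>+\<omega>. F \<omega> * indicator (space S - L) (X n \<omega>) * ?r \<omega> + F \<omega> * indicator L (X n \<omega>) * ?r \<omega> \<partial>M)"
      by (intro nn_integral_add[symmetric]) measurable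
    also have "\<dots> = (\<integral>\<^sup>+\<omega>. F \<omega> * ?r \<omega> \<partial>M)"
      using X_space by (intro nn_integral_cong) (auto simp: indicator_def)
    finally show "(\<integral>\<^sup>+\<omega>. ?F \<omega> * indicator E (X (Suc n) \<omega>) \<partial>M) = (\<integral>\<^sup>+\<omega>. F \<omega> * ?r \<omega> \<partial>M)" .
  qed (use g in measurable)
qed

end

section \<open>Regeneration blocks\<close>

text \<open>If \<open>T\<close> is the sum on the right, each single term gives
  \<open>c k \<le> q ^ k * T powr (1 / \<alpha>)\<close> with
  \<open>q = exp (- \<epsilon> / \<alpha>)\<close>, and the geometric series is summed. The argument
  is the same for \<alpha> below and above 1.\<close>

lemma powr_sum_le_weighted_sum:
  fixes c :: "nat \<Rightarrow> real"
  assumes "0 < \<alpha>" "0 < \<epsilon>" and c: "\<And>k. 0 \<le> c k"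
  shows "(\<Sum>k<n. c k) powr \<alpha>
    \<le> (1 / (1 - exp (- \<epsilon> / \<alpha>))) powr \<alpha> * (\<Sum>k<n. exp (\<epsilon> * real k) * c k powr \<alpha>)"
proof -
  define T where "T = (\<Sum>k<n. exp (\<epsilon> * real k) * c k powr \<alpha>)"
  have T: "0 \<le> T" unfolding T_def by (intro sum_nonneg) simp
  define q where "q = exp (- \<epsilon> / \<alpha>)"
  have q: "0 < q" "q < 1" unfolding q_def using assms by auto
  have le: "c k \<le> q ^ k * T powr (1 / \<alpha>)" if "k < n" for k
  proof -
    have "exp (\<epsilon> * real k) * c k powr \<alpha> \<le> T"
      unfolding T_def using that
      by (intro member_le_sum[of k "{..<n}" "\<lambda>k. exp (\<epsilon> * real k) * c k powr \<alpha>"]) auto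
    then have "c k powr \<alpha> \<le> exp (- (\<epsilon> * real k)) * T" by (simp add: exp_minus field_simps)
    then have "(c k powr \<alpha>) powr (1 / \<alpha>) \<le> (exp (- (\<epsilon> * real k)) * T) powr (1 / \<alpha>)"
      using assms by (intro powr_mono2) auto
    also have "(c k powr \<alpha>) powr (1 / \<alpha>) = c k"
      using assms c[of k] by (simp add: powr_powr)
    also have "(exp (- (\<epsilon> * real k)) * T) powr (1 / \<alpha>) = q ^ k * T powr (1 / \<alpha>)"
      using T by (simp add: powr_mult q_def exp_of_nat_mult[symmetric] powr_def[of "exp _"] field_simps)
    finally show ?thesis .
  qed
  have "(\<Sum>k<n. q ^ k) \<le> 1 / (1 - q)"
    using q sum_le_suminf[of "\<lambda>k. q ^ k" "{..<n}"] by (simp add: suminf_geometric summable_geometric)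
  then have "(\<Sum>k<n. q ^ k) * T powr (1 / \<alpha>) \<le> 1 / (1 - q) * T powr (1 / \<alpha>)"
    by (intro mult_right_mono) auto
  moreover have "(\<Sum>k<n. c k) \<le> (\<Sum>k<n. q ^ k) * T powr (1 / \<alpha>)"
    unfolding sum_distrib_right using le by (intro sum_mono) auto
  ultimately have "(\<Sum>k<n. c k) \<le> 1 / (1 - q) * T powr (1 / \<alpha>)" by linarith
  then have "(\<Sum>k<n. c k) powr \<alpha> \<le> (1 / (1 - q) * T powr (1 / \<alpha>)) powr \<alpha>"
    using assms c by (intro powr_mono2 sum_nonneg) auto
  also have "\<dots> = (1 / (1 - q)) powr \<alpha> * T"
    using assms q T by (subst powr_mult) (auto simp: powr_powr)
  finally show ?thesis unfolding T_def q_def .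
qed

text \<open>The \<open>i\<close>-th block begins at \<open>s + 1\<close>, where \<open>s\<close> is the preceding regeneration time (or 0).\<close>

definition block_start :: "nat set \<Rightarrow> nat \<Rightarrow> nat \<Rightarrow> bool" where
  "block_start N i s = (case i of 0 \<Rightarrow> s = 0 | Suc j \<Rightarrow> s \<in> N \<and> card {n\<in>N. n < s} = j)"

lemma block_start_unique:
  assumes "block_start N i s" "block_start N i s'" shows "s = s'"
proof -
  have less: "card {n\<in>N. n < t} < card {n\<in>N. n < t'}" if "t \<in> N" "t < t'" for t t'
    using that by (intro psubset_card_mono) auto
  show ?thesis using assms less[of s s'] less[of s' s]
    by (cases s s' rule: linorder_cases) (auto simp: block_start_def split: nat.splits)
qed

lemma card_less_enumerate:
  fixes N :: "nat set" assumes N: "infinite N"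
  shows "card {n\<in>N. n < enumerate N j} = j"
proof -
  have "{n\<in>N. n < enumerate N j} = enumerate N ` {..<j}"
    using N enumerate_Ex[OF N] by (force simp: enumerate_in_set)
  then show ?thesis using inj_on_subset[OF inj_enumerate[OF N], of "{..<j}"] by (simp add: card_image)
qed

text \<open>Translates between \<open>enumerate\<close>, by which the cycles are defined, and the
  counting description \<open>block_start\<close>, which refers only to times up to
  \<open>s\<close>.\<close>

lemma block_start_exists:
  assumes N: "infinite N" "0 \<notin> N"
  shows "\<exists>s. block_start N i s \<and> (case i of 0 \<Rightarrow> 1 | Suc j \<Rightarrow> enumerate N j + 1) = s + 1 \<and>
    s < enumerate N i \<and> (\<forall>n. s < n \<longrightarrow> n < enumerate N i \<longrightarrow> n \<notin> N)"
proof (cases i)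
  case 0
  have "enumerate N 0 \<in> N" using N by (simp add: enumerate_in_set)
  then have "0 < enumerate N 0" using N by (cases "enumerate N 0") auto
  then show ?thesis using 0 by (auto simp: block_start_def enumerate_0 dest: not_less_Least)
next
  case (Suc j)
  have "n \<notin> N" if "enumerate N j < n" "n < enumerate N (Suc j)" for n
    using that not_less_Least[of n "\<lambda>s. s \<in> N \<and> enumerate N j < s"] unfolding enumerate_Suc''[OF N(1)] by auto
  then show ?thesis using Suc N
    by (auto simp: block_start_def card_less_enumerate enumerate_in_set)
qed

text \<open>One majorant for the block sum and all its initial segments serves
  \<open>cycle_B\<close> and \<open>cycle_M\<close> alike.\<close>

lemma abs_perpetuity_sum_le:
  assumes "\<And>j. 0 \<le> A j" "t \<le> t'"
  shows "\<bar>perpetuity_sum A B s t\<bar> \<le> (\<Sum>k\<in>{s..<t'}. (\<Prod>j\<in>{s..<k}. A j) * \<bar>B k\<bar>)"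
proof -
  have "\<bar>perpetuity_sum A B s t\<bar> \<le> (\<Sum>k\<in>{s..<t}. (\<Prod>j\<in>{s..<k}. A j) * \<bar>B k\<bar>)"
    unfolding perpetuity_sum_def using assms(1)
    by (intro order_trans[OF sum_abs] sum_mono) (simp add: abs_mult prod_nonneg)
  also have "\<dots> \<le> (\<Sum>k\<in>{s..<t'}. (\<Prod>j\<in>{s..<k}. A j) * \<bar>B k\<bar>)"
    using assms by (intro sum_mono2) (auto intro!: mult_nonneg_nonneg prod_nonneg)
  finally show ?thesis .
qed

lemma abs_cSUP_le:
  fixes p :: "nat \<Rightarrow> real"
  assumes "finite I" "I \<noteq> {}" "\<And>j. j \<in> I \<Longrightarrow> \<bar>p j\<bar> \<le> K"
  shows "\<bar>SUP j\<in>I. p j\<bar> \<le> K"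
proof -
  have "(SUP j\<in>I. p j) = Max (p ` I)" using assms by (intro cSup_eq_Max) auto
  also have "\<dots> \<in> p ` I" using assms by (intro Max_in) auto
  finally show ?thesis using assms by auto
qed

section \<open>Starts of blocks and weights collected within a block\<close>

context split_chain
begin

lemma measurable_regen:
  assumes [measurable]: "X n \<in> A \<rightarrow>\<^sub>M S" "Y n \<in> A \<rightarrow>\<^sub>M count_space UNIV"
  shows "Measurable.pred A (regen n)"
  unfolding regen_def[abs_def] by measurable

definition regen_times :: "'v \<Rightarrow> nat set" where
  "regen_times \<omega> = {n. 1 \<le> n \<and> regen n \<omega>}"

definition starts :: "nat \<Rightarrow> nat \<Rightarrow> 'v \<Rightarrow> ennreal" where
  "starts i s \<omega> = of_bool (block_start (regen_times \<omega>) i s)"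

lemma starts_0: "starts 0 s \<omega> = of_bool (s = 0)"
  by (simp add: starts_def block_start_def)

text \<open>The count involves only times below \<open>s\<close>, and the regeneration at
  \<open>s\<close> is split off as a factor, which is the form that \<open>regenerate\<close>
  needs.\<close>

lemma starts_Suc:
  "starts (Suc j) s \<omega>
    = of_bool (1 \<le> s \<and> (\<Sum>n\<in>{1..<s}. of_bool (regen n \<omega>) :: real) = real j) * indicator {\<omega>. regen s \<omega>} \<omega>"
proof -
  have "{n\<in>regen_times \<omega>. n < s} = {n\<in>{1..<s}. regen n \<omega>}" by (auto simp: regen_times_def)
  then have "real (card {n\<in>regen_times \<omega>. n < s}) = (\<Sum>n\<in>{1..<s}. of_bool (regen n \<omega>))"
    by (simp add: of_bool_def sum.If_cases Int_def)
  then show ?thesis by (auto simp: starts_def block_start_def regen_times_def indicator_def)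
qed

lemma starts_measurable:
  assumes "\<And>n. n \<le> s \<Longrightarrow> X n \<in> A \<rightarrow>\<^sub>M S" "\<And>n. n \<le> s \<Longrightarrow> Y n \<in> A \<rightarrow>\<^sub>M count_space UNIV"
  shows "starts i s \<in> borel_measurable A"
proof (cases i)
  case 0 then show ?thesis by (simp add: starts_0[abs_def])
next
  case (Suc j)
  have r: "Measurable.pred A (regen n)" if "n \<le> s" for n
    using assms that by (intro measurable_regen) auto
  have [measurable]: "(\<lambda>\<omega>. \<Sum>n\<in>{1..<s}. of_bool (regen n \<omega>) :: real) \<in> borel_measurable A"
    using measurable_compose[OF r, of _ "of_bool :: bool \<Rightarrow> real" borel] by (intro borel_measurable_sum) auto
  note [measurable] = r[OF order_refl]
  show ?thesis unfolding Suc starts_Suc[abs_def] by measurable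
qed

lemma starts_measurable_M [measurable]: "starts i s \<in> borel_measurable M"
  by (rule starts_measurable) measurable

lemma suminf_starts_le: "(\<Sum>s. starts i s \<omega>) \<le> 1"
proof (rule suminf_le_const)
  fix n
  show "(\<Sum>s<n. starts i s \<omega>) \<le> 1"
  proof (cases "\<exists>s<n. block_start (regen_times \<omega>) i s")
    case True
    then obtain s where s: "s < n" "block_start (regen_times \<omega>) i s" by blast
    have eq: "starts i s' \<omega> = (if s' = s then 1 else 0)" for s'
    proof (cases "s' = s")
      case False
      then have "\<not> block_start (regen_times \<omega>) i s'" using block_start_unique[OF s(2)] by blast
      then show ?thesis using False by (simp add: starts_def)
    qed (use s(2) in \<open>simp add: starts_def\<close>)
    show ?thesis unfolding eq by (simp add: sum.delta)
  qed (simp add: starts_def)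
qed simp

text \<open>Iterates \<open>survive\<close>. \<open>F\<close> may involve \<open>X m\<close> but not
  \<open>Y m\<close>, because the first survival factor is the one at time \<open>m\<close>.\<close>

lemma run:
  assumes F: "F \<in> borel_measurable (history m)" and [measurable]: "w \<in> borel_measurable S"
    and g: "g \<in> borel_measurable S"
  shows "(\<integral>\<^sup>+\<omega>. F \<omega> * (\<Prod>j<k. indicator {\<omega>. \<not> regen (m + j) \<omega>} \<omega> * w (X (m + j + 1) \<omega>)) * g (X (m + k) \<omega>) \<partial>M)
    = (\<integral>\<^sup>+\<omega>. F \<omega> * (kop R w ^^ k) g (X m \<omega>) \<partial>M)"
  using g
proof (induction k arbitrary: g)
  case (Suc k)
  note [measurable] = Suc.prems
  let ?F = "\<lambda>\<omega>. F \<omega> * (\<Prod>j<k. indicator {\<omega>. \<not> regen (m + j) \<omega>} \<omega> * w (X (m + j + 1) \<omega>))"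
  have hist: "F \<in> borel_measurable (history (m + k))"
  proof -
    have "(\<lambda>\<omega>. \<omega>) \<in> history (m + k) \<rightarrow>\<^sub>M history m"
      unfolding history_def[of m]
    proof (rule measurable_vimage_algebra2)
      show "(\<lambda>\<omega>. (\<lambda>i\<in>{..m}. X i \<omega>, \<lambda>i\<in>{..<m}. Y i \<omega>)) \<in> history (m + k) \<rightarrow>\<^sub>M
          (Pi\<^sub>M {..m} (\<lambda>_. S) \<Otimes>\<^sub>M Pi\<^sub>M {..<m} (\<lambda>_. count_space UNIV))"
        by (intro measurable_Pair measurable_restrict measurable_X_history measurable_Y_history) auto
    qed simp
    from measurable_compose[OF this F] show ?thesis .
  qed
  have "?F \<in> borel_measurable (history (m + k))"
  proof (intro borel_measurable_times_ennreal hist borel_measurable_prod_ennreal)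
    fix j assume j: "j \<in> {..<k}"
    have [measurable]: "X (m + j + 1) \<in> history (m + k) \<rightarrow>\<^sub>M S"
      using j by (intro measurable_X_history) auto
    have [measurable]: "Measurable.pred (history (m + k)) (regen (m + j))"
      using j by (intro measurable_regen measurable_X_history measurable_Y_history) auto
    show "(\<lambda>\<omega>. indicator {\<omega>. \<not> regen (m + j) \<omega>} \<omega>) \<in> borel_measurable (history (m + k))" by measurable
    show "(\<lambda>\<omega>. w (X (m + j + 1) \<omega>)) \<in> borel_measurable (history (m + k))" by measurable
  qed
  from survive[OF this, of "\<lambda>y. w y * g y"]
  have "(\<integral>\<^sup>+\<omega>. ?F \<omega> * indicator {\<omega>. \<not> regen (m + k) \<omega>} \<omega> * (w (X (Suc (m + k)) \<omega>) * g (X (Suc (m + k)) \<omega>)) \<partial>M)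
      = (\<integral>\<^sup>+\<omega>. ?F \<omega> * kop R w g (X (m + k) \<omega>) \<partial>M)"
    unfolding kop_def by simp
  also have "\<dots> = (\<integral>\<^sup>+\<omega>. F \<omega> * (kop R w ^^ k) (kop R w g) (X m \<omega>) \<partial>M)"
    by (rule Suc.IH) measurable
  finally show ?case by (simp add: funpow_swap1 mult_ac)
qed simp

text \<open>The first step mixes \<nu> and \<open>R x\<close>, with an unknown weight
  \<open>p\<close> on \<nu>. Testing with the constant 1 identifies \<open>p\<close> as \<delta> on
  \<open>L\<close> and 0 elsewhere, and the mixture is then \<open>P x\<close>.\<close>

lemma initial_step:
  assumes [measurable]: "g \<in> borel_measurable S"
  shows "(\<integral>\<^sup>+\<omega>. g (X 1 \<omega>) \<partial>M) = (\<integral>\<^sup>+y. g y \<partial>P x)"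
proof -
  define p where "p = (\<integral>\<^sup>+\<omega>. indicator {\<omega>. regen 0 \<omega>} \<omega> \<partial>M)"
  have X0: "distr M S (X 0) = return S x" using chain by (simp add: split_chain_from_def)
  have eq: "(\<integral>\<^sup>+\<omega>. g (X 1 \<omega>) \<partial>M) = p * (\<integral>\<^sup>+y. g y \<partial>\<nu>) + (\<integral>\<^sup>+y. g y \<partial>R x)"
    if [measurable]: "g \<in> borel_measurable S" for g
  proof -
    have "(\<integral>\<^sup>+\<omega>. g (X 1 \<omega>) \<partial>M) = (\<integral>\<^sup>+\<omega>. 1 * indicator {\<omega>. regen 0 \<omega>} \<omega> * g (X (Suc 0) \<omega>)
        + 1 * indicator {\<omega>. \<not> regen 0 \<omega>} \<omega> * g (X (Suc 0) \<omega>) \<partial>M)"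
      by (intro nn_integral_cong) (auto simp: indicator_def)
    also have "\<dots> = (\<integral>\<^sup>+\<omega>. 1 * indicator {\<omega>. regen 0 \<omega>} \<omega> * g (X (Suc 0) \<omega>) \<partial>M)
        + (\<integral>\<^sup>+\<omega>. 1 * indicator {\<omega>. \<not> regen 0 \<omega>} \<omega> * g (X (Suc 0) \<omega>) \<partial>M)"
      by (intro nn_integral_add) measurable
    also have "\<dots> = p * (\<integral>\<^sup>+y. g y \<partial>\<nu>) + (\<integral>\<^sup>+\<omega>. 1 * (\<integral>\<^sup>+y. g y \<partial>R (X 0 \<omega>)) \<partial>M)"
      unfolding p_def by (subst regenerate, simp, simp, subst survive) simp_all
    also have "(\<integral>\<^sup>+\<omega>. 1 * (\<integral>\<^sup>+y. g y \<partial>R (X 0 \<omega>)) \<partial>M) = (\<integral>\<^sup>+y. g y \<partial>R x)"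
      using nn_integral_initial_state[OF X_measurable X0 x, of "\<lambda>z. \<integral>\<^sup>+y. g y \<partial>R z"]
        measurable_compose[OF R.kernel nn_integral_measurable_subprob_algebra[OF that]] by simp
    finally show ?thesis .
  qed
  have nS: "emeasure \<nu> (space \<nu>) = 1" by (rule prob_space.emeasure_space_1[OF prob_nu])
  have "p + emeasure (R x) (space S) = 1"
    using eq[of "\<lambda>_. 1"] nS by (simp add: R.space_kernel[OF x] M.emeasure_space_1)
  moreover have "ennreal \<delta> * indicator L x + emeasure (R x) (space S) = 1"
    using decomposition[OF x, of "space S"] prob_P[OF x] nS by (simp add: space_nu add.commute)
  ultimately have "p = ennreal \<delta> * indicator L x"
    using R.emeasure_kernel_le_1[OF x, of "space S"]
    by (metis add.commute ennreal_add_left_cancel ennreal_one_less_top leD infinity_ennreal_def)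
  then show ?thesis using eq[of g] nn_integral_decomposition[OF x, of g] by (simp add: add.commute)
qed

text \<open>There are \<open>k + 1\<close> weights but \<open>k\<close> survival factors: the
  position \<open>s + 1 + k\<close> belongs to the block whether or not the chain regenerates
  there.\<close>

definition path_weight :: "('s \<Rightarrow> ennreal) \<Rightarrow> nat \<Rightarrow> nat \<Rightarrow> nat \<Rightarrow> 'v \<Rightarrow> ennreal" where
  "path_weight w i s k \<omega> = starts i s \<omega> * w (X (s + 1) \<omega>) *
     (\<Prod>j<k. indicator {\<omega>. \<not> regen (s + 1 + j) \<omega>} \<omega> * w (X (s + 1 + j + 1) \<omega>))"

lemma path_weight_measurable:
  assumes [measurable]: "w \<in> borel_measurable S"
    and XY: "\<And>n. X n \<in> A \<rightarrow>\<^sub>M S" "\<And>n. Y n \<in> A \<rightarrow>\<^sub>M count_space UNIV"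
  shows "path_weight w i s k \<in> borel_measurable A"
proof -
  note [measurable] = XY starts_measurable[OF XY] measurable_regen[OF XY]
  show ?thesis unfolding path_weight_def[abs_def] by measurable
qed

text \<open>Law of the first state of a block. Block 0 begins at time 1, one step after the initial
  state; every later block begins right after a regeneration.\<close>

fun entrance :: "nat \<Rightarrow> ('s \<Rightarrow> ennreal) \<Rightarrow> ennreal" where
  "entrance 0 g = (\<integral>\<^sup>+y. g y \<partial>P x)"
| "entrance (Suc j) g = (\<integral>\<^sup>+y. g y \<partial>\<nu>)"

text \<open>Regeneration decouples the event that the block starts from the state that is entered.
  The possible starts of one block are disjoint events, so their probabilities add up to at most
  1.\<close>

lemma suminf_starts_entrance:
  assumes [measurable]: "g \<in> borel_measurable S"
  shows "(\<Sum>s. \<integral>\<^sup>+\<omega>. starts i s \<omega> * g (X (s + 1) \<omega>) \<partial>M) \<le> entrance i g"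
proof (cases i)
  case 0
  have "(\<integral>\<^sup>+\<omega>. starts i s \<omega> * g (X (s + 1) \<omega>) \<partial>M) = (if s = 0 then (\<integral>\<^sup>+y. g y \<partial>P x) else 0)" for s
    using initial_step[of g] by (simp add: 0 starts_0)
  then show ?thesis using 0 suminf_finite[of "{0}" "\<lambda>s. if s = 0 then (\<integral>\<^sup>+y. g y \<partial>P x) else 0"] by simp
next
  case (Suc j)
  have eq: "(\<integral>\<^sup>+\<omega>. starts (Suc j) s \<omega> * g (X (s + 1) \<omega>) \<partial>M) = (\<integral>\<^sup>+\<omega>. starts (Suc j) s \<omega> \<partial>M) * (\<integral>\<^sup>+y. g y \<partial>\<nu>)" for s
  proof -
    let ?F = "\<lambda>\<omega>. of_bool (1 \<le> s \<and> (\<Sum>n\<in>{1..<s}. of_bool (regen n \<omega>) :: real) = real j) :: ennreal"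
    have r: "Measurable.pred (full_past s) (regen n)" if "n \<le> s" for n
      using that by (intro measurable_regen measurable_X_past measurable_Y_past)
    have [measurable]: "(\<lambda>\<omega>. \<Sum>n\<in>{1..<s}. of_bool (regen n \<omega>) :: real) \<in> borel_measurable (full_past s)"
      using measurable_compose[OF r, of _ "of_bool :: bool \<Rightarrow> real" borel] by (intro borel_measurable_sum) auto
    have "?F \<in> borel_measurable (full_past s)" by measurable
    from regenerate[OF this assms] show ?thesis unfolding starts_Suc by simp
  qed
  have "(\<Sum>s. \<integral>\<^sup>+\<omega>. starts (Suc j) s \<omega> * g (X (s + 1) \<omega>) \<partial>M) = (\<Sum>s. \<integral>\<^sup>+\<omega>. starts (Suc j) s \<omega> \<partial>M) * (\<integral>\<^sup>+y. g y \<partial>\<nu>)"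
    unfolding eq by (rule ennreal_suminf_multc)
  also have "(\<Sum>s. \<integral>\<^sup>+\<omega>. starts (Suc j) s \<omega> \<partial>M) = (\<integral>\<^sup>+\<omega>. (\<Sum>s. starts (Suc j) s \<omega>) \<partial>M)"
    by (rule nn_integral_suminf[symmetric]) measurable
  also have "\<dots> \<le> (\<integral>\<^sup>+\<omega>. 1 \<partial>M)" by (intro nn_integral_mono suminf_starts_le)
  also have "\<dots> = 1" by (simp add: M.emeasure_space_1)
  finally show ?thesis using Suc by (simp add: mult_right_mono)
qed

lemma suminf_path_weight:
  assumes [measurable]: "w \<in> borel_measurable S"
  shows "(\<Sum>s. \<integral>\<^sup>+\<omega>. path_weight w i s k \<omega> \<partial>M) \<le> entrance i (\<lambda>y. w y * (kop R w ^^ k) (\<lambda>_. 1) y)"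
proof -
  have "(\<integral>\<^sup>+\<omega>. path_weight w i s k \<omega> \<partial>M) = (\<integral>\<^sup>+\<omega>. starts i s \<omega> * (\<lambda>y. w y * (kop R w ^^ k) (\<lambda>_. 1) y) (X (s + 1) \<omega>) \<partial>M)" for s
  proof -
    have [measurable]: "starts i s \<in> borel_measurable (history (s + 1))" "X (s + 1) \<in> history (s + 1) \<rightarrow>\<^sub>M S"
      by (intro starts_measurable measurable_X_history measurable_Y_history; simp)+
    have "(\<lambda>\<omega>. starts i s \<omega> * w (X (s + 1) \<omega>)) \<in> borel_measurable (history (s + 1))" by measurable
    from run[OF this, of w "\<lambda>_. 1" k] show ?thesis by (simp add: path_weight_def mult_ac)
  qed
  then show ?thesis using suminf_starts_entrance[of "\<lambda>y. w y * (kop R w ^^ k) (\<lambda>_. 1) y" i] by simp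
qed

text \<open>After any time \<open>m\<close> another regeneration occurs almost surely, because the
  mass surviving \<open>k\<close> further steps tends to 0. This makes \<open>enumerate\<close>, and
  with it \<open>cycle_start\<close>, meaningful.\<close>

lemma AE_infinite_regen_times:
  assumes hit: "\<And>x. x \<in> space S \<Longrightarrow> (\<lambda>n. (kop P (indicator (space S - L)) ^^ n) (\<lambda>_. 1) x) \<longlonglongrightarrow> 0"
  shows "AE \<omega> in M. infinite (regen_times \<omega>)"
proof -
  let ?q = "\<lambda>k. (kop R (\<lambda>_. 1) ^^ k) (\<lambda>_. 1)"
  have "AE \<omega> in M. \<exists>j. regen (m + j) \<omega>" for m
  proof -
    let ?Z = "\<lambda>\<omega>. \<forall>j. \<not> regen (m + j) \<omega>"
    have le: "(\<integral>\<^sup>+\<omega>. indicator {\<omega>. ?Z \<omega>} \<omega> \<partial>M) \<le> (\<integral>\<^sup>+\<omega>. ?q k (X m \<omega>) \<partial>M)" for k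
    proof -
      have "(\<integral>\<^sup>+\<omega>. indicator {\<omega>. ?Z \<omega>} \<omega> \<partial>M)
          \<le> (\<integral>\<^sup>+\<omega>. 1 * (\<Prod>j<k. indicator {\<omega>. \<not> regen (m + j) \<omega>} \<omega> * 1) * 1 \<partial>M)"
      proof (intro nn_integral_mono)
        fix \<omega>
        show "indicator {\<omega>. ?Z \<omega>} \<omega> \<le> 1 * (\<Prod>j<k. indicator {\<omega>. \<not> regen (m + j) \<omega>} \<omega> * 1) * (1::ennreal)"
          by (cases "?Z \<omega>") (simp_all add: indicator_def)
      qed
      also have "\<dots> = (\<integral>\<^sup>+\<omega>. 1 * ?q k (X m \<omega>) \<partial>M)"
        by (rule run) measurable
      finally show ?thesis by simp
    qed
    have "(\<integral>\<^sup>+\<omega>. indicator {\<omega>. ?Z \<omega>} \<omega> \<partial>M) \<le> (INF k. \<integral>\<^sup>+\<omega>. ?q k (X m \<omega>) \<partial>M)"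
      by (intro INF_greatest le)
    also have "\<dots> = (\<integral>\<^sup>+\<omega>. (INF k. ?q k (X m \<omega>)) \<partial>M)"
    proof (rule nn_integral_monotone_convergence_INF_AE[symmetric])
      show "AE \<omega> in M. ?q (Suc k) (X m \<omega>) \<le> ?q k (X m \<omega>)" for k
        by (intro AE_I2 R.kop_mass_decreasing X_space)
      show "(\<integral>\<^sup>+\<omega>. ?q 0 (X m \<omega>) \<partial>M) < \<infinity>" by (simp add: M.emeasure_space_1)
    qed measurable
    also have "\<dots> = (\<integral>\<^sup>+\<omega>. 0 \<partial>M)"
      by (intro nn_integral_cong no_regeneration_mass prob_P hit X_space)
    finally have "(\<integral>\<^sup>+\<omega>. indicator {\<omega>. ?Z \<omega>} \<omega> \<partial>M) = 0" by simp
    then have "AE \<omega> in M. indicator {\<omega>. ?Z \<omega>} \<omega> = (0::ennreal)"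
      by (subst (asm) nn_integral_0_iff_AE) auto
    then show ?thesis by eventually_elim (auto simp: indicator_def split: if_splits)
  qed
  then have "AE \<omega> in M. \<forall>m. \<exists>j. regen (m + j) \<omega>" by (simp add: AE_all_countable)
  then show ?thesis
  proof eventually_elim
    case (elim \<omega>)
    show ?case unfolding infinite_nat_iff_unbounded
    proof
      fix m
      obtain j where "regen (Suc m + j) \<omega>" using elim by blast
      then show "\<exists>n>m. n \<in> regen_times \<omega>" by (intro exI[of _ "Suc m + j"]) (simp add: regen_times_def)
    qed
  qed
qed

end

section \<open>Moments of the cycle variables\<close>

lemma prod_atLeastLessThan_shift: "(\<Prod>j\<in>{a..<a + k}. g j) = (\<Prod>j<k. g (a + j :: nat))"
  by (induction k) simp_all

lemma sum_atLeastLessThan_shift: "(\<Sum>j\<in>{a..<a + k}. g j) = (\<Sum>j<k. g (a + j :: nat))"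
  by (induction k) simp_all

lemma prod_exp_powr: "(\<Prod>j<k::nat. exp (g j)) powr \<alpha> = (\<Prod>j<k. exp (\<alpha> * g j :: real))"
  by (induction k) (simp_all add: powr_mult prod_nonneg powr_def[of "exp _"])

context split_chain
begin

lemma entrance_suminf:
  assumes [measurable]: "\<And>k. g k \<in> borel_measurable S"
  shows "(\<Sum>k. entrance i (g k)) = entrance i (\<lambda>y. \<Sum>k. g k y)"
proof (cases i)
  case 0
  then show ?thesis by (simp add: nn_integral_suminf measurable_kernel[OF x])
next
  case (Suc j)
  then show ?thesis by (simp add: nn_integral_suminf)
qed

lemma entrance_cmult:
  assumes [measurable]: "g \<in> borel_measurable S"
  shows "c * entrance i g = entrance i (\<lambda>y. c * g y)"
  by (cases i) (simp_all add: nn_integral_cmult measurable_kernel[OF x])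

lemma B_moment:
  assumes n: "1 \<le> n"
  shows "B n \<in> borel_measurable M" "(\<integral>\<^sup>+\<omega>. ennreal (\<bar>B n \<omega>\<bar> powr \<alpha>) \<partial>M) = (\<integral>\<^sup>+b. ennreal (\<bar>b\<bar> powr \<alpha>) \<partial>\<mu>B)"
proof -
  have "M.indep_vars (\<lambda>_. borel) B {1..}" and d: "distr M borel (B n) = \<mu>B"
    using chain n by (auto simp: split_chain_from_def)
  then show [measurable]: "B n \<in> borel_measurable M" using n by (auto simp: M.indep_vars_def)
  show "(\<integral>\<^sup>+\<omega>. ennreal (\<bar>B n \<omega>\<bar> powr \<alpha>) \<partial>M) = (\<integral>\<^sup>+b. ennreal (\<bar>b\<bar> powr \<alpha>) \<partial>\<mu>B)"
    unfolding d[symmetric] by (subst nn_integral_distr) auto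
qed

text \<open>Measurability of \<open>F\<close> for every sigma-algebra that makes all
  \<open>X n\<close> and \<open>Y n\<close> measurable expresses that \<open>F\<close> is a
  functional of the process, without writing it as a composition.\<close>

lemma B_indep:
  assumes F: "\<And>A. (\<And>n. X n \<in> A \<rightarrow>\<^sub>M S) \<Longrightarrow> (\<And>n. Y n \<in> A \<rightarrow>\<^sub>M count_space UNIV) \<Longrightarrow> F \<in> borel_measurable A"
    and n: "1 \<le> n"
  shows "(\<integral>\<^sup>+\<omega>. F \<omega> * ennreal (\<bar>B n \<omega>\<bar> powr \<alpha>) \<partial>M)
    = (\<integral>\<^sup>+\<omega>. F \<omega> \<partial>M) * (\<integral>\<^sup>+b. ennreal (\<bar>b\<bar> powr \<alpha>) \<partial>\<mu>B)"
proof -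
  let ?XY = "\<lambda>\<omega> n. (X n \<omega>, Y n \<omega>)" and ?N = "Pi\<^sub>M UNIV (\<lambda>_. S \<Otimes>\<^sub>M count_space UNIV)"
  let ?B = "\<lambda>\<omega>. \<lambda>n\<in>{1..}. B n \<omega>" and ?K = "Pi\<^sub>M {1..} (\<lambda>_. borel :: real measure)"
  have ind: "indep_elements M ?N ?XY ?K ?B" using chain by (simp add: split_chain_from_def)
  have XY: "?XY \<in> vimage_algebra (space M) ?XY ?N \<rightarrow>\<^sub>M ?N"
    by (intro measurable_vimage_algebra1) (auto simp: space_PiM space_pair_measure X_space)
  have XYn: "(\<lambda>\<omega>. (X n \<omega>, Y n \<omega>)) \<in> vimage_algebra (space M) ?XY ?N \<rightarrow>\<^sub>M S \<Otimes>\<^sub>M count_space UNIV" for n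
    using measurable_compose[OF XY measurable_component_singleton[of n UNIV "\<lambda>_. S \<Otimes>\<^sub>M count_space UNIV"]] by simp
  have Fm: "F \<in> borel_measurable (vimage_algebra (space M) ?XY ?N)"
    using measurable_compose[OF XYn measurable_fst] measurable_compose[OF XYn measurable_snd] by (intro F) simp_all
  have "?B \<in> vimage_algebra (space M) ?B ?K \<rightarrow>\<^sub>M ?K"
    by (intro measurable_vimage_algebra1) (auto simp: space_PiM)
  from measurable_compose[OF this measurable_component_singleton[of n "{1..}" "\<lambda>_. borel :: real measure"]]
  have [measurable]: "B n \<in> borel_measurable (vimage_algebra (space M) ?B ?K)" using n by simp
  show ?thesis unfolding B_moment(2)[OF n, symmetric]
    by (rule indep_elements_nn_integral[OF M.prob_space_axioms ind Fm]) measurable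
qed

text \<open>Random block boundaries are avoided by summing over all starts \<open>s\<close> and all
  positions \<open>k\<close>: the contributions of the actual block are among the nonnegative
  summands of \<open>ZA\<close> and \<open>ZB\<close>, whose expectations are computed at
  deterministic times.\<close>

theorem cycle_moments:
  fixes f :: "'s \<Rightarrow> real"
  defines "U \<equiv> \<lambda>\<alpha> \<epsilon> y. \<Sum>n. (kop R (expw (\<lambda>y. \<alpha> * f y + \<epsilon>)) ^^ n) (\<lambda>_. 1) y"
  assumes f [measurable]: "f \<in> borel_measurable S" and \<alpha>: "0 < \<alpha>" and \<epsilon>: "0 < \<epsilon>"
    and bound: "entrance i (\<lambda>y. expw (\<lambda>y. \<alpha> * f y) y * U \<alpha> \<epsilon> y) < \<infinity>"
    and B_fin: "(\<integral>\<^sup>+b. ennreal (\<bar>b\<bar> powr \<alpha>) \<partial>\<mu>B) < \<infinity>"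
    and hit: "\<And>x. x \<in> space S \<Longrightarrow> (\<lambda>n. (kop P (indicator (space S - L)) ^^ n) (\<lambda>_. 1) x) \<longlonglongrightarrow> 0"
  shows "finite_moment \<alpha> M (cycle_A f L X Y i) \<and> finite_moment \<alpha> M (cycle_B f L X Y B i) \<and>
    finite_moment \<alpha> M (cycle_M f L X Y B i)"
proof -
  define w where "w = expw (\<lambda>y. \<alpha> * f y)"
  have [measurable]: "w \<in> borel_measurable S" unfolding w_def by measurable
  define q where "q = ennreal (exp \<epsilon>)"
  have q: "1 \<le> q" using \<epsilon> unfolding q_def by (simp add: ennreal_ge_1)
  define \<beta> where "\<beta> = (\<integral>\<^sup>+b. ennreal (\<bar>b\<bar> powr \<alpha>) \<partial>\<mu>B)"
  \<comment> \<open>The entry of \<open>B\<close> at place \<open>k\<close> of a block is multiplied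
    by the \<open>k\<close> weights before it; hence the shift by one against
    \<open>path_weight\<close>, and no weight at place 0.\<close>
  define pre where "pre s k \<omega> = (case k of 0 \<Rightarrow> starts i s \<omega> | Suc k' \<Rightarrow> path_weight w i s k' \<omega>)" for s k \<omega>
  define b where "b n \<omega> = ennreal (\<bar>B n \<omega>\<bar> powr \<alpha>)" for n \<omega>
  define ZA where "ZA \<omega> = (\<Sum>k. q ^ k * (\<Sum>s. path_weight w i s k \<omega>))" for \<omega>
  define ZB where "ZB \<omega> = (\<Sum>k. q ^ k * (\<Sum>s. pre s k \<omega> * b (s + k + 1) \<omega>))" for \<omega>
  have pw [measurable]: "path_weight w i s k \<in> borel_measurable M" for s k
    by (rule path_weight_measurable) measurable
  have pre_meas: "pre s k \<in> borel_measurable A"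
    if "\<And>n. X n \<in> A \<rightarrow>\<^sub>M S" "\<And>n. Y n \<in> A \<rightarrow>\<^sub>M count_space UNIV" for s k A
    using that unfolding pre_def[abs_def]
    by (cases k) (auto intro: path_weight_measurable starts_measurable)
  have [measurable]: "pre s k \<in> borel_measurable M" for s k by (rule pre_meas) measurable
  have [measurable]: "b (Suc n) \<in> borel_measurable M" for n
    using B_moment(1)[of "Suc n"] unfolding b_def[abs_def] by measurable
  have int_ZA: "(\<integral>\<^sup>+\<omega>. ZA \<omega> \<partial>M) = (\<Sum>k. q ^ k * (\<Sum>s. \<integral>\<^sup>+\<omega>. path_weight w i s k \<omega> \<partial>M))"
    unfolding ZA_def by (simp add: nn_integral_suminf nn_integral_cmult)
  have ZA_le: "(\<Sum>k. q ^ k * (\<Sum>s. \<integral>\<^sup>+\<omega>. path_weight w i s k \<omega> \<partial>M)) \<le> entrance i (\<lambda>y. w y * U \<alpha> \<epsilon> y)"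
  proof -
    have "(\<Sum>k. q ^ k * (\<Sum>s. \<integral>\<^sup>+\<omega>. path_weight w i s k \<omega> \<partial>M))
        \<le> (\<Sum>k. q ^ k * entrance i (\<lambda>y. w y * (kop R w ^^ k) (\<lambda>_. 1) y))"
      by (intro suminf_le mult_left_mono suminf_path_weight) auto
    also have "\<dots> = entrance i (\<lambda>y. \<Sum>k. q ^ k * (w y * (kop R w ^^ k) (\<lambda>_. 1) y))"
      by (subst entrance_suminf[symmetric]) (simp_all add: entrance_cmult)
    also have "\<dots> = entrance i (\<lambda>y. w y * U \<alpha> \<epsilon> y)"
    proof -
      have eq: "(\<Sum>k. q ^ k * (w y * (kop R w ^^ k) (\<lambda>_. 1) y)) = w y * U \<alpha> \<epsilon> y" if y: "y \<in> space S" for y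
      proof -
        have "expw (\<lambda>y. \<alpha> * f y + \<epsilon>) = (\<lambda>y. q * w y)"
          unfolding w_def q_def expw_def by (auto simp: exp_add ennreal_mult mult.commute)
        then show ?thesis unfolding U_def ennreal_suminf_cmult[symmetric]
          using R.kop_funpow_scale[where q = q and w = w and g = "\<lambda>_. 1" and x = y] y by (intro suminf_cong) (simp add: mult_ac)
      qed
      then show ?thesis
        by (cases i) (auto intro!: nn_integral_cong simp: space_kernel[OF x] space_nu)
    qed
    finally show ?thesis .
  qed
  have ZA_fin: "(\<integral>\<^sup>+\<omega>. ZA \<omega> \<partial>M) < \<infinity>"
    unfolding int_ZA using ZA_le bound unfolding w_def by (rule order_le_less_trans)
  have "(\<integral>\<^sup>+\<omega>. ZB \<omega> \<partial>M) = (\<Sum>k. q ^ k * (\<Sum>s. \<integral>\<^sup>+\<omega>. pre s k \<omega> * b (s + k + 1) \<omega> \<partial>M))"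
    unfolding ZB_def by (simp add: nn_integral_suminf nn_integral_cmult)
  \<comment> \<open>The index \<open>s + k + 1\<close> is deterministic, so independence separates
    off the moment \<beta>.\<close>
  also have "\<dots> = (\<Sum>k. q ^ k * (\<Sum>s. (\<integral>\<^sup>+\<omega>. pre s k \<omega> \<partial>M) * \<beta>))"
    unfolding b_def \<beta>_def by (intro suminf_cong arg_cong2[where f = "(*)"] refl B_indep pre_meas) auto
  also have "\<dots> = (\<Sum>k. q ^ k * (\<Sum>s. \<integral>\<^sup>+\<omega>. pre s k \<omega> \<partial>M)) * \<beta>"
    by (simp only: ennreal_suminf_multc mult.assoc[symmetric])
  \<comment> \<open>Term 0 collects the starts of the block; the later terms are the series of
    \<open>ZA\<close> shifted by one, with one more factor \<open>q\<close>.\<close>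
  also have "(\<Sum>k. q ^ k * (\<Sum>s. \<integral>\<^sup>+\<omega>. pre s k \<omega> \<partial>M))
      = (\<Sum>s. \<integral>\<^sup>+\<omega>. starts i s \<omega> \<partial>M) + q * (\<Sum>k. q ^ k * (\<Sum>s. \<integral>\<^sup>+\<omega>. path_weight w i s k \<omega> \<partial>M))"
    using suminf_offset[of "\<lambda>k. q ^ k * (\<Sum>s. \<integral>\<^sup>+\<omega>. pre s k \<omega> \<partial>M)" 1]
    by (simp add: pre_def mult.assoc)
  also have "(\<Sum>s. \<integral>\<^sup>+\<omega>. starts i s \<omega> \<partial>M) = (\<integral>\<^sup>+\<omega>. (\<Sum>s. starts i s \<omega>) \<partial>M)"
    by (rule nn_integral_suminf[symmetric]) measurable
  finally have int_ZB: "(\<integral>\<^sup>+\<omega>. ZB \<omega> \<partial>M) = ((\<integral>\<^sup>+\<omega>. (\<Sum>s. starts i s \<omega>) \<partial>M)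
      + q * (\<Sum>k. q ^ k * (\<Sum>s. \<integral>\<^sup>+\<omega>. path_weight w i s k \<omega> \<partial>M))) * \<beta>" .
  have "(\<integral>\<^sup>+\<omega>. (\<Sum>s. starts i s \<omega>) \<partial>M) \<le> (\<integral>\<^sup>+\<omega>. 1 \<partial>M)" by (intro nn_integral_mono suminf_starts_le)
  also have "\<dots> < \<infinity>" by (simp add: M.emeasure_space_1)
  finally have ZB_fin: "(\<integral>\<^sup>+\<omega>. ZB \<omega> \<partial>M) < \<infinity>"
    unfolding int_ZB using ZA_fin B_fin unfolding int_ZA
    by (simp add: q_def \<beta>_def ennreal_mult_less_top)
  define C where "C = (1 / (1 - exp (- \<epsilon> / \<alpha>))) powr \<alpha>"
  have C: "0 \<le> C" unfolding C_def by simp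
  have "AE \<omega> in M. infinite (regen_times \<omega>)"
    by (rule AE_infinite_regen_times) (rule hit)
  then have pointwise: "AE \<omega> in M. ennreal (\<bar>cycle_A f L X Y i \<omega>\<bar> powr \<alpha>) \<le> ZA \<omega> \<and>
      ennreal (\<bar>cycle_B f L X Y B i \<omega>\<bar> powr \<alpha>) \<le> ennreal C * ZB \<omega> \<and>
      ennreal (\<bar>cycle_M f L X Y B i \<omega>\<bar> powr \<alpha>) \<le> ennreal C * ZB \<omega>"
  proof eventually_elim
    case (elim \<omega>)
    have set_eq: "{n. 1 \<le> n \<and> X n \<omega> \<in> L \<and> Y n \<omega>} = regen_times \<omega>"
      by (simp add: regen_times_def regen_def)
    have "0 \<notin> regen_times \<omega>" by (simp add: regen_times_def)
    from block_start_exists[OF elim this, of i] obtain s where s: "block_start (regen_times \<omega>) i s"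
      "(case i of 0 \<Rightarrow> 1 | Suc j \<Rightarrow> enumerate (regen_times \<omega>) j + 1) = s + 1"
      "s < enumerate (regen_times \<omega>) i"
      "\<And>n. s < n \<Longrightarrow> n < enumerate (regen_times \<omega>) i \<Longrightarrow> n \<notin> regen_times \<omega>" by blast
    \<comment> \<open>The block occupies the times \<open>s + 1\<close> to \<open>s + n\<close>, and
      among these only \<open>s + n\<close> is a regeneration time.\<close>
    define n where "n = enumerate (regen_times \<omega>) i - s"
    have n: "0 < n" "enumerate (regen_times \<omega>) i = s + n" using s(3) unfolding n_def by auto
    have cs: "cycle_start L X Y \<omega> i = s + 1" using s(2) set_eq by (cases i) auto
    have ce: "cycle_start L X Y \<omega> (Suc i) = s + 1 + n" using set_eq n by simp
    let ?g = "\<lambda>j. f (X (s + 1 + j) \<omega>)"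
    have st: "starts i s \<omega> = 1" using s(1) by (simp add: starts_def)
    have no_regen: "\<not> regen (s + 1 + j) \<omega>" if "s + 1 + j < s + n" for j
      using s(4)[of "s + 1 + j"] that n by (auto simp: regen_times_def)
    have pw_eq: "path_weight w i s k \<omega> = ennreal (\<Prod>j<Suc k. exp (\<alpha> * ?g j))" if k: "k < n" for k
    proof -
      have "path_weight w i s k \<omega> = w (X (s + 1) \<omega>) * (\<Prod>j<k. w (X (s + 1 + j + 1) \<omega>))"
      proof -
        have "(\<Prod>j<k. indicator {\<omega>. \<not> regen (s + 1 + j) \<omega>} \<omega> * w (X (s + 1 + j + 1) \<omega>))
            = (\<Prod>j<k. w (X (s + 1 + j + 1) \<omega>))"
        proof (rule prod.cong[OF refl])
          fix j assume "j \<in> {..<k}"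
          then have "\<not> regen (s + 1 + j) \<omega>" using no_regen[of j] k by auto
          then show "indicator {\<omega>. \<not> regen (s + 1 + j) \<omega>} \<omega> * w (X (s + 1 + j + 1) \<omega>) = w (X (s + 1 + j + 1) \<omega>)"
            by simp
        qed
        then show ?thesis unfolding path_weight_def st by (simp only: mult_1)
      qed
      also have "\<dots> = (\<Prod>j<Suc k. w (X (s + 1 + j) \<omega>))"
        unfolding prod.lessThan_Suc_shift by simp
      also have "\<dots> = ennreal (\<Prod>j<Suc k. exp (\<alpha> * ?g j))"
        unfolding w_def expw_def by (rule prod_ennreal) simp
      finally show ?thesis .
    qed
    have pre_eq: "pre s k \<omega> = ennreal (\<Prod>j<k. exp (\<alpha> * ?g j))" if k: "k < n" for k
      using pw_eq k st by (cases k) (auto simp: pre_def)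
    have ZA: "path_weight w i s k \<omega> \<le> ZA \<omega>" for k
    proof -
      have "path_weight w i s k \<omega> \<le> (\<Sum>s. path_weight w i s k \<omega>)"
        using sum_le_suminf[of "\<lambda>s. path_weight w i s k \<omega>" "{s}"] by simp
      also have "\<dots> \<le> q ^ k * (\<Sum>s. path_weight w i s k \<omega>)"
        using mult_right_mono[OF one_le_power[OF q, of k]] by simp
      also have "\<dots> \<le> ZA \<omega>"
        unfolding ZA_def using sum_le_suminf[of "\<lambda>k. q ^ k * (\<Sum>s. path_weight w i s k \<omega>)" "{k}"] by simp
      finally show ?thesis .
    qed
    \<comment> \<open>The product over all \<open>n\<close> positions of the block is the path
      weight with \<open>k = n - 1\<close>.\<close>
    have "ennreal (\<bar>cycle_A f L X Y i \<omega>\<bar> powr \<alpha>) = path_weight w i s (n - 1) \<omega>"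
      using n pw_eq[of "n - 1"]
      unfolding cycle_A_def cs ce prod_atLeastLessThan_shift by (simp add: prod_nonneg prod_exp_powr)
    then have A: "ennreal (\<bar>cycle_A f L X Y i \<omega>\<bar> powr \<alpha>) \<le> ZA \<omega>" using ZA by simp
    define c where "c k = (\<Prod>j<k. exp (?g j)) * \<bar>B (s + 1 + k) \<omega>\<bar>" for k
    have c: "0 \<le> c k" for k unfolding c_def by (simp add: prod_nonneg)
    have c_powr: "ennreal (c k powr \<alpha>) = pre s k \<omega> * b (s + k + 1) \<omega>" if "k < n" for k
      using pre_eq[OF that] unfolding c_def b_def
      by (simp add: powr_mult prod_nonneg prod_exp_powr ennreal_mult)
    have ZB: "ennreal (z powr \<alpha>) \<le> ennreal C * ZB \<omega>" if z: "0 \<le> z" "z \<le> (\<Sum>k<n. c k)" for z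
    proof -
      have "z powr \<alpha> \<le> (\<Sum>k<n. c k) powr \<alpha>" using z \<alpha> by (intro powr_mono2) auto
      also have "\<dots> \<le> C * (\<Sum>k<n. exp (\<epsilon> * real k) * c k powr \<alpha>)"
        unfolding C_def by (rule powr_sum_le_weighted_sum[OF \<alpha> \<epsilon> c])
      finally have z_le: "ennreal (z powr \<alpha>) \<le> ennreal C * (\<Sum>k<n. ennreal (exp (\<epsilon> * real k) * c k powr \<alpha>))"
        using C by (simp add: sum_ennreal ennreal_mult[symmetric] sum_nonneg ennreal_leI)
      have "(\<Sum>k<n. ennreal (exp (\<epsilon> * real k) * c k powr \<alpha>)) = (\<Sum>k<n. q ^ k * (pre s k \<omega> * b (s + k + 1) \<omega>))"
        using c_powr by (intro sum.cong refl)
          (simp add: ennreal_mult q_def ennreal_power exp_of_nat_mult[symmetric] mult.commute)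
      also have "\<dots> \<le> (\<Sum>k<n. q ^ k * (\<Sum>s. pre s k \<omega> * b (s + k + 1) \<omega>))"
      proof (intro sum_mono mult_left_mono)
        fix k show "pre s k \<omega> * b (s + k + 1) \<omega> \<le> (\<Sum>s. pre s k \<omega> * b (s + k + 1) \<omega>)"
          using sum_le_suminf[of "\<lambda>s. pre s k \<omega> * b (s + k + 1) \<omega>" "{s}"] by simp
      qed simp
      also have "\<dots> \<le> ZB \<omega>" unfolding ZB_def by (intro sum_le_suminf) auto
      finally show ?thesis by (intro order_trans[OF z_le] mult_left_mono) auto
    qed
    have abs_le: "\<bar>perpetuity_sum (\<lambda>j. exp (f (X j \<omega>))) (\<lambda>j. B j \<omega>) (s + 1) t\<bar> \<le> (\<Sum>k<n. c k)"
      if t: "t \<le> s + 1 + n" for t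
    proof -
      have "\<bar>perpetuity_sum (\<lambda>j. exp (f (X j \<omega>))) (\<lambda>j. B j \<omega>) (s + 1) t\<bar>
          \<le> (\<Sum>k\<in>{s + 1..<s + 1 + n}. (\<Prod>j\<in>{s + 1..<k}. exp (f (X j \<omega>))) * \<bar>B k \<omega>\<bar>)"
        by (rule abs_perpetuity_sum_le) (use t in auto)
      also have "\<dots> = (\<Sum>k<n. c k)"
        unfolding sum_atLeastLessThan_shift prod_atLeastLessThan_shift c_def ..
      finally show ?thesis .
    qed
    have "\<bar>cycle_B f L X Y B i \<omega>\<bar> \<le> (\<Sum>k<n. c k)" unfolding cycle_B_def cs ce by (rule abs_le) simp
    moreover have "\<bar>cycle_M f L X Y B i \<omega>\<bar> \<le> (\<Sum>k<n. c k)"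
      unfolding cycle_M_def cs ce by (rule abs_cSUP_le) (use n abs_le in auto)
    ultimately show ?case using A ZB by simp
  qed
  have [measurable]: "b (s + k + 1) \<in> borel_measurable M" for s k by simp
  have [measurable]: "ZA \<in> borel_measurable M" "ZB \<in> borel_measurable M"
    unfolding ZA_def[abs_def] ZB_def[abs_def] by measurable
  have fin: "(\<integral>\<^sup>+\<omega>. g \<omega> \<partial>M) < \<infinity>" if "AE \<omega> in M. g \<omega> \<le> Z \<omega>" "(\<integral>\<^sup>+\<omega>. Z \<omega> \<partial>M) < \<infinity>" for g Z
    using nn_integral_mono_AE[OF that(1)] that(2) by (rule order_le_less_trans)
  have ZB_fin': "(\<integral>\<^sup>+\<omega>. ennreal C * ZB \<omega> \<partial>M) < \<infinity>"
    using ZB_fin by (simp add: nn_integral_cmult ennreal_mult_less_top)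
  show ?thesis unfolding finite_moment_def
  proof (intro conjI)
    show "(\<integral>\<^sup>+\<omega>. ennreal (\<bar>cycle_A f L X Y i \<omega>\<bar> powr \<alpha>) \<partial>M) < \<infinity>"
      by (rule fin[OF _ ZA_fin]) (use pointwise in \<open>eventually_elim, simp\<close>)
    show "(\<integral>\<^sup>+\<omega>. ennreal (\<bar>cycle_B f L X Y B i \<omega>\<bar> powr \<alpha>) \<partial>M) < \<infinity>"
      by (rule fin[OF _ ZB_fin']) (use pointwise in \<open>eventually_elim, simp\<close>)
    show "(\<integral>\<^sup>+\<omega>. ennreal (\<bar>cycle_M f L X Y B i \<omega>\<bar> powr \<alpha>) \<partial>M) < \<infinity>"
      by (rule fin[OF _ ZB_fin']) (use pointwise in \<open>eventually_elim, simp\<close>)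
  qed
qed

end

definition residual_kernel :: "('s \<Rightarrow> 's measure) \<Rightarrow> 's set \<Rightarrow> real \<Rightarrow> 's measure \<Rightarrow> 's \<Rightarrow> 's measure" where
  "residual_kernel P L \<delta> \<nu> x =
     (if x \<in> L then diff_measure (P x) (scale_measure (ennreal \<delta>) \<nu>) else P x)"

lemma
  assumes P: "P \<in> S \<rightarrow>\<^sub>M prob_algebra S" and L: "L \<in> sets S"
    and nu: "prob_space \<nu>" "sets \<nu> = sets S"
    and le: "\<And>x E. x \<in> L \<Longrightarrow> E \<in> sets S \<Longrightarrow> ennreal \<delta> * emeasure \<nu> E \<le> emeasure (P x) E"
  shows emeasure_residual_kernel: "x \<in> space S \<Longrightarrow> E \<in> sets S \<Longrightarrow>
      emeasure (P x) E = emeasure (residual_kernel P L \<delta> \<nu> x) E + ennreal \<delta> * indicator L x * emeasure \<nu> E"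
    and residual_kernel_measurable: "residual_kernel P L \<delta> \<nu> \<in> S \<rightarrow>\<^sub>M subprob_algebra S"
proof -
  have Px: "prob_space (P x)" "sets (P x) = sets S" if "x \<in> space S" for x
    using measurable_space[OF P that] by (auto simp: space_prob_algebra)
  have em: "emeasure (residual_kernel P L \<delta> \<nu> x) E
      = (if x \<in> L then emeasure (P x) E - ennreal \<delta> * emeasure \<nu> E else emeasure (P x) E)"
    if "x \<in> space S" "E \<in> sets S" for x E
  proof (cases "x \<in> L")
    case True
    have fin: "finite_measure (scale_measure (ennreal \<delta>) \<nu>)"
      using prob_space.emeasure_space_1[OF nu(1)]
      by (intro finite_measureI) (simp add: space_scale_measure)
    have "emeasure (diff_measure (P x) (scale_measure (ennreal \<delta>) \<nu>)) E
        = emeasure (P x) E - emeasure (scale_measure (ennreal \<delta>) \<nu>) E"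
      using True that Px[OF that(1)] nu le fin
      by (intro emeasure_diff_measure) (auto intro: prob_space.finite_measure)
    then show ?thesis using True by (simp add: residual_kernel_def)
  qed (simp add: residual_kernel_def)
  have fin: "ennreal \<delta> * emeasure \<nu> E \<noteq> \<infinity>" for E
    using prob_space.emeasure_le_1[OF nu(1), of E] by (auto simp: ennreal_mult_eq_top_iff top_unique)
  show "emeasure (P x) E = emeasure (residual_kernel P L \<delta> \<nu> x) E + ennreal \<delta> * indicator L x * emeasure \<nu> E"
    if "x \<in> space S" "E \<in> sets S" for x E
    using em[OF that] le[of x E] that fin[of E] by (auto simp: diff_add_cancel_ennreal)
  have sets: "sets (residual_kernel P L \<delta> \<nu> x) = sets S" if "x \<in> space S" for x
    using Px[OF that] by (simp add: residual_kernel_def)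
  show "residual_kernel P L \<delta> \<nu> \<in> S \<rightarrow>\<^sub>M subprob_algebra S"
  proof (rule measurable_subprob_algebra)
    fix x assume x: "x \<in> space S"
    then show "sets (residual_kernel P L \<delta> \<nu> x) = sets S" by (rule sets)
    then have sp: "space (residual_kernel P L \<delta> \<nu> x) = space S" by (rule sets_eq_imp_space_eq)
    show "subprob_space (residual_kernel P L \<delta> \<nu> x)"
    proof
      have "emeasure (residual_kernel P L \<delta> \<nu> x) (space S) \<le> emeasure (P x) (space S)"
        unfolding em[OF x sets.top] by (auto intro: diff_le_self_ennreal)
      also have "\<dots> \<le> 1" by (rule prob_space.emeasure_le_1[OF Px(1)[OF x]])
      finally show "emeasure (residual_kernel P L \<delta> \<nu> x) (space (residual_kernel P L \<delta> \<nu> x)) \<le> 1"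
        unfolding sp .
      show "space (residual_kernel P L \<delta> \<nu> x) \<noteq> {}" unfolding sp using x by auto
    qed
  next
    fix E assume E: "E \<in> sets S"
    note L [measurable]
    have [measurable]: "(\<lambda>x. emeasure (P x) E) \<in> borel_measurable S"
      by (rule measurable_emeasure_kernel[OF measurable_prob_algebraD[OF P] E])
    have "(\<lambda>x. if x \<in> L then emeasure (P x) E - ennreal \<delta> * emeasure \<nu> E else emeasure (P x) E) \<in> borel_measurable S"
      by measurable
    then show "(\<lambda>x. emeasure (residual_kernel P L \<delta> \<nu> x) E) \<in> borel_measurable S"
      using em[OF _ E] by (simp cong: measurable_cong)
  qed
qed

section \<open>The moment theorem\<close>

lemma (in prob_space) nn_integral_prod_indicator_tendsto_0:
  assumes [measurable]: "\<And>n. X n \<in> M \<rightarrow>\<^sub>M S" "L \<in> sets S"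
    and io: "AE \<omega> in M. \<exists>\<^sub>\<infinity>n. X n \<omega> \<in> L"
  shows "(\<lambda>n. \<integral>\<^sup>+\<omega>. (\<Prod>i=1..n::nat. indicator (space S - L) (X i \<omega>)) \<partial>M) \<longlonglongrightarrow> 0"
proof -
  have "(\<lambda>n. \<integral>\<^sup>+\<omega>. (\<Prod>i=1..n. indicator (space S - L) (X i \<omega>)) \<partial>M) \<longlonglongrightarrow> (\<integral>\<^sup>+\<omega>. 0 \<partial>M)"
  proof (rule nn_integral_dominated_convergence[where w = "\<lambda>_. 1"])
    show "AE \<omega> in M. (\<Prod>i=1..n. indicator (space S - L) (X i \<omega>)) \<le> (1::ennreal)" for n
      by (intro AE_I2 prod_le_1) (auto simp: indicator_def)
    show "AE \<omega> in M. (\<lambda>n. \<Prod>i=1..n. indicator (space S - L) (X i \<omega>)) \<longlonglongrightarrow> (0::ennreal)"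
      using io
    proof eventually_elim
      case (elim \<omega>)
      then obtain m where m: "m > 0" "X m \<omega> \<in> L" unfolding INFM_nat by blast
      have "(\<Prod>i=1..n. indicator (space S - L) (X i \<omega>)) = (0::ennreal)" if "n \<ge> m" for n
        using m that by (intro prod_zero) (auto intro!: bexI[of _ m])
      then show ?case
        by (intro tendsto_eventually) (auto simp: eventually_sequentially)
    qed
  qed (auto simp: emeasure_space_1)
  then show ?thesis by simp
qed

text \<open>Avoidance probabilities depend on \<open>P\<close> alone. Harris recurrence, stated for
  \<open>X\<close> under \<open>Pr\<close>, thereby becomes available for the split chain, which may
  live on other probability spaces.\<close>

lemma harris_recurrent_avoidance_tendsto_0:
  assumes P: "subkernel S P" and mc: "\<forall>x\<in>space S. markov_chain_from S P x (Pr x) X"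
    and har: "harris_recurrent S \<phi> Pr X" and L: "L \<in> sets S" "emeasure \<phi> L > 0" and x: "x \<in> space S"
  shows "(\<lambda>n. (kop P (indicator (space S - L)) ^^ n) (\<lambda>_. 1) x) \<longlonglongrightarrow> 0"
proof -
  have c: "markov_chain_from S P x (Pr x) X" using mc x by blast
  then interpret prob_space "Pr x" by (simp add: markov_chain_from_def)
  have "(\<lambda>n. \<integral>\<^sup>+\<omega>. (\<Prod>i=1..n. indicator (space S - L) (X i \<omega>)) \<partial>Pr x) \<longlonglongrightarrow> 0"
    using c har L x unfolding markov_chain_from_def harris_recurrent_def
    by (intro nn_integral_prod_indicator_tendsto_0) auto
  moreover have "(\<integral>\<^sup>+\<omega>. (\<Prod>i=1..n. indicator (space S - L) (X i \<omega>)) \<partial>Pr x)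
      = (kop P (indicator (space S - L)) ^^ n) (\<lambda>_. 1) x" for n
    using markov_chain_nn_integral[OF P x c, of "indicator (space S - L)" "\<lambda>_. 1" n] L by simp
  ultimately show ?thesis by simp
qed

lemma markov_chain_exp_additive_sum:
  assumes P: "subkernel S P" and mc: "\<forall>x\<in>space S. markov_chain_from S P x (Pr x) X"
    and x: "x \<in> space S" and [measurable]: "u \<in> borel_measurable S"
  shows "(\<integral>\<^sup>+\<omega>. ennreal (exp (\<Sum>i=1..n. u (X i \<omega>))) \<partial>Pr x) = (kop P (expw u) ^^ n) (\<lambda>_. 1) x"
proof -
  have "ennreal (exp (\<Sum>i=1..n. u (X i \<omega>))) = (\<Prod>i=1..n. expw u (X i \<omega>))" for \<omega>
    unfolding expw_def by (subst prod_ennreal) (auto simp: exp_sum)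
  then show ?thesis using markov_chain_nn_integral[OF P x, of "Pr x" X "expw u" "\<lambda>_. 1" n] mc x by simp
qed

lemma (in irreducible_kernel) AE_ex:
  assumes "AE x in \<phi>. F x" "E \<in> sets S" "emeasure \<phi> E > 0"
  shows "\<exists>x\<in>E. F x"
proof (rule ccontr)
  assume "\<not> (\<exists>x\<in>E. F x)"
  then have "AE x in \<phi>. x \<notin> E" using assms(1) by (auto elim: AE_mp)
  then have "emeasure \<phi> E = 0"
    using assms(2) sets_phi sets.sets_into_space[OF assms(2)]
    by (subst (asm) AE_iff_measurable[of E]) (auto simp: space_phi)
  then show False using assms(3) by simp
qed

text \<open>Each of the sets in (H3) has positive measure and so contains a point satisfying
  \<open>F\<close>; the infimum is at most the value at the chosen points.\<close>

lemma (in irreducible_kernel) condition_H3_good_points: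
  assumes H3: "condition_H3 S P \<phi> h" and a: "0 < a" and F: "AE x in \<phi>. F x"
  shows "\<exists>(l::nat) y D. (\<forall>i\<in>{1..l}. y i \<in> space S \<and> F (y i)) \<and>
      (\<forall>x\<in>sublevel S h a. \<forall>E\<in>sets S. emeasure (P x) E \<le> ennreal D * (\<Sum>i=1..l. emeasure (P (y i)) E))"
proof -
  obtain l :: nat and Es D where Es: "\<forall>i\<in>{1..l}. Es i \<in> sets S \<and> emeasure \<phi> (Es i) > 0"
    and D: "\<forall>x\<in>sublevel S h a. \<forall>E\<in>sets S.
      emeasure (P x) E \<le> ennreal D * (INF y\<in>(\<Pi>\<^sub>E i\<in>{1..l}. Es i). \<Sum>i=1..l. emeasure (P (y i)) E)"
    using H3[unfolded condition_H3_def, rule_format, OF a] by (elim exE conjE) (rule that)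
  have "\<forall>i\<in>{1..l}. \<exists>z. z \<in> Es i \<and> F z" using AE_ex[OF F] Es by blast
  then obtain y where y: "\<And>i. i \<in> {1..l} \<Longrightarrow> y i \<in> Es i \<and> F (y i)" by metis
  let ?y = "\<lambda>i\<in>{1..l}. y i"
  have yE: "?y \<in> (\<Pi>\<^sub>E i\<in>{1..l}. Es i)" using y by auto
  have "emeasure (P x) E \<le> ennreal D * (\<Sum>i=1..l. emeasure (P (?y i)) E)"
    if "x \<in> sublevel S h a" "E \<in> sets S" for x E
    using D[rule_format, OF that] by (rule order_trans) (intro mult_left_mono INF_lower yE, simp)
  moreover have "?y i \<in> space S \<and> F (?y i)" if "i \<in> {1..l}" for i
    using y[OF that] sets.sets_into_space[of "Es i" S] Es that by auto
  ultimately show ?thesis by (intro exI[of _ l] exI[of _ ?y] exI[of _ D]) blast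
qed

text \<open>Off \<open>L = {h \<le> a}\<close> every step contributes more than \<open>\<beta> a\<close> to \<open>\<beta> S\<^sub>n\<^sup>(\<^sup>h\<^sup>)\<close>, so for large \<open>a\<close> the
  excursions from \<open>L\<close> are exponentially light, uniformly better than the growth rate \<open>C\<close>.\<close>

lemma (in split_kernel) excursion_finite:
  fixes f h :: "'s \<Rightarrow> real"
  assumes [measurable]: "f \<in> borel_measurable S" "h \<in> borel_measurable S"
    and h: "\<And>y. y \<in> space S \<Longrightarrow> 0 \<le> h y" "\<And>y. y \<in> space S - L \<Longrightarrow> C + 2 \<le> \<beta> * h y"
    and \<beta>: "0 \<le> \<beta>" and x: "x \<in> space S"
    and fin: "(\<Sum>n. ennreal (exp (- C)) ^ n * (kop P (expw (\<lambda>y. \<alpha> * f y + \<beta> * h y)) ^^ n) (\<lambda>_. 1) x) < \<infinity>"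
  shows "excursion (\<lambda>y. \<alpha> * f y + 2) x < \<infinity>"
proof -
  let ?q = "ennreal (exp (- C))" and ?w = "expw (\<lambda>y. \<alpha> * f y + \<beta> * h y)" and ?v = "expw (\<lambda>y. \<alpha> * f y + 2)"
  let ?E = "\<lambda>n. (kop P ?w ^^ n) (\<lambda>_. 1)"
  \<comment> \<open>Off \<open>L\<close> the term \<open>\<beta> * h\<close> pays for both the
    summand 2 and the discount \<open>C\<close>.\<close>
  have avoid: "indicator (space S - L) y * ?v y \<le> ?q * ?w y" if "y \<in> space S" for y
    using h(2)[of y] that
    by (auto simp: indicator_def expw_def ennreal_mult[symmetric] exp_add[symmetric] intro!: ennreal_leI)
  \<comment> \<open>The last step may end in \<open>L\<close>, where only \<open>0 \<le> h\<close>
    is known; it costs the constant factor \<open>exp 2\<close>.\<close>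
  have step: "kop P ?v (\<lambda>_. 1) y \<le> ennreal (exp 2) * ?E 1 y" if y: "y \<in> space S" for y
  proof -
    have "?v z \<le> ennreal (exp 2) * ?w z" if "z \<in> space S" for z
      using h(1)[OF that] \<beta>
      by (auto simp: expw_def ennreal_mult[symmetric] exp_add[symmetric] intro!: ennreal_leI)
    then have "kop P ?v (\<lambda>_. 1) y \<le> kop P ?w (\<lambda>_. ennreal (exp 2) * 1) y"
      by (intro kop_mono y) (simp add: mult.commute)
    also have "\<dots> = ennreal (exp 2) * ?E 1 y" by (subst kop_cmult[OF y]) simp_all
    finally show ?thesis .
  qed
  have "excursion (\<lambda>y. \<alpha> * f y + 2) x \<le> (\<Sum>n. ennreal (exp 2) * (?q ^ n * ?E (Suc n) x))"
    unfolding excursion_def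
  proof (intro suminf_le)
    fix n
    have "(kop P (\<lambda>y. indicator (space S - L) y * ?v y) ^^ n) (kop P ?v (\<lambda>_. 1)) x
        \<le> (kop P (\<lambda>y. ?q * ?w y) ^^ n) (\<lambda>y. ennreal (exp 2) * ?E 1 y) x"
      by (intro kop_funpow_mono x avoid step)
    also have "\<dots> = ennreal (exp 2) * (kop P (\<lambda>y. ?q * ?w y) ^^ n) (?E 1) x"
      by (rule kop_funpow_cmult[OF x]) measurable
    also have "(kop P (\<lambda>y. ?q * ?w y) ^^ n) (?E 1) x = ?q ^ n * (kop P ?w ^^ n) (?E 1) x"
      by (rule kop_funpow_scale) (use x in measurable)
    also have "(kop P ?w ^^ n) (?E 1) x = ?E (Suc n) x" by (simp add: funpow_swap1)
    finally show "(kop P (\<lambda>y. indicator (space S - L) y * ?v y) ^^ n) (kop P ?v (\<lambda>_. 1)) x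
        \<le> ennreal (exp 2) * (?q ^ n * ?E (Suc n) x)" .
  qed auto
  \<comment> \<open>The last step is included in the iterate but not in the discount; supplying the
    missing factor costs \<open>exp C\<close>.\<close>
  also have "\<dots> = (\<Sum>n. ennreal (exp 2 * exp C) * (?q ^ Suc n * ?E (Suc n) x))"
  proof (intro suminf_cong)
    fix n
    have "ennreal (exp 2 * exp C) * ?q = ennreal (exp 2)"
      by (simp add: ennreal_mult[symmetric] exp_minus)
    then show "ennreal (exp 2) * (?q ^ n * ?E (Suc n) x) = ennreal (exp 2 * exp C) * (?q ^ Suc n * ?E (Suc n) x)"
      by (simp only: power_Suc mult.assoc[symmetric])
  qed
  also have "\<dots> = ennreal (exp 2 * exp C) * (\<Sum>n. ?q ^ Suc n * ?E (Suc n) x)" by simp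
  also have "\<dots> \<le> ennreal (exp 2 * exp C) * (\<Sum>n. ?q ^ n * ?E n x)"
    using suminf_offset[of "\<lambda>n. ?q ^ n * ?E n x" 1] by (intro mult_left_mono) auto
  also have "\<dots> < \<infinity>" using fin by (simp add: ennreal_mult_less_top)
  finally show ?thesis .
qed

lemma finite_lower_moment:
  fixes \<alpha> \<alpha>0 :: real
  assumes "prob_space \<mu>" "sets \<mu> = sets borel" "0 \<le> \<alpha>" "\<alpha> \<le> \<alpha>0"
    and fin: "(\<integral>\<^sup>+b. ennreal (\<bar>b\<bar> powr \<alpha>0) \<partial>\<mu>) < \<infinity>"
  shows "(\<integral>\<^sup>+b. ennreal (\<bar>b\<bar> powr \<alpha>) \<partial>\<mu>) < \<infinity>"
proof -
  interpret prob_space \<mu> by fact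
  have [measurable_cong]: "sets \<mu> = sets borel" by fact
  have "\<bar>b\<bar> powr \<alpha> \<le> 1 + \<bar>b\<bar> powr \<alpha>0" for b :: real
  proof (cases "\<bar>b\<bar> \<le> 1")
    case True
    then have "\<bar>b\<bar> powr \<alpha> \<le> 1" using assms by (intro powr_le1) auto
    then show ?thesis using powr_ge_zero[of "\<bar>b\<bar>" "\<alpha>0"] by linarith
  next
    case False
    then have "\<bar>b\<bar> powr \<alpha> \<le> \<bar>b\<bar> powr \<alpha>0" using assms by (intro powr_mono) auto
    then show ?thesis by simp
  qed
  then have "(\<integral>\<^sup>+b. ennreal (\<bar>b\<bar> powr \<alpha>) \<partial>\<mu>) \<le> (\<integral>\<^sup>+b. 1 + ennreal (\<bar>b\<bar> powr \<alpha>0) \<partial>\<mu>)"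
    by (intro nn_integral_mono) (simp flip: ennreal_1 ennreal_plus)
  also have "\<dots> = 1 + (\<integral>\<^sup>+b. ennreal (\<bar>b\<bar> powr \<alpha>0) \<partial>\<mu>)"
    by (subst nn_integral_add) (auto simp: emeasure_space_1)
  also have "\<dots> < \<infinity>" using fin by simp
  finally show ?thesis .
qed

lemma Lambda_eq_growth_rate:
  "Lambda \<phi> Pr X f \<alpha> = common_value \<phi> (\<lambda>x. growth_rate (\<lambda>n.
     \<integral>\<^sup>+\<omega>. ennreal (exp (\<Sum>i=1..n. \<alpha> * f (X i \<omega>))) \<partial>Pr x))"
  unfolding Lambda_def growth_rate_def additive_sum_def by (simp add: sum_distrib_left)

lemma Lambda2_eq_growth_rate:
  "Lambda2 \<phi> Pr X f h \<alpha> \<beta> = common_value \<phi> (\<lambda>x. growth_rate (\<lambda>n.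
     \<integral>\<^sup>+\<omega>. ennreal (exp (\<Sum>i=1..n. \<alpha> * f (X i \<omega>) + \<beta> * h (X i \<omega>))) \<partial>Pr x))"
  unfolding Lambda2_def growth_rate_def additive_sum_def by (simp add: sum_distrib_left sum.distrib)

text \<open>Puts 0 into the set whose supremum is \<open>frak_r\<close>, so that
  \<open>0 \<le> r\<close>, as \<open>cycle_moment\<close> requires.\<close>

lemma (in irreducible_kernel) Lambda_0_le:
  assumes "\<And>x. x \<in> space S \<Longrightarrow> prob_space (Pr x)"
  shows "Lambda \<phi> Pr X f 0 \<le> 0"
proof -
  have "AE x in \<phi>. growth_rate (\<lambda>n. \<integral>\<^sup>+\<omega>. ennreal (exp (\<Sum>i=1..n. 0 * f (X i \<omega>))) \<partial>Pr x) = 0"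
    using AE_phi_space
  proof eventually_elim
    case (elim x)
    have "log_ennreal 1 = 0" by (simp add: log_ennreal_def)
    then show ?case using prob_space.emeasure_space_1[OF assms[OF elim]]
      by (simp add: growth_rate_def Limsup_const)
  qed
  then show ?thesis unfolding Lambda_eq_growth_rate by (subst common_value_eqI) auto
qed

theorem theorem4p2:
  fixes S :: "'s measure" and P :: "'s \<Rightarrow> 's measure" and \<phi> :: "'s measure"
    and f h :: "'s \<Rightarrow> real" and \<mu>B :: "real measure"
    and Pr :: "'s \<Rightarrow> 'w measure" and X :: "nat \<Rightarrow> 'w \<Rightarrow> 's"
  assumes "countably_generated S"
    and "P \<in> S \<rightarrow>\<^sub>M prob_algebra S"
    and "maximal_irreducibility_measure S P \<phi>"
    and "aperiodic S P \<phi>"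
    and "\<forall>x\<in>space S. markov_chain_from S P x (Pr x) X"
    and "harris_recurrent S \<phi> Pr X"
    and "f \<in> borel_measurable S"
    and "prob_space \<mu>B" and "sets \<mu>B = sets borel"
    and "AE x in \<phi>. \<exists>N>0. \<forall>n\<ge>N. spread_out (distr (Pr x) borel (additive_sum f X n))"
    and "h \<in> borel_measurable S" and "\<forall>x\<in>space S. 0 \<le> h x"
    and "condition_M S P h"
    and "condition_H2 \<phi> Pr X f h \<mu>B"
    and "condition_H3 S P \<phi> h"
  shows "\<forall>\<^sub>F a in at_top.
    \<forall>\<delta> \<nu> b (Q :: 's \<Rightarrow> 'v measure) X' Y B.
      minorization S P h a \<delta> \<nu> \<longrightarrow>
      emeasure \<nu> (sublevel S h a \<inter> sublevel S f b) = 1 \<longrightarrow>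
      (\<forall>x\<in>space S. split_chain_from S P (sublevel S h a) \<delta> \<nu> \<mu>B x (Q x) X' Y B) \<longrightarrow>
      (\<exists>\<alpha>::real. ereal \<alpha> > frak_r \<phi> Pr X f \<and>
        (\<forall>x\<in>space S. \<forall>i\<ge>1.
           finite_moment \<alpha> (Q x) (cycle_A f (sublevel S h a) X' Y i) \<and>
           finite_moment \<alpha> (Q x) (cycle_B f (sublevel S h a) X' Y B i) \<and>
           finite_moment \<alpha> (Q x) (cycle_M f (sublevel S h a) X' Y B i)) \<and>
        (AE x in \<phi>.
           finite_moment \<alpha> (Q x) (cycle_A f (sublevel S h a) X' Y 0) \<and>
           finite_moment \<alpha> (Q x) (cycle_B f (sublevel S h a) X' Y B 0) \<and>
           finite_moment \<alpha> (Q x) (cycle_M f (sublevel S h a) X' Y B 0)))"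
proof -
  note P = assms(2) and mc = assms(5) and [measurable] = assms(7,11)
  interpret irreducible_kernel S P \<phi>
    using assms(3) by unfold_locales (auto simp: measurable_prob_algebraD[OF P] maximal_irreducibility_measure_def)
  have P_prob: "prob_space (P x)" if "x \<in> space S" for x
    using measurable_space[OF P that] by (simp add: space_prob_algebra)
  have subk: "subkernel S P" by unfold_locales
  obtain \<alpha>0 \<beta> where \<alpha>0: "frak_r \<phi> Pr X f < ereal \<alpha>0" and \<beta>: "0 < \<beta>"
    and L2: "Lambda2 \<phi> Pr X f h \<alpha>0 \<beta> < \<infinity>" and LB: "LambdaB \<mu>B \<alpha>0 < \<infinity>"
    using assms(14) unfolding condition_H2_def by blast
  have r0: "0 \<le> frak_r \<phi> Pr X f"
  proof -
    have "Lambda \<phi> Pr X f 0 \<le> 0"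
      using mc by (intro Lambda_0_le) (auto simp: markov_chain_from_def)
    then show ?thesis unfolding frak_r_def by (intro SUP_upper2[of 0]) auto
  qed
  then obtain r where r: "frak_r \<phi> Pr X f = ereal r" using \<alpha>0 by (cases "frak_r \<phi> Pr X f") auto
  have r': "0 \<le> r" "r < \<alpha>0" using r0 \<alpha>0 unfolding r by auto
  \<comment> \<open>Any real number above the growth rate in (H2) will do; the threshold for
    \<open>a\<close> depends on it.\<close>
  obtain C where "Lambda2 \<phi> Pr X f h \<alpha>0 \<beta> < ereal C"
    using L2 ereal_dense2 by blast
  then have growth: "AE x in \<phi>. (\<Sum>n. ennreal (exp (- C)) ^ n
      * (kop P (expw (\<lambda>y. \<alpha>0 * f y + \<beta> * h y)) ^^ n) (\<lambda>_. 1) x) < \<infinity>"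
    unfolding Lambda2_eq_growth_rate
    by (rule common_growth_rate_less_imp_summable[rotated 2])
       (measurable, rule markov_chain_exp_additive_sum[OF subk mc], assumption, measurable)
  have subcritical: "AE x in \<phi>. (\<Sum>n. ennreal (exp (- c)) ^ n * (kop P (expw (\<lambda>y. \<alpha> * f y)) ^^ n) (\<lambda>_. 1) x) < \<infinity>"
    if "Lambda \<phi> Pr X f \<alpha> \<le> 0" "0 < c" for \<alpha> c
  proof (rule common_growth_rate_less_imp_summable)
    have "Lambda \<phi> Pr X f \<alpha> < ereal c" using that by (auto intro: order_le_less_trans)
    then show "common_value \<phi> (\<lambda>x. growth_rate (\<lambda>n. \<integral>\<^sup>+\<omega>. ennreal (exp (\<Sum>i=1..n. \<alpha> * f (X i \<omega>))) \<partial>Pr x)) < ereal c"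
      unfolding Lambda_eq_growth_rate .
    show "(\<integral>\<^sup>+\<omega>. ennreal (exp (\<Sum>i=1..n. \<alpha> * f (X i \<omega>))) \<partial>Pr x) = (kop P (expw (\<lambda>y. \<alpha> * f y)) ^^ n) (\<lambda>_. 1) x"
      if "x \<in> space S" for n x
      by (rule markov_chain_exp_additive_sum[OF subk mc that]) measurable
  qed measurable
  \<comment> \<open>Whether \<open>Lambda \<le> 0\<close> holds at \<open>r\<close> itself is left
    open; \<open>renewal_le_1_limit\<close> needs only exponents arbitrarily close to
    \<open>r\<close> from below.\<close>
  have approx: "\<exists>\<alpha>. r - e < \<alpha> \<and> \<alpha> \<le> r \<and> Lambda \<phi> Pr X f \<alpha> \<le> 0" if e: "0 < e" for e
  proof -
    have "ereal (r - e) < frak_r \<phi> Pr X f" unfolding r using e by simp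
    then obtain \<alpha> where \<alpha>: "Lambda \<phi> Pr X f \<alpha> \<le> 0" "r - e < \<alpha>"
      unfolding frak_r_def less_SUP_iff by auto
    have "ereal \<alpha> \<le> frak_r \<phi> Pr X f" unfolding frak_r_def using \<alpha> by (intro SUP_upper) simp
    then show ?thesis using \<alpha> unfolding r by auto
  qed
  have B0: "(\<integral>\<^sup>+b. ennreal (\<bar>b\<bar> powr \<alpha>0) \<partial>\<mu>B) < \<infinity>"
    using LB unfolding LambdaB_def log_ennreal_less_top_iff .
  have sub_sets: "sublevel S g a \<in> sets S" if [measurable]: "g \<in> borel_measurable S" for g a
    unfolding sublevel_def by measurable
  \<comment> \<open>The sublevel sets of \<open>h\<close> exhaust the space, so one of them has
    positive measure.\<close>
  have "\<exists>k::nat. emeasure \<phi> (sublevel S h (real k)) > 0"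
  proof (rule ccontr)
    assume "\<not> ?thesis"
    then have "(\<Union>k. sublevel S h (real k)) \<in> null_sets \<phi>"
      using sub_sets[of h] sets_phi by (intro null_sets_UN) (auto simp: null_sets_def)
    moreover have "(\<Union>k. sublevel S h (real k)) = space S"
      by (auto simp: sublevel_def intro: real_arch_simple)
    ultimately show False using not_AE_False by (auto simp: AE_False_iff space_phi)
  qed
  then obtain k where k: "emeasure \<phi> (sublevel S h (real k)) > 0" by blast
  \<comment> \<open>The three lower bounds: (H3) speaks of positive \<open>a\<close>, the set
    \<open>L\<close> must have positive measure under \<phi>, and off \<open>L\<close> the term
    \<open>\<beta> * h\<close> must reach \<open>C + 2\<close>.\<close>
  have "\<forall>\<^sub>F a in at_top. a \<ge> max 1 (max (real k) ((C + 2) / \<beta>))" by (rule eventually_ge_at_top)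
  then show ?thesis
  proof (rule eventually_mono, intro allI impI)
    fix a \<delta> \<nu> b and Q :: "'s \<Rightarrow> 'v measure" and X' Y B
    assume a: "max 1 (max (real k) ((C + 2) / \<beta>)) \<le> a" and min: "minorization S P h a \<delta> \<nu>"
      and nu1: "emeasure \<nu> (sublevel S h a \<inter> sublevel S f b) = 1"
      and chain: "\<forall>x\<in>space S. split_chain_from S P (sublevel S h a) \<delta> \<nu> \<mu>B x (Q x) X' Y B"
    define L where "L = sublevel S h a"
    define R where "R = residual_kernel P L \<delta> \<nu>"
    have L: "L \<in> sets S" unfolding L_def by (rule sub_sets) measurable
    have \<nu>: "prob_space \<nu>" "sets \<nu> = sets S" and \<delta>: "0 < \<delta>"
      and le: "\<And>x E. x \<in> L \<Longrightarrow> E \<in> sets S \<Longrightarrow> ennreal \<delta> * emeasure \<nu> E \<le> emeasure (P x) E"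
      using min unfolding minorization_def L_def[symmetric]
      by (auto simp: L_def sublevel_def split: split_indicator_asm)
    have phiL: "emeasure \<phi> L > 0"
    proof -
      have "emeasure \<phi> (sublevel S h (real k)) \<le> emeasure \<phi> L"
        using a L sets_phi by (intro emeasure_mono) (auto simp: L_def sublevel_def)
      then show ?thesis using k by (rule less_le_trans[rotated])
    qed
    have nuL: "emeasure \<nu> L = 1"
    proof (rule antisym)
      show "emeasure \<nu> L \<le> 1" by (rule prob_space.emeasure_le_1[OF \<nu>(1)])
      show "1 \<le> emeasure \<nu> L"
        unfolding nu1[symmetric] using L \<nu>(2) by (intro emeasure_mono) (auto simp: L_def)
    qed
    have f_le: "AE y in \<nu>. f y \<le> b"
    proof -
      have "AE y in \<nu>. y \<in> sublevel S h a \<inter> sublevel S f b"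
        by (intro prob_space.AE_prob_1[OF \<nu>(1)]) (simp add: measure_def nu1)
      then show ?thesis by eventually_elim (auto simp: sublevel_def)
    qed
    interpret split_kernel S P \<phi> R L \<delta> \<nu>
    proof (intro split_kernel.intro split_kernel_axioms.intro subkernel.intro)
      show "irreducible_kernel S P \<phi>" by unfold_locales
      show "R \<in> S \<rightarrow>\<^sub>M subprob_algebra S"
        unfolding R_def by (rule residual_kernel_measurable[OF P L \<nu> le])
      show "emeasure (P x) E = emeasure (R x) E + ennreal \<delta> * indicator L x * emeasure \<nu> E"
        if "x \<in> space S" "E \<in> sets S" for x E
        unfolding R_def by (rule emeasure_residual_kernel[OF P L \<nu> le that])
    qed fact+
    have crit: "ennreal \<delta> * (\<integral>\<^sup>+y. expw (\<lambda>y. r * f y) y *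
        (\<Sum>n. (kop R (expw (\<lambda>y. r * f y)) ^^ n) (indicator L) y) \<partial>\<nu>) \<le> 1"
    proof (rule renewal_le_1_limit)
      fix e :: real assume "0 < e"
      then obtain \<alpha> where "r - e < \<alpha>" "\<alpha> \<le> r" and \<alpha>: "Lambda \<phi> Pr X f \<alpha> \<le> 0" using approx by blast
      moreover have "ennreal \<delta> * (\<integral>\<^sup>+y. expw (\<lambda>y. \<alpha> * f y) y *
          (\<Sum>n. (kop R (expw (\<lambda>y. \<alpha> * f y)) ^^ n) (indicator L) y) \<partial>\<nu>) \<le> 1"
        by (rule renewal_le_1) (use subcritical[OF \<alpha>] in measurable)
      ultimately show "\<exists>\<alpha>. r - e < \<alpha> \<and> \<alpha> \<le> r \<and> ennreal \<delta> * (\<integral>\<^sup>+y. expw (\<lambda>y. \<alpha> * f y) y *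
          (\<Sum>n. (kop R (expw (\<lambda>y. \<alpha> * f y)) ^^ n) (indicator L) y) \<partial>\<nu>) \<le> 1" by blast
    qed measurable
    have exc: "AE x in \<phi>. excursion (\<lambda>y. \<alpha>0 * f y + 2) x < \<infinity>"
      using growth AE_phi_space
    proof eventually_elim
      case (elim x)
      show ?case
      proof (rule excursion_finite[OF _ _ _ _ _ elim(2) elim(1)])
        fix y assume y: "y \<in> space S - L"
        then have "a \<le> h y" by (auto simp: L_def sublevel_def)
        then have "\<beta> * a \<le> \<beta> * h y" using \<beta> by simp
        moreover have "C + 2 \<le> \<beta> * a" using a \<beta> by (simp add: field_simps)
        ultimately show "C + 2 \<le> \<beta> * h y" by simp
      qed (use \<beta> assms(12) in auto)
    qed
    obtain \<alpha> \<epsilon> where \<alpha>: "r < \<alpha>" "\<alpha> \<le> \<alpha>0" and \<epsilon>: "0 < \<epsilon>" and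
      nu_fin: "(\<integral>\<^sup>+y. expw (\<lambda>y. \<alpha> * f y) y * (\<Sum>n. (kop R (expw (\<lambda>y. \<alpha> * f y + \<epsilon>)) ^^ n) (\<lambda>_. 1) y) \<partial>\<nu>) < \<infinity>" and
      P_fin: "AE x in \<phi>. kop P (expw (\<lambda>y. \<alpha> * f y)) (\<lambda>y. \<Sum>n. (kop R (expw (\<lambda>y. \<alpha> * f y + \<epsilon>)) ^^ n) (\<lambda>_. 1) y) x < \<infinity>"
      using cycle_moment[OF assms(7) r' crit exc _ f_le] condition_H3_good_points[OF assms(15), of a] a
      unfolding L_def by auto
    have \<alpha>_pos: "0 < \<alpha>" using \<alpha> r' by simp
    have B_fin: "(\<integral>\<^sup>+b. ennreal (\<bar>b\<bar> powr \<alpha>) \<partial>\<mu>B) < \<infinity>"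
      by (rule finite_lower_moment[OF assms(8,9) _ _ B0]) (use \<alpha> \<alpha>_pos in auto)
    have hit: "(\<lambda>n. (kop P (indicator (space S - L)) ^^ n) (\<lambda>_. 1) x) \<longlonglongrightarrow> 0" if "x \<in> space S" for x
      by (rule harris_recurrent_avoidance_tendsto_0[OF subk mc assms(6) L phiL that])
    have sc: "split_chain S P \<phi> R L \<delta> \<nu> (Q x) \<mu>B x X' Y B" if x: "x \<in> space S" for x
    proof -
      have c: "split_chain_from S P L \<delta> \<nu> \<mu>B x (Q x) X' Y B" using chain x unfolding L_def by blast
      then interpret Q: prob_space "Q x" by (simp add: split_chain_from_def)
      show ?thesis
      proof unfold_locales
        show "emeasure (P y) (space S) = 1" if "y \<in> space S" for y
          using prob_space.emeasure_space_1[OF P_prob[OF that]] space_kernel[OF that] by simp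
      qed (use x c in auto)
    qed
    show "\<exists>\<alpha>::real. ereal \<alpha> > frak_r \<phi> Pr X f \<and>
        (\<forall>x\<in>space S. \<forall>i\<ge>1.
           finite_moment \<alpha> (Q x) (cycle_A f (sublevel S h a) X' Y i) \<and>
           finite_moment \<alpha> (Q x) (cycle_B f (sublevel S h a) X' Y B i) \<and>
           finite_moment \<alpha> (Q x) (cycle_M f (sublevel S h a) X' Y B i)) \<and>
        (AE x in \<phi>.
           finite_moment \<alpha> (Q x) (cycle_A f (sublevel S h a) X' Y 0) \<and>
           finite_moment \<alpha> (Q x) (cycle_B f (sublevel S h a) X' Y B 0) \<and>
           finite_moment \<alpha> (Q x) (cycle_M f (sublevel S h a) X' Y B 0))"
      unfolding L_def[symmetric]
    proof (intro exI[of _ \<alpha>] conjI ballI allI impI)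
      show "frak_r \<phi> Pr X f < ereal \<alpha>" using \<alpha> unfolding r by simp
    next
      fix x and i :: nat assume x: "x \<in> space S" and i: "1 \<le> i"
      interpret split_chain S P \<phi> R L \<delta> \<nu> "Q x" \<mu>B x X' Y B by (rule sc[OF x])
      have "entrance i (\<lambda>y. expw (\<lambda>y. \<alpha> * f y) y * (\<Sum>n. (kop R (expw (\<lambda>y. \<alpha> * f y + \<epsilon>)) ^^ n) (\<lambda>_. 1) y)) < \<infinity>"
        using i nu_fin by (cases i) auto
      from cycle_moments[OF assms(7) \<alpha>_pos \<epsilon> this B_fin hit]
      show "finite_moment \<alpha> (Q x) (cycle_A f L X' Y i)" "finite_moment \<alpha> (Q x) (cycle_B f L X' Y B i)"
        "finite_moment \<alpha> (Q x) (cycle_M f L X' Y B i)" by auto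
    next
      show "AE x in \<phi>. finite_moment \<alpha> (Q x) (cycle_A f L X' Y 0) \<and>
          finite_moment \<alpha> (Q x) (cycle_B f L X' Y B 0) \<and> finite_moment \<alpha> (Q x) (cycle_M f L X' Y B 0)"
        using P_fin AE_phi_space
      proof eventually_elim
        case (elim x)
        interpret split_chain S P \<phi> R L \<delta> \<nu> "Q x" \<mu>B x X' Y B by (rule sc[OF elim(2)])
        \<comment> \<open>Block 0 enters through \<open>P x\<close>, so its bound is only the
          almost-everywhere statement \<open>P_fin\<close>; later blocks enter through \<nu> and are
          bounded for every initial state.\<close>
        have "entrance 0 (\<lambda>y. expw (\<lambda>y. \<alpha> * f y) y * (\<Sum>n. (kop R (expw (\<lambda>y. \<alpha> * f y + \<epsilon>)) ^^ n) (\<lambda>_. 1) y)) < \<infinity>"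
          using elim(1) by (simp add: kop_def[of _ _ _ x])
        from cycle_moments[OF assms(7) \<alpha>_pos \<epsilon> this B_fin hit] show ?case .
      qed
    qed
  qed
qed

end
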